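(* Let $\mathbf{B}(t)\in\mathring{\mathbb{V}}_2$ be time-differentiable and $\mathbf{E}_{H_M}(t),\mathbf{j}(t)\in\mathring{\mathbb{V}}_1$ satisfy, with $\mathcal{B}=P(\mathbf{B})$ the $L^2$-projection of $\mathbf{B}$ into $\mathring{\mathbb{V}}_1$, $$\frac{\partial\mathbf{B}}{\partial t}+\nabla\times\mathbf{E}_{H_M}=0,\qquad\langle\mathbf{\Sigma},\mathbf{j}\rangle=\Big\langle\nabla\times\mathbf{\Sigma},\frac1{\mu_0}\mathbf{B}\Big\rangle\quad\forall\mathbf{\Sigma}\in\mathring{\mathbb{V}}_1,$$ $$\langle\boldsymbol{\omega},\mathbf{E}_{H_M}\rangle=\langle\boldsymbol{\omega},-\mathbf{F}/n\times\mathcal{B}\rangle+\int_\Gamma h_e^2\kappa_B[\![\mathcal{B}\times\boldsymbol{\omega}]\!]'\cdot[\![\mathcal{B}\times\mathbf{j}]\!]'\,dS\qquad\forall\boldsymbol{\omega}\in\mathring{\mathbb{V}}_1.$$ Assume there is a time-differentiable magnetic vector potential $\mathbf{A}(t)\in\mathbb{V}_1$ with $$\nabla\times\mathbf{A}=\mathbf{B},\qquad\frac{\partial\mathbf{A}}{\partial t}=-\mathbf{E}_{H_M}+\nabla\Phi$$ for some scalar potential $\Phi(t)\in\mathbb{V}_0$. Then the total magnetic helicity $H_M=\langle\mathbf{A},\mathbf{B}\rangle$ is conserved: $\frac{d}{dt}\langle\mathbf{A},\mathbf{B}\rangle=0$.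
   Context: $\Omega\subset\mathbb{R}^3$ is a bounded domain (possibly periodic, in which case boundary conditions are absent) with a finite element mesh, $\mathbf{n}$ its outward unit normal, $\langle\cdot,\cdot\rangle$ the $L^2(\Omega)$ inner product. $\mathbb{V}_0\subset H^1(\Omega)$, $\mathbb{V}_1\subset H(\mathrm{curl};\Omega)$, $\mathbb{V}_2\subset H(\mathrm{div};\Omega)$, $\mathbb{V}_3\subset L^2(\Omega)$ are finite-dimensional finite element spaces of cell-wise smooth functions forming a discrete de Rham complex: $\nabla\mathbb{V}_0\subset\mathbb{V}_1$, $\nabla\times\mathbb{V}_1\subset\mathbb{V}_2$, $\nabla\cdot\mathbb{V}_2\subset\mathbb{V}_3$. $\mathring{\mathbb{V}}_2=\{\mathbf{w}\in\mathbb{V}_2:\mathbf{w}\cdot\mathbf{n}|_{\partial\Omega}=0\}$, $\mathring{\mathbb{V}}_1=\{\mathbf{\Sigma}\in\mathbb{V}_1:\mathbf{\Sigma}\times\mathbf{n}|_{\partial\Omega}=0\}$, $\nabla\times\mathring{\mathbb{V}}_1\subset\mathring{\mathbb{V}}_2$ (the boundary condition is $\mathbf{B}\cdot\mathbf{n}=0$, correspondingly $\mathbf{E}\times\mathbf{n}=0$, on all of $\partial\Omega$). $\mathbf{F}(t)\in\mathring{\mathbb{V}}_2$ and $n(t)\in\mathbb{V}_3$, $n>0$, are the discrete flux and density. $\Gamma$ is the set of interior mesh facets with sides arbitrarily labelled $+,-$; for vector fields $[\![\mathbf{u}]\!]'=\mathbf{u}^+-\mathbf{u}^-$. $h_e$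 is the local facet area, $\kappa_B$ a stabilization parameter, $\mu_0>0$ a constant. *)

theory Defs
  imports "HOL-Analysis.Analysis"
begin

type_synonym vec3 = "real^3"
type_synonym scalar_field = "vec3 \<Rightarrow> real"
type_synonym vector_field = "vec3 \<Rightarrow> vec3"

section \<open>Smooth functions and classical differential operators\<close>

text \<open>\<open>Ck_on k f S\<close> is meant for open \<open>S\<close>.\<close>

primrec Ck_on :: "nat \<Rightarrow> ('a::real_normed_vector \<Rightarrow> 'b::real_normed_vector) \<Rightarrow> 'a set \<Rightarrow> bool" where
  "Ck_on 0 = (\<lambda>f S. continuous_on S f)"
| "Ck_on (Suc k) = (\<lambda>f S. f differentiable_on S \<and>
      (\<forall>v. Ck_on k (\<lambda>x. frechet_derivative f (at x) v) S))"

definition smooth_on :: "'a::real_normed_vector set \<Rightarrow> ('a \<Rightarrow> 'b::real_normed_vector) \<Rightarrow> bool" where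
  "smooth_on S f \<longleftrightarrow> (\<forall>k. Ck_on k f S)"

definition pd :: "3 \<Rightarrow> scalar_field \<Rightarrow> scalar_field" where
  "pd i f x = frechet_derivative f (at x) (axis i 1)"

definition classical_grad :: "scalar_field \<Rightarrow> vector_field" where
  "classical_grad f x = (\<chi> i. pd i f x)"

definition classical_div :: "vector_field \<Rightarrow> scalar_field" where
  "classical_div u x = (\<Sum>i\<in>UNIV. pd i (\<lambda>y. u y $ i) x)"

definition classical_curl :: "vector_field \<Rightarrow> vector_field" where
  "classical_curl u x = vector
     [pd 2 (\<lambda>y. u y $ 3) x - pd 3 (\<lambda>y. u y $ 2) x,
      pd 3 (\<lambda>y. u y $ 1) x - pd 1 (\<lambda>y. u y $ 3) x,
      pd 1 (\<lambda>y. u y $ 2) x - pd 2 (\<lambda>y. u y $ 1) x]"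

definition test_function :: "vec3 set \<Rightarrow> (vec3 \<Rightarrow> 'b::real_normed_vector) \<Rightarrow> bool" where
  "test_function \<Omega> \<phi> \<longleftrightarrow> smooth_on UNIV \<phi> \<and>
     (\<exists>C. compact C \<and> C \<subseteq> \<Omega> \<and> (\<forall>x. x \<notin> C \<longrightarrow> \<phi> x = 0))"

section \<open>Domains, possibly periodic\<close>

text \<open>
  A periodic domain is represented by its periodic unfolding.  \<open>L\<close> is the group of periods:
  \<open>L = {0}\<close> with \<open>\<Omega>\<close> bounded is the ordinary case; \<open>L\<close> a lattice of full rank with \<open>\<Omega> = UNIV\<close>
  is the periodic case, where \<open>\<Omega>\<close> modulo \<open>L\<close> is a torus without boundary.  Fields on the torus are
  \<open>L\<close>-periodic functions on \<open>\<Omega>\<close>.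
\<close>

definition full_lattice :: "vec3 set \<Rightarrow> bool" where
  "full_lattice L \<longleftrightarrow> (\<exists>p :: 3 \<Rightarrow> vec3. inj p \<and> independent (range p) \<and>
     L = {(\<Sum>i\<in>UNIV. of_int (k i) *\<^sub>R p i) | k :: 3 \<Rightarrow> int. True})"

definition spatial_domain :: "vec3 set \<Rightarrow> vec3 set \<Rightarrow> bool" where
  "spatial_domain L \<Omega> \<longleftrightarrow> open \<Omega> \<and> connected \<Omega> \<and> \<Omega> \<noteq> {} \<and>
     (L = {0} \<and> bounded \<Omega> \<or> full_lattice L \<and> \<Omega> = UNIV)"

definition periodic :: "vec3 set \<Rightarrow> (vec3 \<Rightarrow> 'b) \<Rightarrow> bool" where
  "periodic L f \<longleftrightarrow> (\<forall>l\<in>L. \<forall>x. f (x + l) = f x)"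

section \<open>Meshes\<close>

text \<open>
  A cell \<open>(P, T)\<close> is the image \<open>T ` P\<close> of a reference polytope \<open>P\<close> under a smooth diffeomorphism \<open>T\<close>
  of a neighbourhood of \<open>P\<close>, so both affine and curved (isoparametric) cells are covered.
\<close>

type_synonym cell = "vec3 set \<times> (vec3 \<Rightarrow> vec3)"

definition cell_set :: "cell \<Rightarrow> vec3 set" where
  "cell_set K = snd K ` fst K"

definition is_cell :: "cell \<Rightarrow> bool" where
  "is_cell K \<longleftrightarrow> polytope (fst K) \<and> interior (fst K) \<noteq> {} \<and>
     (\<exists>U S. open U \<and> fst K \<subseteq> U \<and> smooth_on U (snd K) \<and>
        open (snd K ` U) \<and> smooth_on (snd K ` U) S \<and> (\<forall>x\<in>U. S (snd K x) = x))"

definition cell_facets :: "cell \<Rightarrow> vec3 set set" where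
  "cell_facets K = {snd K ` F | F. F facet_of fst K}"

definition translate_cell :: "vec3 \<Rightarrow> cell \<Rightarrow> cell" where
  "translate_cell l K = (fst K, \<lambda>x. l + snd K x)"

text \<open>A mesh is given by finitely many cells, one from each class modulo \<open>L\<close>.\<close>

definition all_cells :: "vec3 set \<Rightarrow> cell set \<Rightarrow> cell set" where
  "all_cells L M = {translate_cell l K | l K. l \<in> L \<and> K \<in> M}"

definition meet_in_common_face :: "cell \<Rightarrow> cell \<Rightarrow> bool" where
  "meet_in_common_face K K' \<longleftrightarrow>
     (\<exists>F G. F face_of fst K \<and> F \<noteq> fst K \<and> G face_of fst K' \<and> G \<noteq> fst K' \<and>
        cell_set K \<inter> cell_set K' = snd K ` F \<and> snd K ` F = snd K' ` G)"

definition interior_facets :: "vec3 set \<Rightarrow> cell set \<Rightarrow> vec3 set set" where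
  "interior_facets L M = {e. \<exists>K\<in>all_cells L M. \<exists>K'\<in>all_cells L M.
     K \<noteq> K' \<and> e \<in> cell_facets K \<and> e \<in> cell_facets K'}"

definition boundary_facets :: "vec3 set \<Rightarrow> cell set \<Rightarrow> vec3 set set" where
  "boundary_facets L M = (\<Union>K\<in>all_cells L M. cell_facets K) - interior_facets L M"

definition fe_mesh :: "vec3 set \<Rightarrow> cell set \<Rightarrow> vec3 set \<Rightarrow> bool" where
  "fe_mesh L M \<Omega> \<longleftrightarrow> finite M \<and> (\<forall>K\<in>M. is_cell K) \<and>
     (\<forall>K\<in>M. \<forall>K'\<in>M. \<forall>l\<in>L. K \<noteq> K' \<or> l \<noteq> 0 \<longrightarrow> meet_in_common_face K (translate_cell l K')) \<and>
     closure \<Omega> = (\<Union>K\<in>all_cells L M. cell_set K) \<and>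
     frontier \<Omega> = \<Union>(boundary_facets L M)"

text \<open>
  The set over which one integrates: this is \<open>\<Omega>\<close> itself if \<open>L = {0}\<close> (then the cells cover
  \<open>closure \<Omega>\<close>) and one period if \<open>\<Omega>\<close> is periodic.
\<close>

definition period_cell :: "cell set \<Rightarrow> vec3 set \<Rightarrow> vec3 set" where
  "period_cell M \<Omega> = \<Omega> \<inter> (\<Union>K\<in>M. cell_set K)"

text \<open>The set of interior facets of the (possibly periodic) domain: one representative per class modulo \<open>L\<close>.\<close>

definition facet_representatives :: "vec3 set \<Rightarrow> cell set \<Rightarrow> vec3 set set \<Rightarrow> bool" where
  "facet_representatives L M \<Gamma> \<longleftrightarrow> \<Gamma> \<subseteq> interior_facets L M \<and>
     (\<forall>e\<in>interior_facets L M. \<exists>!e'. e' \<in> \<Gamma> \<and> (\<exists>l\<in>L. e = (\<lambda>x. l + x) ` e'))"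

text \<open>\<open>Kp e\<close> and \<open>Km e\<close> are the cells on the \<open>+\<close> and \<open>-\<close> side of the facet \<open>e\<close>.\<close>

definition side_labelling ::
  "vec3 set \<Rightarrow> cell set \<Rightarrow> vec3 set set \<Rightarrow> (vec3 set \<Rightarrow> cell) \<Rightarrow> (vec3 set \<Rightarrow> cell) \<Rightarrow> bool" where
  "side_labelling L M \<Gamma> Kp Km \<longleftrightarrow>
     (\<forall>e\<in>\<Gamma>. Kp e \<in> all_cells L M \<and> Km e \<in> all_cells L M \<and> Kp e \<noteq> Km e \<and>
        e \<in> cell_facets (Kp e) \<and> e \<in> cell_facets (Km e))"

section \<open>Traces, boundary conditions, facet integrals\<close>

definition cellwise_smooth ::
  "cell set \<Rightarrow> (vec3 \<Rightarrow> 'b::real_normed_vector) \<Rightarrow> bool" where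
  "cellwise_smooth \<K> f \<longleftrightarrow> (\<forall>K\<in>\<K>. \<exists>U g. open U \<and> cell_set K \<subseteq> U \<and> smooth_on U g \<and>
     (\<forall>x\<in>interior (cell_set K). f x = g x))"

text \<open>One-sided value of a cell-wise smooth function; the values it takes on facets are irrelevant.\<close>

definition cell_trace :: "cell \<Rightarrow> (vec3 \<Rightarrow> 'b::real_normed_vector) \<Rightarrow> vec3 \<Rightarrow> 'b" where
  "cell_trace K f x = Lim (at x within interior (cell_set K)) f"

text \<open>
  \<open>n\<close> is the outward unit normal at a boundary point near which the boundary is a \<open>C\<^sup>1\<close> surface
  with \<open>\<Omega>\<close> on one side: \<open>n\<close> is the normalised gradient of a local defining function \<open>s\<close>.
\<close>

definition outward_unit_normal :: "vec3 set \<Rightarrow> vec3 \<Rightarrow> vec3 \<Rightarrow> bool" where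
  "outward_unit_normal \<Omega> x n \<longleftrightarrow> x \<in> frontier \<Omega> \<and> norm n = 1 \<and>
     (\<exists>U (s :: scalar_field) c. open U \<and> x \<in> U \<and> Ck_on 1 s U \<and>
        \<Omega> \<inter> U = {y\<in>U. s y < 0} \<and> frontier \<Omega> \<inter> U = {y\<in>U. s y = 0} \<and>
        c > 0 \<and> classical_grad s x = c *\<^sub>R n)"

text \<open>Normals exist at least on the relative interiors of boundary facets, that is, off the mesh edges.\<close>

definition zero_normal_trace :: "vec3 set \<Rightarrow> cell set \<Rightarrow> vec3 set \<Rightarrow> vector_field \<Rightarrow> bool" where
  "zero_normal_trace L M \<Omega> w \<longleftrightarrow>
     (\<forall>K\<in>all_cells L M. \<forall>F. F facet_of fst K \<and> snd K ` F \<in> boundary_facets L M \<longrightarrow>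
        (\<forall>x\<in>snd K ` rel_interior F. \<forall>n. outward_unit_normal \<Omega> x n \<longrightarrow> cell_trace K w x \<bullet> n = 0))"

definition zero_tangential_trace :: "vec3 set \<Rightarrow> cell set \<Rightarrow> vec3 set \<Rightarrow> vector_field \<Rightarrow> bool" where
  "zero_tangential_trace L M \<Omega> w \<longleftrightarrow>
     (\<forall>K\<in>all_cells L M. \<forall>F. F facet_of fst K \<and> snd K ` F \<in> boundary_facets L M \<longrightarrow>
        (\<forall>x\<in>snd K ` rel_interior F. \<forall>n. outward_unit_normal \<Omega> x n \<longrightarrow> cross3 (cell_trace K w x) n = 0))"

text \<open>
  Surface measure is the two-dimensional Hausdorff measure, normalised so as to agree with area.
  By Caratheodory's theorem \<open>hausdorff2\<close> is countably additive on Borel sets, so \<open>measure_of\<close>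
  retains it.
\<close>

definition hausdorff2_pre :: "real \<Rightarrow> vec3 set \<Rightarrow> ennreal" where
  "hausdorff2_pre \<delta> A =
     (INF C\<in>{C :: nat \<Rightarrow> vec3 set. A \<subseteq> (\<Union>i. C i) \<and> (\<forall>i. bounded (C i) \<and> diameter (C i) \<le> \<delta>)}.
        \<Sum>i. ennreal (pi / 4 * (diameter (C i))\<^sup>2))"

definition hausdorff2 :: "vec3 set \<Rightarrow> ennreal" where
  "hausdorff2 A = (SUP \<delta>\<in>{0<..}. hausdorff2_pre \<delta> A)"

definition surface_measure :: "vec3 measure" where
  "surface_measure = measure_of UNIV (sets borel) hausdorff2"

definition jump ::
  "(vec3 set \<Rightarrow> cell) \<Rightarrow> (vec3 set \<Rightarrow> cell) \<Rightarrow> vec3 set \<Rightarrow> vector_field \<Rightarrow> vector_field" where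
  "jump Kp Km e u x = cell_trace (Kp e) u x - cell_trace (Km e) u x"

definition facet_area :: "vec3 set \<Rightarrow> real" where
  "facet_area e = measure surface_measure e"

text \<open>The integral over \<open>\<Gamma>\<close> of \<open>h\<^sub>e\<^sup>2 \<kappa> [[u]]' \<bullet> [[v]]'\<close>.\<close>

definition facet_stabilization ::
  "vec3 set set \<Rightarrow> (vec3 set \<Rightarrow> cell) \<Rightarrow> (vec3 set \<Rightarrow> cell) \<Rightarrow> real \<Rightarrow>
   vector_field \<Rightarrow> vector_field \<Rightarrow> real" where
  "facet_stabilization \<Gamma> Kp Km \<kappa> u v =
     (\<Sum>e\<in>\<Gamma>. LINT x:e|surface_measure.
        (facet_area e)\<^sup>2 * \<kappa> * (jump Kp Km e u x \<bullet> jump Kp Km e v x))"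

section \<open>Lebesgue and Sobolev spaces\<close>

definition L2 :: "vec3 set \<Rightarrow> (vec3 \<Rightarrow> 'b::euclidean_space) \<Rightarrow> bool" where
  "L2 D f \<longleftrightarrow> set_borel_measurable lebesgue D f \<and> set_integrable lebesgue D (\<lambda>x. (norm (f x))\<^sup>2)"

definition ip :: "vec3 set \<Rightarrow> (vec3 \<Rightarrow> 'b::euclidean_space) \<Rightarrow> (vec3 \<Rightarrow> 'b) \<Rightarrow> real" where
  "ip D f g = (LINT x:D|lebesgue. f x \<bullet> g x)"

definition L2_norm :: "vec3 set \<Rightarrow> (vec3 \<Rightarrow> 'b::euclidean_space) \<Rightarrow> real" where
  "L2_norm D f = sqrt (ip D f f)"

definition locally_integrable :: "vec3 set \<Rightarrow> (vec3 \<Rightarrow> 'b::euclidean_space) \<Rightarrow> bool" where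
  "locally_integrable \<Omega> f \<longleftrightarrow> (\<forall>C. compact C \<and> C \<subseteq> \<Omega> \<longrightarrow> set_integrable lebesgue C f)"

text \<open>
  Weak derivatives are relations, since they are determined only up to null sets.  For periodic
  fields, testing on the unfolded domain is the same as testing on the torus.
\<close>

definition has_weak_grad :: "vec3 set \<Rightarrow> scalar_field \<Rightarrow> vector_field \<Rightarrow> bool" where
  "has_weak_grad \<Omega> f g \<longleftrightarrow> locally_integrable \<Omega> f \<and> locally_integrable \<Omega> g \<and>
     (\<forall>\<phi>. test_function \<Omega> \<phi> \<longrightarrow>
        (LINT x:\<Omega>|lebesgue. g x \<bullet> \<phi> x) = - (LINT x:\<Omega>|lebesgue. f x * classical_div \<phi> x))"

definition has_weak_curl :: "vec3 set \<Rightarrow> vector_field \<Rightarrow> vector_field \<Rightarrow> bool" where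
  "has_weak_curl \<Omega> u c \<longleftrightarrow> locally_integrable \<Omega> u \<and> locally_integrable \<Omega> c \<and>
     (\<forall>\<phi>. test_function \<Omega> \<phi> \<longrightarrow>
        (LINT x:\<Omega>|lebesgue. c x \<bullet> \<phi> x) = (LINT x:\<Omega>|lebesgue. u x \<bullet> classical_curl \<phi> x))"

definition has_weak_div :: "vec3 set \<Rightarrow> vector_field \<Rightarrow> scalar_field \<Rightarrow> bool" where
  "has_weak_div \<Omega> w d \<longleftrightarrow> locally_integrable \<Omega> w \<and> locally_integrable \<Omega> d \<and>
     (\<forall>\<phi>. test_function \<Omega> \<phi> \<longrightarrow>
        (LINT x:\<Omega>|lebesgue. d x * \<phi> x) = - (LINT x:\<Omega>|lebesgue. w x \<bullet> classical_grad \<phi> x))"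

definition H1 :: "vec3 set \<Rightarrow> vec3 set \<Rightarrow> scalar_field \<Rightarrow> bool" where
  "H1 D \<Omega> f \<longleftrightarrow> L2 D f \<and> (\<exists>g. L2 D g \<and> has_weak_grad \<Omega> f g)"

definition Hcurl :: "vec3 set \<Rightarrow> vec3 set \<Rightarrow> vector_field \<Rightarrow> bool" where
  "Hcurl D \<Omega> u \<longleftrightarrow> L2 D u \<and> (\<exists>c. L2 D c \<and> has_weak_curl \<Omega> u c)"

definition Hdiv :: "vec3 set \<Rightarrow> vec3 set \<Rightarrow> vector_field \<Rightarrow> bool" where
  "Hdiv D \<Omega> w \<longleftrightarrow> L2 D w \<and> (\<exists>d. L2 D d \<and> has_weak_div \<Omega> w d)"

section \<open>The discrete de Rham complex\<close>

definition fe_space ::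
  "vec3 set \<Rightarrow> cell set \<Rightarrow> (vec3 \<Rightarrow> 'b::euclidean_space) set \<Rightarrow> bool" where
  "fe_space L M V \<longleftrightarrow>
     (\<exists>(m::nat) b. V = {(\<lambda>x. \<Sum>i<m. c i *\<^sub>R b i x) | c :: nat \<Rightarrow> real. True}) \<and>
     (\<forall>f\<in>V. periodic L f \<and> cellwise_smooth (all_cells L M) f)"

definition V1_bc :: "vec3 set \<Rightarrow> cell set \<Rightarrow> vec3 set \<Rightarrow> vector_field set \<Rightarrow> vector_field set" where
  "V1_bc L M \<Omega> V1 = {u \<in> V1. zero_tangential_trace L M \<Omega> u}"

definition V2_bc :: "vec3 set \<Rightarrow> cell set \<Rightarrow> vec3 set \<Rightarrow> vector_field set \<Rightarrow> vector_field set" where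
  "V2_bc L M \<Omega> V2 = {w \<in> V2. zero_normal_trace L M \<Omega> w}"

definition discrete_de_Rham ::
  "vec3 set \<Rightarrow> cell set \<Rightarrow> vec3 set \<Rightarrow>
   scalar_field set \<Rightarrow> vector_field set \<Rightarrow> vector_field set \<Rightarrow> scalar_field set \<Rightarrow> bool" where
  "discrete_de_Rham L M \<Omega> V0 V1 V2 V3 \<longleftrightarrow>
     fe_space L M V0 \<and> fe_space L M V1 \<and> fe_space L M V2 \<and> fe_space L M V3 \<and>
     (\<forall>f\<in>V0. H1 (period_cell M \<Omega>) \<Omega> f) \<and>
     (\<forall>u\<in>V1. Hcurl (period_cell M \<Omega>) \<Omega> u) \<and>
     (\<forall>w\<in>V2. Hdiv (period_cell M \<Omega>) \<Omega> w) \<and>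
     (\<forall>f\<in>V3. L2 (period_cell M \<Omega>) f) \<and>
     (\<forall>f\<in>V0. \<exists>g\<in>V1. has_weak_grad \<Omega> f g) \<and>
     (\<forall>u\<in>V1. \<exists>c\<in>V2. has_weak_curl \<Omega> u c) \<and>
     (\<forall>w\<in>V2. \<exists>d\<in>V3. has_weak_div \<Omega> w d) \<and>
     (\<forall>u\<in>V1_bc L M \<Omega> V1. \<exists>c\<in>V2_bc L M \<Omega> V2. has_weak_curl \<Omega> u c)"

definition is_L2_projection ::
  "vec3 set \<Rightarrow> (vec3 \<Rightarrow> 'b::euclidean_space) set \<Rightarrow> (vec3 \<Rightarrow> 'b) \<Rightarrow> (vec3 \<Rightarrow> 'b) \<Rightarrow> bool" where
  "is_L2_projection D V u p \<longleftrightarrow> p \<in> V \<and> (\<forall>w\<in>V. ip D w p = ip D w u)"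

text \<open>
  The time derivative is the limit of difference quotients in \<open>L\<^sup>2\<close>; on the finite-dimensional
  spaces used here this is the same as in any other norm.
\<close>

definition has_time_derivative ::
  "vec3 set \<Rightarrow> real set \<Rightarrow> (real \<Rightarrow> vec3 \<Rightarrow> 'b::euclidean_space) \<Rightarrow> real \<Rightarrow> (vec3 \<Rightarrow> 'b) \<Rightarrow> bool" where
  "has_time_derivative D I u t u' \<longleftrightarrow> L2 D u' \<and>
     ((\<lambda>s. L2_norm D (\<lambda>x. (u s x - u t x) /\<^sub>R (s - t) - u' x)) \<longlongrightarrow> 0) (at t within I)"

end

theory Submission
  imports Defs
begin

text \<open>  The helicity changes at the rate \<open>\<langle>A', B\<rangle> + \<langle>A, B'\<rangle>\<close> with \<open>A' = - E + grad \<Phi>\<close> and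
  \<open>B' = - curl E\<close>.  Two integrations by parts without boundary terms,
  \<open>\<langle>A, curl E\<rangle> = \<langle>curl A, E\<rangle>\<close> because \<open>E \<times> n = 0\<close> (\<open>curl_integration_by_parts\<close>) and
  \<open>\<langle>grad \<Phi>, B\<rangle> = 0\<close> because \<open>B \<bullet> n = 0\<close> and \<open>div B = div curl A = 0\<close> (\<open>grad_orthogonal\<close>), turn
  this rate into \<open>- 2 \<langle>E, B\<rangle>\<close>.  Since \<open>E\<close> lies in the space onto which \<open>B\<close> is projected, \<open>B\<close> may
  be replaced by its projection, and Ohm's law tested with that projection gives zero: the projection
  is orthogonal to its cross product with the flux, and its cross product with itself has no jumps.

  The substance is in the two integrations by parts, because all derivatives are weak and the
  boundary conditions are imposed only on traces from single cells, away from the mesh edges.  Both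
  are instances of \<open>gauss_zero_flux\<close>: if \<open>w\<close> is bounded and continuous on the cells, has
  weak divergence \<open>d\<close> and vanishing normal trace, then \<open>d\<close> has integral zero.  It is applied to
  \<open>w = E \<times> A\<close> and to \<open>w = \<Phi> B\<close>.  That these products have the expected weak divergence is
  \<open>weak_product_rule\<close>, proved by mollifying one of the two factors; since the fields are bounded and
  continuous off a null set, mollifications converge boundedly almost everywhere, and the interior
  facets of the mesh need no separate treatment.

  On a bounded domain, \<open>gauss_zero_flux\<close> amounts to the weak divergence identity for the extension of
  \<open>w\<close> by zero, tested with a function that is \<open>1\<close> on the domain.  This identity is local.  At a
  relatively interior point of a boundary facet the boundary is the zero set of a smooth function \<open>s\<close>
  (\<open>boundary_chart\<close>), and the cut-offs \<open>h (s / \<epsilon>)\<close> make no contribution in the limit: their gradients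
  live in a layer of volume \<open>O(\<epsilon>)\<close>, have size \<open>O(1 / \<epsilon>)\<close> and are multiplied with the flux
  \<open>w \<bullet> grad s\<close>, which tends to zero (\<open>boundary_local\<close>).  The mesh edges are one-dimensional, so they
  are hidden by cut-offs whose gradients are small in \<open>L\<^sup>1\<close> (\<open>cutoff_off_balls\<close>).  On a torus there is
  no boundary, and one tests with a mollified indicator of the period cell, whose translates form a
  partition of unity (\<open>gauss_tiling\<close>).
\<close>

section \<open>Gradients, smooth functions and mollifiers\<close>

text \<open>The gradient of a \<open>C\<^sup>1\<close> test function is carried along as a second
  argument, so that cut-offs can be multiplied and composed together with their gradients.\<close>
definition has_grad :: "('a::euclidean_space \<Rightarrow> real) \<Rightarrow> ('a \<Rightarrow> 'a) \<Rightarrow> bool" where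
  "has_grad f g \<longleftrightarrow> (\<forall>x. (f has_derivative (\<lambda>h. g x \<bullet> h)) (at x)) \<and> continuous_on UNIV g"

lemma has_gradD:
  assumes "has_grad f g"
  shows "(f has_derivative (\<lambda>h. g x \<bullet> h)) (at x)" "continuous_on UNIV g"
    "continuous_on UNIV f" "isCont g x" "isCont f x"
proof -
  have 1: "(f has_derivative (\<lambda>h. g x \<bullet> h)) (at x)" for x
    using assms by (auto simp: has_grad_def)
  have 2: "continuous_on UNIV g"
    using assms by (auto simp: has_grad_def)
  show "(f has_derivative (\<lambda>h. g x \<bullet> h)) (at x)" "continuous_on UNIV g" by (fact 1 2)+
  show "continuous_on UNIV f"
    using 1 by (meson differentiable_at_withinI differentiable_imp_continuous_on
        differentiable_on_def differentiable_def)
  then show "isCont f x" by (simp add: continuous_on_eq_continuous_at)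
  show "isCont g x" using 2 by (simp add: continuous_on_eq_continuous_at)
qed

lemma has_grad_zero_off_closed:
  assumes "has_grad f g" and "closed C" and "\<And>x. x \<notin> C \<Longrightarrow> f x = c" and "x \<notin> C"
  shows "g x = 0"
proof -
  have "((\<lambda>_. c) has_derivative (\<lambda>h. g x \<bullet> h)) (at x)"
    using assms(2-4) by (intro has_derivative_transform_within_open[OF has_gradD(1)[OF assms(1)], of "- C"]) auto
  then have "(\<lambda>h. g x \<bullet> h) = (\<lambda>h. 0)"
    using has_derivative_const has_derivative_unique by blast
  then have "g x \<bullet> g x = 0" by metis
  then show ?thesis by simp
qed

lemma has_grad_const: "has_grad (\<lambda>_. c) (\<lambda>_. 0)"
  by (auto simp: has_grad_def)

lemma has_grad_add:
  assumes "has_grad f g" "has_grad f' g'"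
  shows "has_grad (\<lambda>x. f x + f' x) (\<lambda>x. g x + g' x)"
  unfolding has_grad_def
  by (auto intro!: derivative_eq_intros has_gradD[OF assms(1)] has_gradD[OF assms(2)] continuous_intros
      simp: inner_add_left)

lemma has_grad_mult:
  assumes "has_grad f g" "has_grad f' g'"
  shows "has_grad (\<lambda>x. f x * f' x) (\<lambda>x. f x *\<^sub>R g' x + f' x *\<^sub>R g x)"
  unfolding has_grad_def
  by (auto intro!: derivative_eq_intros has_gradD[OF assms(1)] has_gradD[OF assms(2)] continuous_intros
      simp: inner_add_left)

lemma has_grad_chain:
  assumes f: "has_grad f g" and k: "\<And>t. (k has_real_derivative k' t) (at t)" "continuous_on UNIV k'"
  shows "has_grad (\<lambda>x. k (f x)) (\<lambda>x. k' (f x) *\<^sub>R g x)"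
proof -
  have "((\<lambda>x. k (f x)) has_derivative (\<lambda>h. (k' (f x) *\<^sub>R g x) \<bullet> h)) (at x)" for x
    using has_derivative_compose[OF has_gradD(1)[OF f] k(1)[THEN has_field_derivative_imp_has_derivative]]
    by simp
  moreover have "continuous_on UNIV (\<lambda>x. k' (f x) *\<^sub>R g x)"
    by (intro continuous_intros continuous_on_compose2[OF k(2)] has_gradD[OF f]) auto
  ultimately show ?thesis by (auto simp: has_grad_def)
qed

lemma has_grad_compose_affine:
  assumes "has_grad f g"
  shows "has_grad (\<lambda>y. f (x - y)) (\<lambda>y. - g (x - y))"
proof -
  have "((\<lambda>y. f (x - y)) has_derivative (\<lambda>h. (- g (x - y)) \<bullet> h)) (at y)" for y
  proof -
    have "((\<lambda>y. x - y) has_derivative (\<lambda>h. - h)) (at y)"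
      by (auto intro!: derivative_eq_intros)
    from has_derivative_compose[OF this has_gradD(1)[OF assms, of "x - y"]] show ?thesis by simp
  qed
  moreover have "continuous_on UNIV (\<lambda>y. - g (x - y))"
    by (intro continuous_intros continuous_on_compose2[OF has_gradD(2)[OF assms]]) auto
  ultimately show ?thesis by (auto simp: has_grad_def)
qed

text \<open>All orders of differentiability are obtained at once from a class of functions
  that is closed under directional derivatives.\<close>
lemma smooth_coinduct:
  assumes "P f"
    and step: "\<And>f. P f \<Longrightarrow> \<exists>f'. (\<forall>x. (f has_derivative f' x) (at x)) \<and> (\<forall>v. P (\<lambda>x. f' x v))"
  shows "smooth_on UNIV f"
proof -
  have "Ck_on k f UNIV" if "P f" for k f
    using that
  proof (induction k arbitrary: f)
    case 0
    then obtain f' where "\<And>x. (f has_derivative f' x) (at x)" using step by blast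
    then have "f differentiable_on UNIV" unfolding differentiable_on_def differentiable_def by blast
    then show ?case using differentiable_imp_continuous_on by simp blast
  next
    case (Suc k)
    then obtain f' where f': "\<And>x. (f has_derivative f' x) (at x)" and P: "\<And>v. P (\<lambda>x. f' x v)"
      using step by blast
    have eq: "frechet_derivative f (at x) = f' x" for x
      using frechet_derivative_at[OF f'] by simp
    have "f differentiable_on UNIV"
      using f' unfolding differentiable_on_def differentiable_def by blast
    then show ?case using Suc.IH[OF P] by (simp add: eq)
  qed
  then show ?thesis using assms(1) by (simp add: smooth_on_def)
qed

lemma smooth_derivative:
  fixes f :: "'a::euclidean_space \<Rightarrow> 'b::euclidean_space"
  assumes "smooth_on UNIV f"
  shows "(f has_derivative frechet_derivative f (at x)) (at x)"
    and "smooth_on UNIV (\<lambda>x. frechet_derivative f (at x) v)"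
    and "continuous_on UNIV f"
proof -
  have "Ck_on 0 f UNIV" "\<And>k. Ck_on (Suc k) f UNIV" using assms by (auto simp: smooth_on_def simp del: Ck_on.simps)
  then show "(f has_derivative frechet_derivative f (at x)) (at x)"
     "smooth_on UNIV (\<lambda>x. frechet_derivative f (at x) v)" "continuous_on UNIV f"
    by (auto simp: smooth_on_def frechet_derivative_works[symmetric] differentiable_on_def)
qed

lemma smooth_has_grad:
  fixes f :: "'a::euclidean_space \<Rightarrow> real"
  assumes "smooth_on UNIV f"
  obtains g where "has_grad f g" "\<And>v. smooth_on UNIV (\<lambda>x. g x \<bullet> v)"
proof
  let ?D = "\<lambda>x. frechet_derivative f (at x)"
  let ?g = "\<lambda>x. \<Sum>i\<in>Basis. ?D x i *\<^sub>R i"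
  note d = smooth_derivative[OF assms]
  have lin: "linear (?D x)" for x using d(1) has_derivative_linear by blast
  have eq: "?g x \<bullet> h = ?D x h" for x h
  proof -
    have "?D x h = ?D x (\<Sum>i\<in>Basis. (h \<bullet> i) *\<^sub>R i)" by (simp add: euclidean_representation)
    also have "\<dots> = (\<Sum>i\<in>Basis. (h \<bullet> i) *\<^sub>R ?D x i)"
      by (simp add: linear_sum[OF lin] linear_scale[OF lin])
    also have "\<dots> = ?g x \<bullet> h" unfolding inner_sum_left by (simp add: inner_commute mult.commute)
    finally show ?thesis by simp
  qed
  have "continuous_on UNIV ?g"
    by (intro continuous_intros smooth_derivative(3) d(2))
  then show "has_grad f ?g" using d(1) by (simp add: has_grad_def eq)
  show "smooth_on UNIV (\<lambda>x. ?g x \<bullet> v)" for v using d(2) by (simp add: eq)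
qed

text \<open>The classical flat function \<open>exp (- 1 / r)\<close>, divided by powers of \<open>r\<close> so that
  differentiation stays within the family.\<close>
definition flat :: "nat \<Rightarrow> real \<Rightarrow> real" where
  "flat k r = (if r > 0 then exp (- (1 / r)) / r ^ k else 0)"

lemma flat_bound:
  assumes "r > 0"
  shows "flat k r \<le> real (k + 1) ^ (k + 1) * r"
proof -
  define m where "m = k + 1"
  have m0: "m > 0" by (simp add: m_def)
  have "1 / (m * r) \<le> exp (1 / (m * r))" using exp_ge_add_one_self[of "1 / (m * r)"] by linarith
  then have "(1 / (m * r)) ^ m \<le> exp (1 / (m * r)) ^ m"
    using assms by (intro power_mono) auto
  also have "\<dots> = exp (1 / r)" using assms m0 by (subst exp_of_nat_mult[symmetric]) simp
  finally have "inverse (exp (1 / r)) \<le> inverse ((1 / (m * r)) ^ m)"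
    by (rule le_imp_inverse_le) (use assms m0 in simp)
  then have "exp (- (1 / r)) \<le> (m * r) ^ m"
    by (simp add: exp_minus power_divide)
  then have "exp (- (1 / r)) / r ^ k \<le> (m * r) ^ m / r ^ k"
    using assms by (intro divide_right_mono) auto
  also have "\<dots> = real m ^ m * (r ^ m / r ^ k)" by (simp add: power_mult_distrib)
  also have "r ^ m / r ^ k = r" using assms by (simp add: m_def)
  finally show ?thesis using assms unfolding flat_def m_def[symmetric] by simp
qed

lemma flat_has_derivative:
  "(flat k has_real_derivative (flat (k + 2) r - k * flat (k + 1) r)) (at r)"
proof -
  consider "r > 0" | "r < 0" | "r = 0" by linarith
  then show ?thesis
  proof cases
    case 1
    have d: "((\<lambda>r. exp (- (1 / r)) / r ^ k) has_real_derivative (flat (k + 2) r - k * flat (k + 1) r)) (at r)"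
      using 1 apply (auto intro!: derivative_eq_intros simp: flat_def)
      apply (cases k)
       apply (auto simp: field_simps power2_eq_square)
      done
    have e: "\<forall>\<^sub>F s in nhds r. exp (- (1 / s)) / s ^ k = flat k s"
      using eventually_nhds_in_open[of "{0<..}" r] 1 by (auto simp: flat_def elim!: eventually_mono)
    show ?thesis by (rule iffD1[OF DERIV_cong_ev[OF refl e refl] d])
  next
    case 2
    have e: "\<forall>\<^sub>F s in nhds r. 0 = flat k s"
      using eventually_nhds_in_open[of "{..<0}" r] 2 by (auto simp: flat_def elim!: eventually_mono)
    have d: "((\<lambda>s. 0) has_real_derivative (flat (k + 2) r - k * flat (k + 1) r)) (at r)"
      using 2 by (auto intro!: derivative_eq_intros simp: flat_def)
    show ?thesis by (rule iffD1[OF DERIV_cong_ev[OF refl e refl] d])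
  next
    case 3
    let ?c = "real (k + 2) ^ (k + 2)"
    have "((\<lambda>h. flat k h / h) \<longlongrightarrow> 0) (at 0)"
    proof (rule Lim_null_comparison)
      show "((\<lambda>h. ?c * \<bar>h\<bar>) \<longlongrightarrow> 0) (at 0)" by (auto intro!: tendsto_eq_intros)
      show "\<forall>\<^sub>F h in at 0. norm (flat k h / h) \<le> ?c * \<bar>h\<bar>"
      proof (rule always_eventually, rule allI)
        fix h :: real
        show "norm (flat k h / h) \<le> ?c * \<bar>h\<bar>"
        proof (cases "h > 0")
          case True
          then have "flat k h / h = flat (k + 1) h" "0 \<le> flat (k+1) h" by (auto simp: flat_def)
          then show ?thesis using flat_bound[OF True, of "k + 1"] True by simp
        next
          case False
          then have "flat k h = 0" by (simp add: flat_def)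
          then show ?thesis by simp
        qed
      qed
    qed
    then show ?thesis using 3 by (simp add: DERIV_def flat_def)
  qed
qed

text \<open>The algebra generated by the coordinates and the standard bumps; it is closed under
  directional derivatives, so no higher derivative has to be computed.\<close>
inductive bump_algebra :: "real \<Rightarrow> ('a::euclidean_space \<Rightarrow> real) \<Rightarrow> bool" for R where
  "bump_algebra R (\<lambda>x. c)"
| "bump_algebra R (\<lambda>x. x \<bullet> v)"
| "bump_algebra R (\<lambda>x. flat k (R - x \<bullet> x))"
| "bump_algebra R f \<Longrightarrow> bump_algebra R g \<Longrightarrow> bump_algebra R (\<lambda>x. f x + g x)"
| "bump_algebra R f \<Longrightarrow> bump_algebra R g \<Longrightarrow> bump_algebra R (\<lambda>x. f x * g x)"

lemma bump_algebra_derivative: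
  assumes "bump_algebra R f"
  shows "\<exists>f'. (\<forall>x. (f has_derivative f' x) (at x)) \<and> (\<forall>v. bump_algebra R (\<lambda>x. f' x v))"
  using assms
proof induction
  case (1 c)
  show ?case by (intro exI[of _ "\<lambda>x h. 0"]) (auto intro: bump_algebra.intros)
next
  case (2 v)
  show ?case
    by (intro exI[of _ "\<lambda>x h. h \<bullet> v"]) (auto intro!: bump_algebra.intros derivative_eq_intros)
next
  case (3 k)
  let ?f = "\<lambda>x v. (flat (k + 2) (R - x \<bullet> x) + (- real k) * flat (k + 1) (R - x \<bullet> x)) * (x \<bullet> ((-2) *\<^sub>R v))"
  have "((\<lambda>x. flat k (R - x \<bullet> x)) has_derivative ?f x) (at x)" for x
  proof -
    have "((\<lambda>x. R - x \<bullet> x) has_derivative (\<lambda>h. - 2 * (x \<bullet> h))) (at x)"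
      by (auto intro!: derivative_eq_intros simp: inner_commute)
    from has_derivative_compose[OF this flat_has_derivative[THEN has_field_derivative_imp_has_derivative]]
    show ?thesis by simp
  qed
  moreover have "bump_algebra R (\<lambda>x. ?f x v)" for v by (intro bump_algebra.intros)
  ultimately show ?case by (intro exI[of _ ?f]) blast
next
  case (4 f g)
  then obtain f' g' where "\<And>x. (f has_derivative f' x) (at x)" "\<And>v. bump_algebra R (\<lambda>x. f' x v)"
     "\<And>x. (g has_derivative g' x) (at x)" "\<And>v. bump_algebra R (\<lambda>x. g' x v)" by blast
  then show ?case
    by (intro exI[of _ "\<lambda>x h. f' x h + g' x h"]) (auto intro!: bump_algebra.intros has_derivative_add)
next
  case (5 f g)
  then obtain f' g' where "\<And>x. (f has_derivative f' x) (at x)" "\<And>v. bump_algebra R (\<lambda>x. f' x v)"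
     "\<And>x. (g has_derivative g' x) (at x)" "\<And>v. bump_algebra R (\<lambda>x. g' x v)" by blast
  then show ?case
    using 5(1,2)
    by (intro exI[of _ "\<lambda>x h. f x * g' x h + f' x h * g x"]) (auto intro!: bump_algebra.intros has_derivative_mult)
qed

lemma bump_algebra_smooth:
  assumes "bump_algebra R f"
  shows "smooth_on UNIV f"
  using smooth_coinduct[of "bump_algebra R", OF assms bump_algebra_derivative] .

lemma integrable_continuous_compact_support:
  fixes f :: "'a::euclidean_space \<Rightarrow> 'b::euclidean_space"
  assumes "continuous_on UNIV f" and "compact C" and "\<And>x. x \<notin> C \<Longrightarrow> f x = 0"
  shows "integrable lebesgue f"
proof -
  have "continuous_on C f" using assms(1) continuous_on_subset by blast
  then have "set_integrable lborel C f" using assms(2) borel_integrable_compact[of C f]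
    by (simp add: set_integrable_def)
  moreover have "(\<lambda>x. indicat_real C x *\<^sub>R f x) = f" using assms(3) by (auto simp: indicator_def fun_eq_iff)
  ultimately have "integrable lborel f" by (simp add: set_integrable_def)
  then show ?thesis using integrable_completion[of f lborel]
    by (metis borel_measurable_integrable)
qed

definition mollifier :: "real \<Rightarrow> ('a::euclidean_space \<Rightarrow> real) \<Rightarrow> bool" where
  "mollifier \<delta> \<rho> \<longleftrightarrow> smooth_on UNIV \<rho> \<and> (\<forall>x. 0 \<le> \<rho> x) \<and> (\<forall>x. \<delta> \<le> norm x \<longrightarrow> \<rho> x = 0) \<and>
     integral\<^sup>L lebesgue \<rho> = 1"

lemma mollifier_exists:
  assumes "\<delta> > 0"
  shows "\<exists>\<rho> :: 'a::euclidean_space \<Rightarrow> real. mollifier \<delta> \<rho>"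
proof -
  define b :: "'a \<Rightarrow> real" where "b = (\<lambda>x. flat 0 (\<delta>\<^sup>2 - x \<bullet> x))"
  define c where "c = integral\<^sup>L lebesgue b"
  have ba: "bump_algebra (\<delta>\<^sup>2) b" unfolding b_def by (rule bump_algebra.intros)
  have cont: "continuous_on UNIV b" using smooth_derivative(3)[OF bump_algebra_smooth[OF ba]] .
  have nn: "0 \<le> b x" for x by (simp add: b_def flat_def)
  have pos: "b x > 0 \<longleftrightarrow> norm x < \<delta>" for x
  proof -
    have "x \<bullet> x < \<delta>\<^sup>2 \<longleftrightarrow> norm x < \<delta>"
      using assms by (simp add: power2_norm_eq_inner[symmetric] abs_le_square_iff[symmetric] power2_less_imp_less
          linorder_not_le[symmetric])
    then show ?thesis by (auto simp: b_def flat_def)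
  qed
  have zero: "b x = 0" if "\<delta> \<le> norm x" for x using pos[of x] nn[of x] that by linarith
  have int: "integrable lebesgue b"
    using zero by (intro integrable_continuous_compact_support[OF cont, of "cball 0 \<delta>"]) auto
  have "c \<noteq> 0"
  proof
    assume "c = 0"
    then have "AE x in lebesgue. b x = 0"
      using integral_nonneg_eq_0_iff_AE[OF int] nn by (auto simp: c_def)
    then have "negligible {x. b x \<noteq> 0}"
      by (auto simp: eventually_ae_filter negligible_iff_null_sets[symmetric] intro: negligible_subset)
    moreover have "ball 0 \<delta> \<subseteq> {x. b x \<noteq> 0}" using pos by force
    ultimately have "negligible (ball (0::'a) \<delta>)" using negligible_subset by blast
    then show False using assms open_not_negligible[of "ball (0::'a) \<delta>"] by simp
  qed
  moreover have "c \<ge> 0" unfolding c_def using nn by (simp add: integral_nonneg)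
  ultimately have cp: "c > 0" by simp
  have "mollifier \<delta> (\<lambda>x. (1 / c) * b x)"
    unfolding mollifier_def
  proof (intro conjI allI impI)
    show "smooth_on UNIV (\<lambda>x. (1 / c) * b x)"
      by (rule bump_algebra_smooth[of "\<delta>\<^sup>2"]) (intro bump_algebra.intros ba)
    show "integral\<^sup>L lebesgue (\<lambda>x. 1 / c * b x) = 1"
      using cp by (simp add: c_def[symmetric])
  qed (use nn zero cp in auto)
  then show ?thesis by blast
qed

section \<open>Convolution\<close>

lemma lebesgue_distr_reflect_translate:
  fixes \<delta> :: "'a::euclidean_space"
  assumes "\<bar>m\<bar> = 1"
  shows "(\<lambda>y. m *\<^sub>R y + \<delta>) \<in> lebesgue \<rightarrow>\<^sub>M lebesgue" "distr lebesgue lebesgue (\<lambda>y. m *\<^sub>R y + \<delta>) = lebesgue"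
proof -
  have eq: "(\<lambda>y. m *\<^sub>R y + \<delta>) = (\<lambda>x. \<delta> + (\<Sum>j\<in>Basis. (m * (x \<bullet> j)) *\<^sub>R j))"
    by (simp add: fun_eq_iff scaleR_scaleR[symmetric] scaleR_sum_right[symmetric] euclidean_representation del: scaleR_scaleR)
  have "m \<noteq> 0" using assms by auto
  then show M: "(\<lambda>y. m *\<^sub>R y + \<delta>) \<in> lebesgue \<rightarrow>\<^sub>M lebesgue"
    unfolding eq by (intro lebesgue_affine_measurable) auto
  show "distr lebesgue lebesgue (\<lambda>y. m *\<^sub>R y + \<delta>) = lebesgue"
  proof (rule measure_eqI)
    fix A assume "A \<in> sets (distr lebesgue lebesgue (\<lambda>y. m *\<^sub>R y + \<delta>))"
    then have A: "A \<in> sets lebesgue" by simp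
    have mm: "m * m = 1" using assms by (metis abs_mult_self_eq mult.right_neutral)
    have "(\<lambda>y. m *\<^sub>R y + \<delta>) -` A = (\<lambda>y. m *\<^sub>R y + (- m *\<^sub>R \<delta>)) ` A"
    proof (intro set_eqI iffI)
      fix y assume "y \<in> (\<lambda>y. m *\<^sub>R y + \<delta>) -` A"
      then show "y \<in> (\<lambda>y. m *\<^sub>R y + (- m *\<^sub>R \<delta>)) ` A"
        by (intro image_eqI[of _ _ "m *\<^sub>R y + \<delta>"]) (auto simp: scaleR_add_right mm)
    qed (auto simp: scaleR_add_right mm scaleR_diff_right)
    then show "emeasure (distr lebesgue lebesgue (\<lambda>y. m *\<^sub>R y + \<delta>)) A = emeasure lebesgue A"
      using emeasure_lebesgue_affine[of m "- m *\<^sub>R \<delta>" A] assms by (simp add: emeasure_distr[OF M A])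
  qed simp
qed

lemma lebesgue_reflect_translate:
  fixes f :: "'a::euclidean_space \<Rightarrow> 'b::{banach,second_countable_topology}"
  assumes m: "\<bar>m\<bar> = 1" and f: "f \<in> borel_measurable lebesgue"
  shows "integrable lebesgue (\<lambda>y. f (m *\<^sub>R y + \<delta>)) \<longleftrightarrow> integrable lebesgue f"
    and "(LINT y|lebesgue. f (m *\<^sub>R y + \<delta>)) = integral\<^sup>L lebesgue f"
  using integrable_distr_eq[OF lebesgue_distr_reflect_translate(1)[OF m] f, of \<delta>]
    integral_distr[OF lebesgue_distr_reflect_translate(1)[OF m] f, of \<delta>]
  by (simp_all add: lebesgue_distr_reflect_translate(2)[OF m])

lemma lebesgue_reflect:
  fixes f :: "'a::euclidean_space \<Rightarrow> 'b::{banach,second_countable_topology}"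
  assumes "integrable lebesgue f"
  shows "integrable lebesgue (\<lambda>y. f (x - y))" "(LINT y|lebesgue. f (x - y)) = integral\<^sup>L lebesgue f"
  using lebesgue_reflect_translate[of "-1" f x] assms by auto

definition conv :: "('a::euclidean_space \<Rightarrow> 'b::euclidean_space) \<Rightarrow> ('a \<Rightarrow> real) \<Rightarrow> 'a \<Rightarrow> 'b" where
  "conv F \<rho> x = (LINT y|lebesgue. \<rho> (x - y) *\<^sub>R F y)"

lemma bounded_compact_support:
  fixes g :: "'a::euclidean_space \<Rightarrow> 'b::real_normed_vector"
  assumes "continuous_on UNIV g" and "compact C" and "\<And>x. x \<notin> C \<Longrightarrow> g x = 0"
  obtains M where "M > 0" "\<And>x. norm (g x) \<le> M"
proof -
  have "bounded (g ` C)"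
    using assms by (meson compact_continuous_image compact_imp_bounded continuous_on_subset subset_UNIV)
  then obtain M where "M > 0" "\<And>x. x \<in> C \<Longrightarrow> norm (g x) \<le> M"
    by (auto simp: bounded_pos)
  then show ?thesis using that[of M] assms(3) by (metis less_imp_le norm_zero)
qed

lemma uniformly_continuous_compact_support:
  fixes g :: "'a::euclidean_space \<Rightarrow> 'b::real_normed_vector"
  assumes "continuous_on UNIV g" and "\<And>x. norm x > r \<Longrightarrow> g x = 0" and "e > 0"
  obtains d where "d > 0" "\<And>x y. norm (x - y) < d \<Longrightarrow> norm (g x - g y) < e"
proof -
  have "uniformly_continuous_on (cball 0 (r + 1)) g"
    using assms(1) by (intro compact_uniformly_continuous) (auto intro: continuous_on_subset)
  then obtain d where d: "d > 0" "\<And>x y. \<lbrakk>norm x \<le> r + 1; norm y \<le> r + 1; norm (x - y) < d\<rbrakk> \<Longrightarrow> norm (g x - g y) < e"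
    unfolding uniformly_continuous_on_def dist_norm using \<open>e > 0\<close>
    by (metis mem_cball_0)
  have "norm (g x - g y) < e" if "norm (x - y) < min d 1" for x y
  proof (cases "norm x \<le> r + 1 \<and> norm y \<le> r + 1")
    case False
    then have "norm x > r" "norm y > r"
      using that norm_triangle_ineq2[of x y] norm_triangle_ineq2[of y x] by (auto simp: norm_minus_commute)
    then show ?thesis using assms by simp
  qed (use d that in auto)
  then show ?thesis using that[of "min d 1"] d(1) by auto
qed

lemma integrable_scale_bounded:
  fixes F :: "'a::euclidean_space \<Rightarrow> 'b::euclidean_space"
  assumes "integrable lebesgue F" and "continuous_on UNIV k" and "\<And>x. norm (k x) \<le> M"
  shows "integrable lebesgue (\<lambda>y. k (x - y) *\<^sub>R F y)"
proof (rule Bochner_Integration.integrable_bound)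
  show "integrable lebesgue (\<lambda>y. M *\<^sub>R norm (F y))" using assms(1) by auto
  have "continuous_on UNIV (\<lambda>y. k (x - y))"
    by (rule continuous_on_compose2[OF assms(2)]) (auto intro!: continuous_intros)
  then have "(\<lambda>y. k (x - y)) \<in> borel_measurable lebesgue"
    using borel_measurable_continuous_onI by (metis measurable_completion measurable_lborel2 measurable_lborel1)
  then show "(\<lambda>y. k (x - y) *\<^sub>R F y) \<in> borel_measurable lebesgue"
    using assms(1) by (intro borel_measurable_scaleR) auto
  have "M \<ge> 0" using assms(3) norm_ge_zero order_trans by blast
  then show "AE y in lebesgue. norm (k (x - y) *\<^sub>R F y) \<le> norm (M *\<^sub>R norm (F y))"
    using assms(3) by (auto intro!: mult_right_mono)
qed

text \<open>The derivative falls on the kernel, because the difference quotients of the kernel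
  converge uniformly; \<open>F\<close> is merely integrable.\<close>
lemma conv_has_derivative:
  fixes F :: "'a::euclidean_space \<Rightarrow> 'b::euclidean_space"
  assumes F: "integrable lebesgue F" and \<rho>: "has_grad \<rho> g" and supp: "\<And>x. norm x > r \<Longrightarrow> \<rho> x = 0"
  shows "(conv F \<rho> has_derivative (\<lambda>h. conv F (\<lambda>z. g z \<bullet> h) x)) (at x)"
proof -
  have g0: "g x = 0" if "norm x > r" for x
    using has_grad_zero_off_closed[OF \<rho>, of "cball 0 r" 0] supp that by simp
  obtain M where M: "M > 0" "\<And>x. norm (g x) \<le> M"
    using bounded_compact_support[OF has_gradD(2)[OF \<rho>], of "cball 0 r"] g0 by auto
  obtain M' where M': "M' > 0" "\<And>x. norm (\<rho> x) \<le> M'"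
    using bounded_compact_support[OF has_gradD(3)[OF \<rho>], of "cball 0 r"] supp by auto
  have int: "integrable lebesgue (\<lambda>y. (g (x - y) \<bullet> h) *\<^sub>R F y)" for x h
  proof (rule integrable_scale_bounded[OF F, of "\<lambda>z. g z \<bullet> h" "M * norm h"])
    show "continuous_on UNIV (\<lambda>z. g z \<bullet> h)" using has_gradD(2)[OF \<rho>] by (intro continuous_intros)
    show "norm (g z \<bullet> h) \<le> M * norm h" for z
      using Cauchy_Schwarz_ineq2[of "g z" h] M(2)[of z] mult_right_mono[of "norm (g z)" M "norm h"] by simp
  qed
  have int\<rho>: "integrable lebesgue (\<lambda>y. \<rho> (x - y) *\<^sub>R F y)" for x
    by (rule integrable_scale_bounded[OF F has_gradD(3)[OF \<rho>] M'(2)])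
  let ?L = "\<lambda>h. conv F (\<lambda>z. g z \<bullet> h) x"
  have "bounded_linear ?L"
  proof (rule bounded_linear_intro[of _ "M * (LINT y|lebesgue. norm (F y))"])
    show "?L (h + k) = ?L h + ?L k" for h k
      by (simp add: conv_def inner_add_right scaleR_add_left int)
    show "?L (c *\<^sub>R h) = c *\<^sub>R ?L h" for c h
      by (simp add: conv_def scaleR_scaleR[symmetric] del: scaleR_scaleR)
    show "norm (?L h) \<le> norm h * (M * (LINT y|lebesgue. norm (F y)))" for h
    proof -
      have "norm (?L h) \<le> (LINT y|lebesgue. norm ((g (x - y) \<bullet> h) *\<^sub>R F y))"
        unfolding conv_def by (rule integral_norm_bound)
      also have "\<dots> \<le> (LINT y|lebesgue. (M * norm h) * norm (F y))"
      proof (rule integral_mono)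
        show "norm ((g (x - y) \<bullet> h) *\<^sub>R F y) \<le> M * norm h * norm (F y)" for y
          using Cauchy_Schwarz_ineq2[of "g (x - y)" h] M(2)[of "x - y"]
            mult_right_mono[of "norm (g (x - y))" M "norm h"]
          by (auto intro!: mult_right_mono)
      qed (use int[of x h, THEN integrable_norm] F in auto)
      finally show ?thesis by (simp add: mult_ac)
    qed
  qed
  moreover have "\<exists>d>0. \<forall>y. norm (y - x) < d \<longrightarrow>
      norm (conv F \<rho> y - conv F \<rho> x - ?L (y - x)) \<le> e * norm (y - x)" if "e > 0" for e
  proof -
    define I where "I = (LINT y|lebesgue. norm (F y))"
    have I: "I \<ge> 0" by (simp add: I_def)
    define e' where "e' = e / (I + 1)"
    have e': "e' > 0" "e' * I \<le> e" using that I by (auto simp: e'_def field_simps)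
    obtain d where d: "d > 0" "\<And>x y. norm (x - y) < d \<Longrightarrow> norm (g x - g y) < e'"
      using uniformly_continuous_compact_support[OF has_gradD(2)[OF \<rho>] g0 e'(1)] by blast
    have lin: "\<bar>\<rho> (z + h) - \<rho> z - g z \<bullet> h\<bar> \<le> e' * norm h" if "norm h < d" for z h
    proof -
      have "norm (\<rho> (z + h) - \<rho> z - (\<lambda>h. g z \<bullet> h) ((z + h) - z)) \<le> norm ((z + h) - z) * e'"
      proof (rule differentiable_bound_linearization[of z "z + h" "ball z d" \<rho> "\<lambda>x h. g x \<bullet> h"])
        show "z + t *\<^sub>R (z + h - z) \<in> ball z d" if "t \<in> {0..1}" for t
        proof -
          have "\<bar>t\<bar> * norm h \<le> 1 * norm h" using that by (intro mult_right_mono) auto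
          then show ?thesis using \<open>norm h < d\<close> by (simp add: dist_norm)
        qed
        show "(\<rho> has_derivative (\<lambda>h. g x \<bullet> h)) (at x within ball z d)" for x
          using has_gradD(1)[OF \<rho>] has_derivative_at_withinI by blast
        show "onorm ((\<lambda>h. g x \<bullet> h) - (\<lambda>h. g z \<bullet> h)) \<le> e'" if "x \<in> ball z d" for x
        proof (rule onorm_le)
          fix v
          have "norm (g x - g z) < e'" using that d(2) by (simp add: dist_norm norm_minus_commute)
          then show "norm (((\<lambda>h. g x \<bullet> h) - (\<lambda>h. g z \<bullet> h)) v) \<le> e' * norm v"
            using Cauchy_Schwarz_ineq2[of "g x - g z" v] mult_right_mono[of "norm (g x - g z)" e' "norm v"]
            by (simp add: inner_diff_left)
        qed
      qed (use d in auto)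
      then show ?thesis by (simp add: mult.commute)
    qed
    show ?thesis
    proof (intro exI[of _ d] conjI allI impI d(1))
      fix y assume y: "norm (y - x) < d"
      have "norm (conv F \<rho> y - conv F \<rho> x - ?L (y - x)) =
          norm (LINT w|lebesgue. (\<rho> (y - w) - \<rho> (x - w) - g (x - w) \<bullet> (y - x)) *\<^sub>R F w)"
        by (simp add: conv_def scaleR_diff_left int int\<rho>)
      also have "\<dots> \<le> (LINT w|lebesgue. norm ((\<rho> (y - w) - \<rho> (x - w) - g (x - w) \<bullet> (y - x)) *\<^sub>R F w))"
        by (rule integral_norm_bound)
      also have "\<dots> \<le> (LINT w|lebesgue. (e' * norm (y - x)) * norm (F w))"
      proof (rule integral_mono)
        show "integrable lebesgue (\<lambda>w. norm ((\<rho> (y - w) - \<rho> (x - w) - g (x - w) \<bullet> (y - x)) *\<^sub>R F w))"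
          by (intro integrable_norm) (auto simp: scaleR_diff_left int int\<rho>)
        show "norm ((\<rho> (y - w) - \<rho> (x - w) - g (x - w) \<bullet> (y - x)) *\<^sub>R F w) \<le> e' * norm (y - x) * norm (F w)" for w
          using lin[OF y, of "x - w"] by (auto intro!: mult_right_mono)
      qed (use F in auto)
      also have "\<dots> = (e' * I) * norm (y - x)" by (simp add: I_def)
      also have "\<dots> \<le> e * norm (y - x)" using e'(2) by (intro mult_right_mono) auto
      finally show "norm (conv F \<rho> y - conv F \<rho> x - ?L (y - x)) \<le> e * norm (y - x)" .
    qed
  qed
  ultimately show ?thesis unfolding has_derivative_at_alt by blast
qed

text \<open>Convolutions of \<open>F\<close> with smooth kernels supported in a fixed ball form a class that is
  closed under directional derivatives.\<close>
lemma conv_smooth: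
  fixes F :: "'a::euclidean_space \<Rightarrow> 'b::euclidean_space"
  assumes F: "integrable lebesgue F" and \<rho>: "smooth_on UNIV \<rho>" and supp: "\<And>x. norm x > r \<Longrightarrow> \<rho> x = 0"
  shows "smooth_on UNIV (conv F \<rho>)"
proof (rule smooth_coinduct[of "\<lambda>\<phi>. \<exists>\<rho>. smooth_on UNIV \<rho> \<and> (\<forall>x. norm x > r \<longrightarrow> \<rho> x = 0) \<and> \<phi> = conv F \<rho>"])
  show "\<exists>\<rho>'. smooth_on UNIV \<rho>' \<and> (\<forall>x. norm x > r \<longrightarrow> \<rho>' x = 0) \<and> conv F \<rho> = conv F \<rho>'"
    using assms by blast
next
  fix f assume "\<exists>\<rho>. smooth_on UNIV \<rho> \<and> (\<forall>x. norm x > r \<longrightarrow> \<rho> x = 0) \<and> f = conv F \<rho>"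
  then obtain \<rho> where \<rho>: "smooth_on UNIV \<rho>" "\<And>x. norm x > r \<Longrightarrow> \<rho> x = 0" and f: "f = conv F \<rho>" by blast
  obtain g where g: "has_grad \<rho> g" "\<And>v. smooth_on UNIV (\<lambda>x. g x \<bullet> v)"
    using smooth_has_grad[OF \<rho>(1)] by blast
  have g0: "g x = 0" if "norm x > r" for x
    using has_grad_zero_off_closed[OF g(1), of "cball 0 r" 0] \<rho>(2) that by simp
  show "\<exists>f'. (\<forall>x. (f has_derivative f' x) (at x)) \<and>
      (\<forall>v. \<exists>\<rho>. smooth_on UNIV \<rho> \<and> (\<forall>x. r < norm x \<longrightarrow> \<rho> x = 0) \<and> (\<lambda>x. f' x v) = conv F \<rho>)"
  proof (intro exI[of _ "\<lambda>x h. conv F (\<lambda>z. g z \<bullet> h) x"] conjI allI)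
    show "(f has_derivative (\<lambda>h. conv F (\<lambda>z. g z \<bullet> h) x)) (at x)" for x
      unfolding f by (rule conv_has_derivative[OF F g(1) \<rho>(2)])
    show "\<exists>\<rho>. smooth_on UNIV \<rho> \<and> (\<forall>x. r < norm x \<longrightarrow> \<rho> x = 0) \<and>
       (\<lambda>x. conv F (\<lambda>z. g z \<bullet> v) x) = conv F \<rho>" for v
      using g(2) g0 by (intro exI[of _ "\<lambda>z. g z \<bullet> v"]) auto
  qed
qed

lemma conv_commute:
  fixes \<xi> \<rho> :: "'a::euclidean_space \<Rightarrow> real"
  assumes "\<And>x. integrable lebesgue (\<lambda>y. \<rho> (x - y) * \<xi> y)"
  shows "conv \<xi> \<rho> x = conv \<rho> \<xi> x"
  using lebesgue_reflect(2)[OF assms[of x], of x] by (simp add: conv_def mult.commute)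

lemma mollifier_integrable:
  assumes "mollifier \<delta> \<rho>"
  shows "integrable lebesgue \<rho>" "integrable lebesgue (\<lambda>y. \<rho> (x - y))" "(LINT y|lebesgue. \<rho> (x - y)) = 1"
    "continuous_on UNIV \<rho>" "\<And>x. norm x > \<delta> \<Longrightarrow> \<rho> x = 0"
proof -
  show c: "continuous_on UNIV \<rho>" using assms smooth_derivative(3) by (auto simp: mollifier_def)
  show z: "\<And>x. norm x > \<delta> \<Longrightarrow> \<rho> x = 0" using assms by (auto simp: mollifier_def)
  show i: "integrable lebesgue \<rho>"
    by (rule integrable_continuous_compact_support[OF c, of "cball 0 \<delta>"]) (auto simp: z)
  show "integrable lebesgue (\<lambda>y. \<rho> (x - y))" "(LINT y|lebesgue. \<rho> (x - y)) = 1"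
    using lebesgue_reflect[OF i, of x] assms by (auto simp: mollifier_def)
qed

lemma mollifier_scale_integrable:
  fixes F :: "'a::euclidean_space \<Rightarrow> 'b::euclidean_space"
  assumes "mollifier \<delta> \<rho>" "integrable lebesgue F"
  shows "integrable lebesgue (\<lambda>y. \<rho> (x - y) *\<^sub>R F y)"
proof -
  obtain M where "M > 0" "\<And>x. norm (\<rho> x) \<le> M"
    using bounded_compact_support[OF mollifier_integrable(4)[OF assms(1)], of "cball 0 \<delta>"]
      mollifier_integrable(5)[OF assms(1)] by auto
  then show ?thesis by (intro integrable_scale_bounded[OF assms(2) mollifier_integrable(4)[OF assms(1)]]) auto
qed

text \<open>With \<open>c = 0\<close> this is the maximum principle for mollification, with \<open>c = F x\<close> it gives
  convergence at the points of continuity.\<close>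
lemma mollify_bound:
  fixes F :: "'a::euclidean_space \<Rightarrow> 'b::euclidean_space"
  assumes \<rho>: "mollifier \<delta> \<rho>" and F: "integrable lebesgue F"
    and b: "AE y in lebesgue. y \<in> ball x \<delta> \<longrightarrow> norm (F y - c) \<le> b"
  shows "norm (conv F \<rho> x - c) \<le> b"
proof -
  note i = mollifier_integrable[OF \<rho>]
  have "conv F \<rho> x - c = (LINT y|lebesgue. \<rho> (x - y) *\<^sub>R F y) - (LINT y|lebesgue. \<rho> (x - y) *\<^sub>R c)"
    using i(2,3)[of x] by (simp add: conv_def)
  also have "\<dots> = (LINT y|lebesgue. \<rho> (x - y) *\<^sub>R (F y - c))"
    using i(2) mollifier_scale_integrable[OF \<rho> F]
    by (simp add: scaleR_diff_right)
  also have "norm \<dots> \<le> (LINT y|lebesgue. norm (\<rho> (x - y) *\<^sub>R (F y - c)))"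
    by (rule integral_norm_bound)
  also have "\<dots> \<le> (LINT y|lebesgue. \<rho> (x - y) * b)"
  proof (rule integral_mono_AE)
    show "integrable lebesgue (\<lambda>y. norm (\<rho> (x - y) *\<^sub>R (F y - c)))"
      using i(2) mollifier_scale_integrable[OF \<rho> F]
      by (intro integrable_norm) (auto simp: scaleR_diff_right)
    show "AE y in lebesgue. norm (\<rho> (x - y) *\<^sub>R (F y - c)) \<le> \<rho> (x - y) * b"
      using b
    proof eventually_elim
      case (elim y)
      show ?case
      proof (cases "y \<in> ball x \<delta>")
        case False
        then have "\<rho> (x - y) = 0" using \<rho> by (auto simp: mollifier_def dist_norm)
        then show ?thesis by simp
      next
        case True
        moreover have "\<rho> (x - y) \<ge> 0" using \<rho> by (auto simp: mollifier_def)
        ultimately show ?thesis using elim by (auto intro!: mult_left_mono)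
      qed
    qed
  qed (use i(2) in auto)
  also have "\<dots> = b" using i(2,3)[of x] by simp
  finally show ?thesis .
qed

lemma mollify_tendsto:
  fixes F :: "'a::euclidean_space \<Rightarrow> 'b::euclidean_space"
  assumes \<rho>: "\<And>m. mollifier (\<delta> m) (\<rho> m)" and \<delta>: "\<delta> \<longlonglongrightarrow> 0" and F: "integrable lebesgue F"
    and cont: "isCont F x"
  shows "(\<lambda>m. conv F (\<rho> m) x) \<longlonglongrightarrow> F x"
proof (rule LIMSEQ_I)
  fix e :: real assume "e > 0"
  then obtain d where d: "d > 0" "\<And>y. dist y x < d \<Longrightarrow> norm (F y - F x) < e / 2"
    using cont unfolding continuous_at_eps_delta dist_norm by (metis half_gt_zero)
  obtain m0 where m0: "\<And>m. m \<ge> m0 \<Longrightarrow> \<bar>\<delta> m\<bar> < d"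
    using LIMSEQ_D[OF \<delta> d(1)] by auto
  have "norm (conv F (\<rho> m) x - F x) < e" if "m \<ge> m0" for m
  proof -
    have "norm (conv F (\<rho> m) x - F x) \<le> e / 2"
      using m0[OF that] d(2) by (intro mollify_bound[OF \<rho> F]) (auto simp: dist_commute less_imp_le)
    then show ?thesis using \<open>e > 0\<close> by simp
  qed
  then show "\<exists>m0. \<forall>m\<ge>m0. norm (conv F (\<rho> m) x - F x) < e" by blast
qed

lemma mollify_support:
  assumes "mollifier \<delta> \<rho>" and "\<And>y. y \<notin> C \<Longrightarrow> F y = 0" and "conv F \<rho> x \<noteq> 0"
  shows "\<exists>y\<in>C. dist x y < \<delta>"
proof (rule ccontr)
  assume "\<not> ?thesis"
  then have "\<rho> (x - y) *\<^sub>R F y = 0" for y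
    using assms(1,2) by (cases "y \<in> C") (auto simp: mollifier_def dist_norm)
  then have "(\<lambda>y. \<rho> (x - y) *\<^sub>R F y) = (\<lambda>_. 0)" by blast
  then have "conv F \<rho> x = 0" by (simp add: conv_def)
  then show False using assms(3) by simp
qed

section \<open>Essentially continuous fields\<close>

text \<open>The regularity shared by all products of finite element fields.  It makes
  mollifications converge boundedly almost everywhere, and it is insensitive to the arbitrary values
  on facets.\<close>
definition ess_cont :: "'a::euclidean_space set \<Rightarrow> ('a \<Rightarrow> 'b::euclidean_space) \<Rightarrow> bool" where
  "ess_cont \<Omega> f \<longleftrightarrow> (\<exists>N b. negligible N \<and> (\<forall>x\<in>\<Omega> - N. isCont f x \<and> norm (f x) \<le> b))"

lemma ess_contE:
  assumes "ess_cont \<Omega> f"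
  obtains N b where "negligible N" "b \<ge> 0" "\<And>x. x \<in> \<Omega> \<Longrightarrow> x \<notin> N \<Longrightarrow> isCont f x"
    "\<And>x. x \<in> \<Omega> \<Longrightarrow> x \<notin> N \<Longrightarrow> norm (f x) \<le> b"
proof -
  obtain N b where *: "negligible N" "\<And>x. x \<in> \<Omega> - N \<Longrightarrow> isCont f x \<and> norm (f x) \<le> b"
    using assms by (auto simp: ess_cont_def)
  show ?thesis
    by (rule that[of N "max b 0"]) (use * in \<open>auto simp: le_max_iff_disj\<close>)
qed

lemma ess_contI:
  assumes "negligible N" "\<And>x. x \<in> \<Omega> \<Longrightarrow> x \<notin> N \<Longrightarrow> isCont f x"
    "\<And>x. x \<in> \<Omega> \<Longrightarrow> x \<notin> N \<Longrightarrow> norm (f x) \<le> b"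
  shows "ess_cont \<Omega> f"
  unfolding ess_cont_def using assms by blast

lemma ess_cont_const: "ess_cont \<Omega> (\<lambda>_. c)"
  unfolding ess_cont_def by (intro exI[of _ "{}"] exI[of _ "norm c"]) auto

lemma ess_cont_continuous:
  assumes "continuous_on UNIV f" "\<And>x. norm (f x) \<le> b"
  shows "ess_cont \<Omega> f"
  unfolding ess_cont_def using assms
  by (intro exI[of _ "{}"] exI[of _ b]) (auto simp: continuous_on_eq_continuous_at)

lemma ess_cont_indicator:
  assumes "closed D" "negligible (D - interior D)"
  shows "ess_cont \<Omega> (indicat_real D)"
proof (rule ess_contI[OF assms(2), of _ _ 1])
  fix x assume x: "x \<notin> D - interior D"
  define W where "W = (if x \<in> D then interior D else - D)"
  have W: "open W" "x \<in> W" "\<And>y. y \<in> W \<Longrightarrow> indicat_real D y = indicat_real D x"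
    using x assms(1) interior_subset[of D] by (auto simp: W_def indicator_def)
  have "\<forall>\<^sub>F y in nhds x. indicat_real D y = indicat_real D x"
    using eventually_nhds_in_open[OF W(1,2)] by (rule eventually_mono) (rule W(3))
  then show "isCont (indicat_real D) x" by (subst isCont_cong[where g="\<lambda>_. indicat_real D x"]) auto
qed (simp add: indicator_def)

lemma ess_cont_bilinear:
  assumes "bounded_bilinear op" "ess_cont \<Omega> f" "ess_cont \<Omega> g"
  shows "ess_cont \<Omega> (\<lambda>x. op (f x) (g x))"
proof -
  interpret bounded_bilinear op by fact
  obtain K where K: "\<And>a b. norm (op a b) \<le> norm a * norm b * K" "K > 0" using pos_bounded by blast
  obtain N b where f: "negligible N" "b \<ge> 0" "\<And>x. x \<in> \<Omega> \<Longrightarrow> x \<notin> N \<Longrightarrow> isCont f x"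
    "\<And>x. x \<in> \<Omega> \<Longrightarrow> x \<notin> N \<Longrightarrow> norm (f x) \<le> b" by (rule ess_contE[OF assms(2)]) (rule that)
  obtain N' b' where g: "negligible N'" "b' \<ge> 0" "\<And>x. x \<in> \<Omega> \<Longrightarrow> x \<notin> N' \<Longrightarrow> isCont g x"
    "\<And>x. x \<in> \<Omega> \<Longrightarrow> x \<notin> N' \<Longrightarrow> norm (g x) \<le> b'" by (rule ess_contE[OF assms(3)]) (rule that)
  show ?thesis
  proof (rule ess_contI)
    show "negligible (N \<union> N')" using f(1) g(1) by simp
    fix x assume x: "x \<in> \<Omega>" "x \<notin> N \<union> N'"
    show "isCont (\<lambda>x. op (f x) (g x)) x" using x f(3) g(3) by (intro isCont) auto
    have "norm (f x) * norm (g x) \<le> b * b'" using x f(2,4) g(2,4) by (intro mult_mono) auto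
    then show "norm (op (f x) (g x)) \<le> b * b' * K"
      using K(2) by (intro order_trans[OF K(1)] mult_right_mono) auto
  qed
qed

lemma ess_cont_add:
  assumes "ess_cont \<Omega> f" "ess_cont \<Omega> g"
  shows "ess_cont \<Omega> (\<lambda>x. f x + g x)"
proof -
  obtain N b where f: "negligible N" "b \<ge> 0" "\<And>x. x \<in> \<Omega> \<Longrightarrow> x \<notin> N \<Longrightarrow> isCont f x"
    "\<And>x. x \<in> \<Omega> \<Longrightarrow> x \<notin> N \<Longrightarrow> norm (f x) \<le> b" by (rule ess_contE[OF assms(1)]) (rule that)
  obtain N' b' where g: "negligible N'" "b' \<ge> 0" "\<And>x. x \<in> \<Omega> \<Longrightarrow> x \<notin> N' \<Longrightarrow> isCont g x"
    "\<And>x. x \<in> \<Omega> \<Longrightarrow> x \<notin> N' \<Longrightarrow> norm (g x) \<le> b'" by (rule ess_contE[OF assms(2)]) (rule that)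
  show ?thesis
    by (rule ess_contI[of "N \<union> N'" _ _ "b + b'"]) (use f g in \<open>auto intro!: norm_triangle_mono continuous_intros\<close>)
qed

lemma ess_cont_linear:
  assumes "bounded_linear k" "ess_cont \<Omega> f"
  shows "ess_cont \<Omega> (\<lambda>x. k (f x))"
proof -
  interpret bounded_linear k by fact
  obtain N b where f: "negligible N" "b \<ge> 0" "\<And>x. x \<in> \<Omega> \<Longrightarrow> x \<notin> N \<Longrightarrow> isCont f x"
    "\<And>x. x \<in> \<Omega> \<Longrightarrow> x \<notin> N \<Longrightarrow> norm (f x) \<le> b" by (rule ess_contE[OF assms(2)]) (rule that)
  obtain K where K: "\<And>a. norm (k a) \<le> norm a * K" "K > 0" using pos_bounded by blast
  show ?thesis
  proof (rule ess_contI[OF f(1)])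
    fix x assume x: "x \<in> \<Omega>" "x \<notin> N"
    show "isCont (\<lambda>x. k (f x)) x" using x f(3) by (intro isCont) auto
    show "norm (k (f x)) \<le> b * K"
      using x f(4) K(2) by (intro order_trans[OF K(1)] mult_right_mono) auto
  qed
qed

lemma ess_cont_sum:
  assumes "\<And>i. i \<in> I \<Longrightarrow> ess_cont \<Omega> (f i)"
  shows "ess_cont \<Omega> (\<lambda>x. \<Sum>i\<in>I. f i x)"
  using assms by (induction I rule: infinite_finite_induct) (auto intro: ess_cont_const ess_cont_add)

lemma ess_cont_extend:
  assumes "ess_cont \<Omega> F" and "closed C" "C \<subseteq> \<Omega>" and F0: "\<And>x. x \<notin> C \<Longrightarrow> F x = 0"
  shows "ess_cont UNIV F"
proof -
  obtain N b where f: "negligible N" "b \<ge> 0" "\<And>x. x \<in> \<Omega> \<Longrightarrow> x \<notin> N \<Longrightarrow> isCont F x"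
    "\<And>x. x \<in> \<Omega> \<Longrightarrow> x \<notin> N \<Longrightarrow> norm (F x) \<le> b" by (rule ess_contE[OF assms(1)]) (rule that)
  have "isCont F x" if "x \<notin> C" for x
  proof -
    have "\<forall>\<^sub>F y in nhds x. F y = 0"
      using eventually_nhds_in_open[OF open_Compl[OF \<open>closed C\<close>], of x] that F0 by (auto elim!: eventually_mono)
    then show ?thesis by (subst isCont_cong[where g="\<lambda>_. 0"]) auto
  qed
  moreover have "isCont F x" "norm (F x) \<le> b" if "x \<in> C" "x \<notin> N" for x
    using that f \<open>C \<subseteq> \<Omega>\<close> by auto
  moreover have "norm (F x) \<le> b" if "x \<notin> C" for x using that F0 f(2) by simp
  ultimately show ?thesis by (intro ess_contI[OF f(1)]) blast+
qed

lemma AE_not_negligible: "negligible N \<Longrightarrow> AE x in lebesgue. x \<notin> N"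
  by (simp add: AE_not_in negligible_iff_null_sets)

lemma borel_measurable_cong_negligible:
  fixes f g :: "'a::euclidean_space \<Rightarrow> 'b::topological_space"
  assumes g: "g \<in> borel_measurable lebesgue" and N: "negligible N" and eq: "\<And>x. x \<notin> N \<Longrightarrow> f x = g x"
  shows "f \<in> borel_measurable lebesgue"
proof (rule measurableI)
  fix A :: "'b set" assume A: "A \<in> sets borel"
  have "g -` A \<in> sets lebesgue" using measurable_sets[OF g A] by simp
  then have "g -` A - N \<in> sets lebesgue" using negligible_imp_sets[OF N] by (rule sets.Diff)
  moreover have "f -` A \<inter> N \<in> sets lebesgue"
    using N by (meson inf_le2 negligible_imp_sets negligible_subset)
  moreover have "f -` A \<inter> space lebesgue = (g -` A - N) \<union> (f -` A \<inter> N)" using eq by auto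
  ultimately show "f -` A \<inter> space lebesgue \<in> sets lebesgue" by (metis sets.Un)
qed simp

lemma ess_cont_measurable:
  fixes f :: "'a::euclidean_space \<Rightarrow> 'b::euclidean_space"
  assumes f: "ess_cont \<Omega> f" and D: "D \<in> sets lebesgue" "D \<subseteq> \<Omega>"
  shows "(\<lambda>x. indicat_real D x *\<^sub>R f x) \<in> borel_measurable lebesgue"
proof -
  obtain N b where N: "negligible N" "b \<ge> 0" "\<And>x. x \<in> \<Omega> \<Longrightarrow> x \<notin> N \<Longrightarrow> isCont f x"
    "\<And>x. x \<in> \<Omega> \<Longrightarrow> x \<notin> N \<Longrightarrow> norm (f x) \<le> b" by (rule ess_contE[OF f]) (rule that)
  have sN: "D - N \<in> sets lebesgue" using negligible_imp_sets[OF N(1)] D(1) by (rule sets.Diff[rotated])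
  have "continuous_on (D - N) f" using N(3) D(2) by (auto intro!: continuous_at_imp_continuous_on)
  then have "f \<in> borel_measurable (lebesgue_on (D - N))"
    using sN by (rule continuous_imp_measurable_on_sets_lebesgue)
  then have "(\<lambda>x. indicat_real (D - N) x *\<^sub>R f x) \<in> borel_measurable lebesgue"
    using sN by (subst (asm) borel_measurable_restrict_space_iff) auto
  then show ?thesis
    by (rule borel_measurable_cong_negligible[OF _ N(1)]) (auto simp: indicator_def)
qed

lemma ess_cont_set_integrable:
  fixes f :: "'a::euclidean_space \<Rightarrow> 'b::euclidean_space"
  assumes f: "ess_cont \<Omega> f" and D: "D \<in> lmeasurable" "D \<subseteq> \<Omega>"
  shows "set_integrable lebesgue D f"
proof -
  obtain N b where N: "negligible N" "b \<ge> 0" "\<And>x. x \<in> \<Omega> \<Longrightarrow> x \<notin> N \<Longrightarrow> isCont f x"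
    "\<And>x. x \<in> \<Omega> \<Longrightarrow> x \<notin> N \<Longrightarrow> norm (f x) \<le> b" by (rule ess_contE[OF f]) (rule that)
  have sD: "D \<in> sets lebesgue" using D(1) by (rule fmeasurableD)
  show ?thesis unfolding set_integrable_def
  proof (rule Bochner_Integration.integrable_bound)
    show "integrable lebesgue (\<lambda>x. b * indicat_real D x)"
      using D(1) by (simp add: lmeasurable_iff_integrable)
    show "(\<lambda>x. indicat_real D x *\<^sub>R f x) \<in> borel_measurable lebesgue" by (rule ess_cont_measurable[OF f sD D(2)])
    show "AE x in lebesgue. norm (indicat_real D x *\<^sub>R f x) \<le> norm (b * indicat_real D x)"
      using AE_not_negligible[OF N(1)]
    proof eventually_elim
      case (elim x)
      then show ?case using N(2,4) D(2) by (cases "x \<in> D") auto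
    qed
  qed
qed

lemma ess_cont_integrable:
  fixes f :: "'a::euclidean_space \<Rightarrow> 'b::euclidean_space"
  assumes f: "ess_cont UNIV f" and C: "C \<in> lmeasurable" and "\<And>x. x \<notin> C \<Longrightarrow> f x = 0"
  shows "integrable lebesgue f"
proof -
  have "(\<lambda>x. indicat_real C x *\<^sub>R f x) = f" using assms(3) by (auto simp: indicator_def fun_eq_iff)
  then show ?thesis using ess_cont_set_integrable[OF f C] by (simp add: set_integrable_def)
qed

section \<open>First-order weak derivatives\<close>

text \<open>One definition for the three weak operators: \<open>T i\<close> is the coefficient of the \<open>i\<close>-th
  partial derivative in the formal adjoint, that is \<open>cross3 i\<close> for the curl, \<open>\<lambda>b. - (i \<bullet> b)\<close> for the
  gradient, and \<open>\<lambda>r. r *\<^sub>R i\<close> for the negative divergence.\<close>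
definition weakly :: "(vec3 \<Rightarrow> 'b::euclidean_space \<Rightarrow> 'a::euclidean_space) \<Rightarrow> vec3 set \<Rightarrow> (vec3 \<Rightarrow> 'a) \<Rightarrow> (vec3 \<Rightarrow> 'b) \<Rightarrow> bool" where
  "weakly T \<Omega> u c \<longleftrightarrow> (\<forall>\<phi>. test_function \<Omega> \<phi> \<longrightarrow>
     (LINT x:\<Omega>|lebesgue. c x \<bullet> \<phi> x) =
     (LINT x:\<Omega>|lebesgue. u x \<bullet> (\<Sum>i\<in>Basis. T i (frechet_derivative \<phi> (at x) i))))"

text \<open>The radii are so small that mollifying a field supported in \<open>C\<close> yields a field
  supported in the compact set \<open>C'\<close> inside \<open>\<Omega>\<close>.\<close>
definition mollifying :: "'a::euclidean_space set \<Rightarrow> 'a set \<Rightarrow> 'a set \<Rightarrow> (nat \<Rightarrow> real) \<Rightarrow> (nat \<Rightarrow> 'a \<Rightarrow> real) \<Rightarrow> bool" where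
  "mollifying \<Omega> C C' \<delta> \<rho> \<longleftrightarrow> compact C' \<and> C' \<subseteq> \<Omega> \<and> (\<forall>m. mollifier (\<delta> m) (\<rho> m)) \<and> \<delta> \<longlonglongrightarrow> 0 \<and>
     (\<forall>m. 0 < \<delta> m) \<and> (\<forall>m x y. x \<notin> C' \<longrightarrow> y \<in> C \<longrightarrow> \<delta> m \<le> dist x y)"

lemma mollifyingD:
  assumes "mollifying \<Omega> C C' \<delta> \<rho>"
  shows "compact C'" "C' \<subseteq> \<Omega>" "mollifier (\<delta> m) (\<rho> m)" "\<delta> \<longlonglongrightarrow> 0" "0 < \<delta> m"
    "x \<notin> C' \<Longrightarrow> y \<in> C \<Longrightarrow> \<delta> m \<le> dist x y"
  using assms by (auto simp: mollifying_def)

lemma mollifying_exists: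
  fixes \<Omega> :: "'a::euclidean_space set"
  assumes "open \<Omega>" "compact C" "C \<subseteq> \<Omega>"
  shows "\<exists>C' \<delta> \<rho>. mollifying \<Omega> C C' \<delta> \<rho>"
proof -
  obtain e where e: "e > 0" "(\<Union>x\<in>C. cball x e) \<subseteq> \<Omega>"
    using compact_subset_open_imp_cball_epsilon_subset[OF assms(2,1,3)] by blast
  define C' where "C' = (\<Union>x\<in>C. \<Union>y\<in>cball 0 e. {x + y})"
  define \<delta> where "\<delta> m = e / real (Suc m)" for m
  have pos: "0 < \<delta> m" for m using e by (simp add: \<delta>_def)
  then have "\<exists>\<rho> :: nat \<Rightarrow> 'a \<Rightarrow> real. \<forall>m. mollifier (\<delta> m) (\<rho> m)"
    by (intro choice allI mollifier_exists)
  then obtain \<rho> :: "nat \<Rightarrow> 'a \<Rightarrow> real" where \<rho>: "\<And>m. mollifier (\<delta> m) (\<rho> m)" by blast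
  have "mollifying \<Omega> C C' \<delta> \<rho>"
    unfolding mollifying_def
  proof (intro conjI allI impI \<rho> pos)
    show "compact C'" unfolding C'_def using assms by (intro compact_sums') auto
    show "C' \<subseteq> \<Omega>" using e(2) by (force simp: C'_def dist_norm)
    show "\<delta> \<longlonglongrightarrow> 0" unfolding \<delta>_def
      using LIMSEQ_inverse_real_of_nat[THEN tendsto_mult_right_zero, of e]
      by (simp add: divide_inverse)
    fix m x y assume "x \<notin> C'" "y \<in> C"
    have "\<not> dist x y \<le> e"
    proof
      assume "dist x y \<le> e"
      then have "x = y + (x - y)" "x - y \<in> cball 0 e" by (auto simp: dist_norm norm_minus_commute)
      then show False using \<open>x \<notin> C'\<close> \<open>y \<in> C\<close> unfolding C'_def by blast
    qed
    moreover have "\<delta> m \<le> e" using e by (simp add: \<delta>_def field_simps)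
    ultimately show "\<delta> m \<le> dist x y" by simp
  qed
  then show ?thesis by blast
qed

lemma conv_zero:
  assumes "mollifier \<delta> \<rho>" and "\<And>y. y \<notin> C \<Longrightarrow> F y = 0" and "\<And>y. y \<in> C \<Longrightarrow> \<delta> \<le> dist x y"
  shows "conv F \<rho> x = 0"
  using mollify_support[OF assms(1,2)] assms(3) by force

lemma mollifier_has_grad:
  assumes "mollifier \<delta> \<rho>"
  obtains g where "has_grad \<rho> g"
  using assms smooth_has_grad unfolding mollifier_def by metis

lemma test_function_conv:
  fixes F :: "vec3 \<Rightarrow> 'b::euclidean_space"
  assumes "mollifier \<delta> \<rho>" "integrable lebesgue F" "compact C'" "C' \<subseteq> \<Omega>" "\<And>x. x \<notin> C' \<Longrightarrow> conv F \<rho> x = 0"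
  shows "test_function \<Omega> (conv F \<rho>)"
  unfolding test_function_def
  using conv_smooth[OF assms(2), of \<rho> \<delta>] mollifier_integrable(5)[OF assms(1)] assms
  by (auto simp: mollifier_def)

lemma integral_mollified_tendsto:
  fixes F k :: "vec3 \<Rightarrow> 'b::euclidean_space"
  assumes \<rho>: "\<And>m. mollifier (\<delta> m) (\<rho> m)" "\<delta> \<longlonglongrightarrow> 0"
    and C': "compact C'" "C' \<subseteq> \<Omega>" and k: "set_integrable lebesgue C' k"
    and F: "ess_cont UNIV F" "integrable lebesgue F"
    and 0: "\<And>m x. x \<notin> C' \<Longrightarrow> conv F (\<rho> m) x = 0" "\<And>x. x \<notin> C' \<Longrightarrow> F x = 0"
  shows "(\<lambda>m. LINT x:\<Omega>|lebesgue. k x \<bullet> conv F (\<rho> m) x) \<longlonglongrightarrow> (LINT x:\<Omega>|lebesgue. k x \<bullet> F x)"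
proof -
  let ?k = "\<lambda>x. indicat_real C' x *\<^sub>R k x"
  have k': "integrable lebesgue ?k" using k by (simp add: set_integrable_def)
  obtain N b where N: "negligible N" "b \<ge> 0" "\<And>x. x \<in> UNIV \<Longrightarrow> x \<notin> N \<Longrightarrow> isCont F x"
    "\<And>x. x \<in> UNIV \<Longrightarrow> x \<notin> N \<Longrightarrow> norm (F x) \<le> b" by (rule ess_contE[OF F(1)]) (rule that)
  have eq: "(LINT x:\<Omega>|lebesgue. k x \<bullet> f x) = (LINT x|lebesgue. ?k x \<bullet> f x)"
    if "\<And>x. x \<notin> C' \<Longrightarrow> f x = 0" for f
    unfolding set_lebesgue_integral_def
    by (rule Bochner_Integration.integral_cong) (use that C'(2) in \<open>auto simp: indicator_def\<close>)
  have "(\<lambda>m. LINT x|lebesgue. ?k x \<bullet> conv F (\<rho> m) x) \<longlonglongrightarrow> (LINT x|lebesgue. ?k x \<bullet> F x)"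
  proof (rule integral_dominated_convergence)
    have bm: "?k \<in> borel_measurable lebesgue" using k' by auto
    show "(\<lambda>x. ?k x \<bullet> F x) \<in> borel_measurable lebesgue"
      by (rule borel_measurable_inner[OF bm]) (use F(2) in auto)
    show "(\<lambda>x. ?k x \<bullet> conv F (\<rho> m) x) \<in> borel_measurable lebesgue" for m
    proof (rule borel_measurable_inner[OF bm])
      have "continuous_on UNIV (conv F (\<rho> m))"
        using \<rho>(1)[of m] mollifier_integrable(5)[OF \<rho>(1)[of m]]
        by (intro smooth_derivative(3) conv_smooth[OF F(2), of _ "\<delta> m"]) (auto simp: mollifier_def)
      then have "conv F (\<rho> m) \<in> borel_measurable borel" by (rule borel_measurable_continuous_onI)
      then show "conv F (\<rho> m) \<in> borel_measurable lebesgue" by (simp add: measurable_completion)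
    qed
    show "integrable lebesgue (\<lambda>x. norm (?k x) * b)" using integrable_norm[OF k'] by (intro integrable_mult_left)
    show "AE x in lebesgue. (\<lambda>m. ?k x \<bullet> conv F (\<rho> m) x) \<longlonglongrightarrow> ?k x \<bullet> F x"
      using AE_not_negligible[OF N(1)]
      by eventually_elim (intro tendsto_intros mollify_tendsto[OF \<rho> F(2)] N, auto)
    have "norm (conv F (\<rho> m) x - 0) \<le> b" for m x
      by (rule mollify_bound[OF \<rho>(1) F(2)]) (use AE_not_negligible[OF N(1)] N(4) in \<open>auto elim!: eventually_mono\<close>)
    then have "norm (?k x \<bullet> conv F (\<rho> m) x) \<le> norm (?k x) * b" for m x
      using Cauchy_Schwarz_ineq2[of "?k x" "conv F (\<rho> m) x"] mult_left_mono[of "norm (conv F (\<rho> m) x)" b "norm (?k x)"]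
      by simp
    then show "AE x in lebesgue. norm (?k x \<bullet> conv F (\<rho> m) x) \<le> norm (?k x) * b" for m by simp
  qed
  then show ?thesis using 0 by (simp add: eq)
qed

lemma ess_cont_locally_integrable: "ess_cont \<Omega> f \<Longrightarrow> locally_integrable \<Omega> f"
  unfolding locally_integrable_def by (auto intro!: ess_cont_set_integrable lmeasurable_compact)

lemma ess_cont_compact_support:
  fixes F :: "vec3 \<Rightarrow> 'b::euclidean_space"
  assumes "ess_cont \<Omega> F" "compact C" "C \<subseteq> \<Omega>" "\<And>x. x \<notin> C \<Longrightarrow> F x = 0"
  shows "ess_cont UNIV F" "integrable lebesgue F"
proof -
  show 1: "ess_cont UNIV F" using assms by (intro ess_cont_extend[of \<Omega> F C]) (auto simp: compact_imp_closed)
  show "integrable lebesgue F" by (rule ess_cont_integrable[OF 1 lmeasurable_compact[OF assms(2)] assms(4)])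
qed

lemma ess_cont_continuous_compact:
  fixes f :: "'a::euclidean_space \<Rightarrow> 'b::euclidean_space"
  assumes "continuous_on UNIV f" "compact C" "\<And>x. x \<notin> C \<Longrightarrow> f x = 0"
  shows "ess_cont \<Omega> f"
proof -
  obtain M where "\<And>x. norm (f x) \<le> M" using bounded_compact_support[OF assms] by blast
  then show ?thesis by (rule ess_cont_continuous[OF assms(1)])
qed

text \<open>Mollifications of an essentially continuous field \<open>F\<close> are admissible test functions
  and converge boundedly, which takes the place of the fundamental lemma of the calculus of
  variations.\<close>
lemma weak_unique:
  fixes F :: "vec3 \<Rightarrow> 'b::euclidean_space"
  assumes w: "weakly T \<Omega> u c" "weakly T \<Omega> u c'" and li: "locally_integrable \<Omega> c" "locally_integrable \<Omega> c'"
    and \<Omega>: "open \<Omega>" and C: "compact C" "C \<subseteq> \<Omega>" and F: "ess_cont \<Omega> F" "\<And>x. x \<notin> C \<Longrightarrow> F x = 0"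
  shows "(LINT x:\<Omega>|lebesgue. c x \<bullet> F x) = (LINT x:\<Omega>|lebesgue. c' x \<bullet> F x)"
proof -
  obtain C' \<delta> \<rho> where "mollifying \<Omega> C C' \<delta> \<rho>" using mollifying_exists[OF \<Omega> C] by blast
  note \<rho> = mollifyingD[OF this]
  note F' = ess_cont_compact_support[OF F(1) C F(2)]
  have 0: "conv F (\<rho> m) x = 0" if "x \<notin> C'" for m x
    by (rule conv_zero[OF \<rho>(3) F(2) \<rho>(6)[OF that]])
  have F0: "F x = 0" if "x \<notin> C'" for x
    using \<rho>(6)[OF that, of x] \<rho>(5) F(2) by (metis dist_self linorder_not_le)
  have T: "test_function \<Omega> (conv F (\<rho> m))" for m
    by (rule test_function_conv[OF \<rho>(3) F'(2) \<rho>(1,2) 0])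
  have l: "(\<lambda>m. LINT x:\<Omega>|lebesgue. k x \<bullet> conv F (\<rho> m) x) \<longlonglongrightarrow> (LINT x:\<Omega>|lebesgue. k x \<bullet> F x)"
    if "locally_integrable \<Omega> k" for k
    by (rule integral_mollified_tendsto[OF \<rho>(3,4,1,2) _ F' 0 F0])
       (use that \<rho>(1,2) in \<open>auto simp: locally_integrable_def\<close>)
  have "(LINT x:\<Omega>|lebesgue. c x \<bullet> conv F (\<rho> m) x) = (LINT x:\<Omega>|lebesgue. c' x \<bullet> conv F (\<rho> m) x)" for m
    using w T[of m] by (auto simp: weakly_def)
  then show ?thesis using LIMSEQ_unique[OF l[OF li(1)]] l[OF li(2)] by simp
qed

text \<open>In contrast to \<open>conv_has_derivative\<close>, the derivative falls on the function and not on
  the kernel, by commutativity of the convolution.\<close>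
lemma has_derivative_conv_scalar:
  fixes \<xi> :: "'a::euclidean_space \<Rightarrow> real"
  assumes \<rho>: "continuous_on UNIV \<rho>" "\<And>x. norm x > \<delta> \<Longrightarrow> \<rho> x = 0"
    and \<xi>: "has_grad \<xi> g" and C: "compact C" "\<And>x. x \<notin> C \<Longrightarrow> \<xi> x = 0"
  shows "(conv \<xi> \<rho> has_derivative (\<lambda>h. conv (\<lambda>z. g z \<bullet> h) \<rho> x)) (at x)"
proof -
  have g0: "g x = 0" if "x \<notin> C" for x
    using has_grad_zero_off_closed[OF \<xi> compact_imp_closed[OF C(1)]] C(2) that by blast
  have com: "conv f \<rho> x = conv \<rho> f x" if f: "continuous_on UNIV f" "\<And>x. x \<notin> C \<Longrightarrow> f x = 0" for f :: "'a \<Rightarrow> real" and x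
  proof (rule conv_commute)
    obtain M where M: "\<And>x. norm (\<rho> x) \<le> M"
      by (rule bounded_compact_support[OF \<rho>(1), of "cball 0 \<delta>"]) (use \<rho>(2) in auto)
    show "integrable lebesgue (\<lambda>y. \<rho> (x - y) * f y)" for x
      using integrable_scale_bounded[OF integrable_continuous_compact_support[OF f(1) C(1) f(2)] \<rho>(1) M, of x] by simp
  qed
  have 1: "conv \<xi> \<rho> = conv \<rho> \<xi>" using com[OF has_gradD(3)[OF \<xi>] C(2)] by blast
  have "continuous_on UNIV (\<lambda>z. g z \<bullet> h)" for h using has_gradD(2)[OF \<xi>] by (intro continuous_intros)
  then have 2: "conv (\<lambda>z. g z \<bullet> h) \<rho> x = conv \<rho> (\<lambda>z. g z \<bullet> h) x" for h
    using g0 by (intro com) auto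
  obtain r where r: "\<And>x. x \<in> C \<Longrightarrow> norm x \<le> r"
    using compact_imp_bounded[OF C(1)] by (auto simp: bounded_iff)
  show ?thesis unfolding 1 2
    by (rule conv_has_derivative[OF _ \<xi>, of _ r]) (use r C(2) \<rho> in \<open>force intro: integrable_continuous_compact_support[of _ "cball 0 \<delta>"]\<close>)+
qed

lemma conv_linear:
  assumes "bounded_linear k" "mollifier \<delta> \<rho>" "integrable lebesgue F"
  shows "conv (\<lambda>y. k (F y)) \<rho> x = k (conv F \<rho> x)"
  using integral_bounded_linear[OF assms(1) mollifier_scale_integrable[OF assms(2,3), of x]]
  by (simp add: conv_def linear_cmul[OF bounded_linear.linear[OF assms(1)]])

lemma conv_sum:
  assumes "mollifier \<delta> \<rho>" "\<And>i. i \<in> I \<Longrightarrow> integrable lebesgue (F i)"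
  shows "conv (\<lambda>y. \<Sum>i\<in>I. F i y) \<rho> x = (\<Sum>i\<in>I. conv (F i) \<rho> x)"
  unfolding conv_def scaleR_sum_right
  by (rule Bochner_Integration.integral_sum) (rule mollifier_scale_integrable[OF assms(1,2)])

text \<open>Mollification commutes with derivatives, so smooth test functions can be traded for
  \<open>C\<^sup>1\<close> ones.\<close>
lemma weakly_C1_test:
  fixes u :: "vec3 \<Rightarrow> 'a::euclidean_space" and c :: "vec3 \<Rightarrow> 'b::euclidean_space"
  assumes w: "weakly T \<Omega> u c" and T: "\<And>i. linear (T i)"
    and li: "locally_integrable \<Omega> u" "locally_integrable \<Omega> c"
    and \<Omega>: "open \<Omega>" and C: "compact C" "C \<subseteq> \<Omega>" and \<xi>: "has_grad \<xi> g" "\<And>x. x \<notin> C \<Longrightarrow> \<xi> x = 0"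
  shows "(LINT x:\<Omega>|lebesgue. c x \<bullet> (\<xi> x *\<^sub>R a)) = (LINT x:\<Omega>|lebesgue. u x \<bullet> (\<Sum>i\<in>Basis. (g x \<bullet> i) *\<^sub>R T i a))"
proof -
  obtain C' \<delta> \<rho> where "mollifying \<Omega> C C' \<delta> \<rho>" using mollifying_exists[OF \<Omega> C] by blast
  note \<rho> = mollifyingD[OF this]
  have CC': "x \<in> C'" if "x \<in> C" for x
    by (rule ccontr) (use \<rho>(6)[of x x 0] \<rho>(5)[of 0] that in auto)
  have off: "x \<notin> C" if "x \<notin> C'" for x using CC' that by blast
  have si: "set_integrable lebesgue C' f" if "locally_integrable \<Omega> f" for f :: "vec3 \<Rightarrow> 'c::euclidean_space"
    using that \<rho>(1,2) by (auto simp: locally_integrable_def)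
  have g0: "g x = 0" if "x \<notin> C" for x
    using has_grad_zero_off_closed[OF \<xi>(1) compact_imp_closed[OF C(1)]] \<xi>(2) that by blast
  let ?F = "\<lambda>x. \<xi> x *\<^sub>R a" and ?G = "\<lambda>x. \<Sum>i\<in>Basis. (g x \<bullet> i) *\<^sub>R T i a"
  have F0: "?F x = 0" and G0: "?G x = 0" if "x \<notin> C" for x using that \<xi>(2) g0 by auto
  have cF: "continuous_on UNIV ?F" and cG: "continuous_on UNIV ?G" and cg: "continuous_on UNIV (\<lambda>x. g x \<bullet> i)" for i
    using has_gradD(2,3)[OF \<xi>(1)] by (auto intro!: continuous_intros)
  have eF: "ess_cont UNIV ?F"
    by (rule ess_cont_continuous_compact[OF cF C(1) F0])
  have eG: "ess_cont UNIV ?G"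
    by (rule ess_cont_continuous_compact[OF cG C(1) G0])
  note iF = integrable_continuous_compact_support[OF cF C(1) F0]
  note iG = integrable_continuous_compact_support[OF cG C(1) G0]
  have i\<xi>: "integrable lebesgue \<xi>"
    by (rule integrable_continuous_compact_support[OF has_gradD(3)[OF \<xi>(1)] C(1) \<xi>(2)])
  have ig: "integrable lebesgue (\<lambda>x. g x \<bullet> i)" for i
    by (rule integrable_continuous_compact_support[OF cg C(1)]) (simp add: g0)
  have z: "conv H (\<rho> m) x = 0" if "x \<notin> C'" "\<And>x. x \<notin> C \<Longrightarrow> H x = 0" for H :: "vec3 \<Rightarrow> 'c::euclidean_space" and m x
    by (rule conv_zero[OF \<rho>(3) that(2) \<rho>(6)[OF that(1)]])
  have D: "(conv ?F (\<rho> m) has_derivative (\<lambda>h. conv (\<lambda>z. g z \<bullet> h) (\<rho> m) x *\<^sub>R a)) (at x)" for m x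
  proof -
    have "conv ?F (\<rho> m) = (\<lambda>x. conv \<xi> (\<rho> m) x *\<^sub>R a)"
      by (rule ext) (rule conv_linear[OF bounded_linear_scaleR_left \<rho>(3) i\<xi>])
    then show ?thesis
      using has_derivative_scaleR_left[OF has_derivative_conv_scalar[OF mollifier_integrable(4,5)[OF \<rho>(3)] \<xi>(1) C(1) \<xi>(2)]] by simp
  qed
  have TG: "(\<Sum>i\<in>Basis. T i (frechet_derivative (conv ?F (\<rho> m)) (at x) i)) = conv ?G (\<rho> m) x" for m x
  proof -
    have "conv ?G (\<rho> m) x = (\<Sum>i\<in>Basis. conv (\<lambda>x. (g x \<bullet> i) *\<^sub>R T i a) (\<rho> m) x)"
      by (rule conv_sum[OF \<rho>(3)]) (use ig in auto)
    also have "\<dots> = (\<Sum>i\<in>Basis. conv (\<lambda>x. g x \<bullet> i) (\<rho> m) x *\<^sub>R T i a)"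
      by (simp add: conv_linear[OF bounded_linear_scaleR_left \<rho>(3) ig])
    finally have G: "conv ?G (\<rho> m) x = (\<Sum>i\<in>Basis. conv (\<lambda>x. g x \<bullet> i) (\<rho> m) x *\<^sub>R T i a)" .
    have "frechet_derivative (conv ?F (\<rho> m)) (at x) = (\<lambda>h. conv (\<lambda>z. g z \<bullet> h) (\<rho> m) x *\<^sub>R a)"
      by (rule frechet_derivative_at[OF D, symmetric])
    then show ?thesis unfolding G by (simp only: linear_cmul[OF T])
  qed
  have l1: "(\<lambda>m. LINT x:\<Omega>|lebesgue. c x \<bullet> conv ?F (\<rho> m) x) \<longlonglongrightarrow> (LINT x:\<Omega>|lebesgue. c x \<bullet> ?F x)"
    by (rule integral_mollified_tendsto[OF \<rho>(3,4,1,2) si[OF li(2)] eF iF z[OF _ F0] F0[OF off]])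
  have l2: "(\<lambda>m. LINT x:\<Omega>|lebesgue. u x \<bullet> conv ?G (\<rho> m) x) \<longlonglongrightarrow> (LINT x:\<Omega>|lebesgue. u x \<bullet> ?G x)"
    by (rule integral_mollified_tendsto[OF \<rho>(3,4,1,2) si[OF li(1)] eG iG z[OF _ G0] G0[OF off]])
  have "test_function \<Omega> (conv ?F (\<rho> m))" for m
    by (rule test_function_conv[OF \<rho>(3) iF \<rho>(1,2) z[OF _ F0]])
  then have "(LINT x:\<Omega>|lebesgue. c x \<bullet> conv ?F (\<rho> m) x) = (LINT x:\<Omega>|lebesgue. u x \<bullet> conv ?G (\<rho> m) x)" for m
    using w by (simp add: weakly_def TG)
  then show ?thesis using LIMSEQ_unique[OF l1] l2 by simp
qed

lemma set_integral_compact_support: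
  fixes f :: "vec3 \<Rightarrow> 'b::euclidean_space"
  assumes "C \<subseteq> \<Omega>" "\<And>x. x \<notin> C \<Longrightarrow> f x = 0"
  shows "(LINT x:\<Omega>|lebesgue. f x) = integral\<^sup>L lebesgue f"
  unfolding set_lebesgue_integral_def
  by (rule Bochner_Integration.integral_cong) (use assms in \<open>auto simp: indicator_def\<close>)

text \<open>The Leibniz rule: the field with components \<open>u \<bullet> T i v\<close> has weak divergence
  \<open>u \<bullet> e - c \<bullet> v\<close>.  The mollification of \<open>\<eta> v\<close> is a test function for the weak derivative of \<open>u\<close>, and
  the operator applied to this mollification is found by testing the weak derivative of \<open>v\<close> with
  translates of the kernel, multiplied by \<open>\<eta>\<close>.  Only one of the two fields has to be regularised.\<close>
lemma weak_product_rule: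
  fixes u e :: "vec3 \<Rightarrow> 'a::euclidean_space" and c v :: "vec3 \<Rightarrow> 'b::euclidean_space"
  assumes u: "weakly T \<Omega> u c" and v: "weakly (\<lambda>i a. - T' i a) \<Omega> v e"
    and adj: "\<And>i a b. T i b \<bullet> a = b \<bullet> T' i a" and lin: "\<And>i. linear (T i)" "\<And>i. linear (T' i)"
    and ec: "ess_cont \<Omega> u" "ess_cont \<Omega> c" "ess_cont \<Omega> v" "ess_cont \<Omega> e"
    and \<Omega>: "open \<Omega>" and C: "compact C" "C \<subseteq> \<Omega>" and \<eta>: "has_grad \<eta> g" "\<And>x. x \<notin> C \<Longrightarrow> \<eta> x = 0"
  shows "(LINT x:\<Omega>|lebesgue. \<eta> x * (u x \<bullet> e x - c x \<bullet> v x) + (\<Sum>i\<in>Basis. (g x \<bullet> i) * (u x \<bullet> T i (v x)))) = 0"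
proof -
  obtain C' \<delta> \<rho> where "mollifying \<Omega> C C' \<delta> \<rho>" using mollifying_exists[OF \<Omega> C] by blast
  note \<rho> = mollifyingD[OF this]
  have CC': "x \<in> C'" if "x \<in> C" for x
    by (rule ccontr) (use \<rho>(6)[of x x 0] \<rho>(5)[of 0] that in auto)
  have off: "x \<notin> C" if "x \<notin> C'" for x using CC' that by blast
  have si: "set_integrable lebesgue C' f" if "locally_integrable \<Omega> f" for f :: "vec3 \<Rightarrow> 'c::euclidean_space"
    using that \<rho>(1,2) by (auto simp: locally_integrable_def)
  have g0: "g x = 0" if "x \<notin> C" for x
    using has_grad_zero_off_closed[OF \<eta>(1) compact_imp_closed[OF C(1)]] \<eta>(2) that by blast
  define V where "V x = \<eta> x *\<^sub>R v x" for x
  define p where "p x = \<eta> x *\<^sub>R e x" for x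
  define q where "q x = (\<Sum>i\<in>Basis. (g x \<bullet> i) *\<^sub>R T i (v x))" for x
  define Z where "Z x = p x + q x" for x
  have zero: "V x = 0" "p x = 0" "q x = 0" "Z x = 0" if "x \<notin> C" for x
    using that \<eta>(2) g0 by (auto simp: V_def p_def q_def Z_def)
  have e\<eta>: "ess_cont \<Omega> \<eta>" and eg: "ess_cont \<Omega> (\<lambda>x. g x \<bullet> i)" for i
    using has_gradD(2,3)[OF \<eta>(1)] \<eta>(2) g0
    by (auto intro!: ess_cont_continuous_compact[OF _ C(1)] continuous_intros)
  have T: "bounded_linear (T i)" for i using lin(1) by (simp add: linear_conv_bounded_linear)
  have eV: "ess_cont \<Omega> V" unfolding V_def by (rule ess_cont_bilinear[OF bounded_bilinear_scaleR e\<eta> ec(3)])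
  have ep: "ess_cont \<Omega> p" unfolding p_def by (rule ess_cont_bilinear[OF bounded_bilinear_scaleR e\<eta> ec(4)])
  have eq: "ess_cont \<Omega> q" unfolding q_def
    by (intro ess_cont_sum ess_cont_bilinear[OF bounded_bilinear_scaleR eg] ess_cont_linear[OF T ec(3)])
  have eZ: "ess_cont \<Omega> Z" unfolding Z_def by (rule ess_cont_add[OF ep eq])
  note V = ess_cont_compact_support[OF eV C zero(1)]
  note p = ess_cont_compact_support[OF ep C zero(2)]
  note q = ess_cont_compact_support[OF eq C zero(3)]
  note Z = ess_cont_compact_support[OF eZ C zero(4)]
  have z: "conv H (\<rho> m) x = 0" if "x \<notin> C'" "\<And>x. x \<notin> C \<Longrightarrow> H x = 0" for H :: "vec3 \<Rightarrow> 'c::euclidean_space" and m x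
    by (rule conv_zero[OF \<rho>(3) that(2) \<rho>(6)[OF that(1)]])
  have TZ: "(\<Sum>i\<in>Basis. T i (frechet_derivative (conv V (\<rho> m)) (at x) i)) = conv Z (\<rho> m) x" for m x
  proof -
    obtain k where k: "has_grad (\<rho> m) k" using mollifier_has_grad[OF \<rho>(3)] .
    have k0: "k x = 0" if "norm x > \<delta> m" for x
      using has_grad_zero_off_closed[OF k, of "cball 0 (\<delta> m)" 0] mollifier_integrable(5)[OF \<rho>(3)] that by simp
    obtain M where M: "\<And>x. norm (k x) \<le> M"
      by (rule bounded_compact_support[OF has_gradD(2)[OF k], of "cball 0 (\<delta> m)"]) (use k0 in auto)
    have ik: "integrable lebesgue (\<lambda>y. (k (x - y) \<bullet> i) *\<^sub>R V y)" for i
    proof (rule integrable_scale_bounded[OF V(2), of "\<lambda>z. k z \<bullet> i" "M * norm i"])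
      show "continuous_on UNIV (\<lambda>z. k z \<bullet> i)" using has_gradD(2)[OF k] by (intro continuous_intros)
      show "norm (k z \<bullet> i) \<le> M * norm i" for z
        using Cauchy_Schwarz_ineq2[of "k z" i] M[of z] mult_right_mono[of "norm (k z)" M "norm i"] by simp
    qed
    have D: "frechet_derivative (conv V (\<rho> m)) (at x) = (\<lambda>h. conv V (\<lambda>z. k z \<bullet> h) x)"
      using frechet_derivative_at[OF conv_has_derivative[OF V(2) k mollifier_integrable(5)[OF \<rho>(3)]]] by simp
    \<comment> \<open>the translated kernel, cut off by \<open>\<eta>\<close>, as a test function for \<open>v\<close>\<close>
    define \<xi> where "\<xi> y = \<rho> m (x - y) * \<eta> y" for y
    define l where "l y = \<rho> m (x - y) *\<^sub>R g y + \<eta> y *\<^sub>R (- k (x - y))" for y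
    have \<xi>l: "has_grad \<xi> l" unfolding \<xi>_def l_def
      by (rule has_grad_mult[OF has_grad_compose_affine[OF k] \<eta>(1)])
    note ip = mollifier_scale_integrable[OF \<rho>(3)[of m] p(2), of x]
    note iq = mollifier_scale_integrable[OF \<rho>(3)[of m] q(2), of x]
    have "a \<bullet> (\<Sum>i\<in>Basis. T i (conv V (\<lambda>z. k z \<bullet> i) x)) = a \<bullet> conv Z (\<rho> m) x" for a
    proof -
      let ?R = "\<lambda>y. \<Sum>i\<in>Basis. ((k (x - y) \<bullet> i) *\<^sub>R V y) \<bullet> T' i a"
      have iR: "integrable lebesgue ?R" using ik by (intro Bochner_Integration.integrable_sum integrable_inner_left) auto
      have "a \<bullet> (\<Sum>i\<in>Basis. T i (conv V (\<lambda>z. k z \<bullet> i) x)) = (\<Sum>i\<in>Basis. conv V (\<lambda>z. k z \<bullet> i) x \<bullet> T' i a)"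
        unfolding inner_sum_right by (intro sum.cong refl) (metis adj inner_commute)
      also have "\<dots> = (LINT y|lebesgue. ?R y)"
        unfolding conv_def using ik by (subst Bochner_Integration.integral_sum) (auto simp del: inner_scaleR_left)
      also have "\<dots> = (LINT y|lebesgue. (\<rho> m (x - y) *\<^sub>R p y) \<bullet> a + (\<rho> m (x - y) *\<^sub>R q y) \<bullet> a)"
      proof -
        have "(LINT y:\<Omega>|lebesgue. e y \<bullet> (\<xi> y *\<^sub>R a)) = (LINT y:\<Omega>|lebesgue. v y \<bullet> (\<Sum>i\<in>Basis. (l y \<bullet> i) *\<^sub>R (- T' i a)))"
        proof (rule weakly_C1_test[OF v _ _ _ \<Omega> C \<xi>l])
          show "linear (\<lambda>a. - T' i a)" for i using lin(2) linear_compose_neg by blast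
          show "\<xi> y = 0" if "y \<notin> C" for y using \<eta>(2)[OF that] by (simp add: \<xi>_def)
        qed (use ec ess_cont_locally_integrable in auto)
        also have "(LINT y:\<Omega>|lebesgue. e y \<bullet> (\<xi> y *\<^sub>R a)) = (LINT y|lebesgue. (\<rho> m (x - y) *\<^sub>R p y) \<bullet> a)"
          by (subst set_integral_compact_support[OF C(2)]) (auto simp: \<xi>_def p_def \<eta>(2) mult_ac)
        also have "(LINT y:\<Omega>|lebesgue. v y \<bullet> (\<Sum>i\<in>Basis. (l y \<bullet> i) *\<^sub>R (- T' i a)))
           = (LINT y|lebesgue. ?R y - (\<rho> m (x - y) *\<^sub>R q y) \<bullet> a)"
        proof (subst set_integral_compact_support[OF C(2)])
          show "v y \<bullet> (\<Sum>i\<in>Basis. (l y \<bullet> i) *\<^sub>R (- T' i a)) = 0" if "y \<notin> C" for y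
            using g0[OF that] \<eta>(2)[OF that] by (simp add: l_def)
          have "v y \<bullet> (\<Sum>i\<in>Basis. (l y \<bullet> i) *\<^sub>R (- T' i a)) = ?R y - (\<rho> m (x - y) *\<^sub>R q y) \<bullet> a" for y
          proof -
            have "v y \<bullet> ((l y \<bullet> i) *\<^sub>R (- T' i a)) = ((k (x - y) \<bullet> i) *\<^sub>R V y) \<bullet> T' i a
               - \<rho> m (x - y) * ((g y \<bullet> i) *\<^sub>R T i (v y) \<bullet> a)" for i
              by (simp add: l_def V_def inner_diff_left adj algebra_simps)
            then show ?thesis
              by (simp only: inner_sum_right sum_subtractf q_def inner_sum_left sum_distrib_left inner_scaleR_left[of _ "sum _ _"])
          qed
          then show "integral\<^sup>L lebesgue (\<lambda>y. v y \<bullet> (\<Sum>i\<in>Basis. (l y \<bullet> i) *\<^sub>R (- T' i a)))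
            = (LINT y|lebesgue. ?R y - (\<rho> m (x - y) *\<^sub>R q y) \<bullet> a)" by simp
        qed
        also have "\<dots> = (LINT y|lebesgue. ?R y) - (LINT y|lebesgue. (\<rho> m (x - y) *\<^sub>R q y) \<bullet> a)"
          using iR integrable_inner_left[OF iq, of a] by (intro Bochner_Integration.integral_diff) auto
        finally show ?thesis
          using integrable_inner_left[OF iq, of a] integrable_inner_left[OF ip, of a]
          by (subst Bochner_Integration.integral_add) auto
      qed
      also have "\<dots> = (LINT y|lebesgue. (\<rho> m (x - y) *\<^sub>R Z y) \<bullet> a)"
        by (simp add: Z_def scaleR_add_right inner_add_left distrib_left)
      also have "\<dots> = a \<bullet> conv Z (\<rho> m) x"
        using integral_inner_left[of a lebesgue "\<lambda>y. \<rho> m (x - y) *\<^sub>R Z y"] mollifier_scale_integrable[OF \<rho>(3)[of m] Z(2), of x]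
        by (simp add: conv_def inner_commute del: inner_scaleR_left)
      finally show ?thesis .
    qed
    then show ?thesis unfolding D using vector_eq_ldot by blast
  qed
  have l1: "(\<lambda>m. LINT x:\<Omega>|lebesgue. c x \<bullet> conv V (\<rho> m) x) \<longlonglongrightarrow> (LINT x:\<Omega>|lebesgue. c x \<bullet> V x)"
    by (rule integral_mollified_tendsto[OF \<rho>(3,4,1,2) si[OF ess_cont_locally_integrable[OF ec(2)]] V z[OF _ zero(1)] zero(1)[OF off]])
  have l2: "(\<lambda>m. LINT x:\<Omega>|lebesgue. u x \<bullet> conv Z (\<rho> m) x) \<longlonglongrightarrow> (LINT x:\<Omega>|lebesgue. u x \<bullet> Z x)"
    by (rule integral_mollified_tendsto[OF \<rho>(3,4,1,2) si[OF ess_cont_locally_integrable[OF ec(1)]] Z z[OF _ zero(4)] zero(4)[OF off]])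
  have "test_function \<Omega> (conv V (\<rho> m))" for m
    by (rule test_function_conv[OF \<rho>(3) V(2) \<rho>(1,2) z[OF _ zero(1)]])
  then have "(LINT x:\<Omega>|lebesgue. c x \<bullet> conv V (\<rho> m) x) = (LINT x:\<Omega>|lebesgue. u x \<bullet> conv Z (\<rho> m) x)" for m
    using u by (simp add: weakly_def TZ)
  then have "(LINT x:\<Omega>|lebesgue. c x \<bullet> V x) = (LINT x:\<Omega>|lebesgue. u x \<bullet> Z x)"
    using LIMSEQ_unique[OF l1] l2 by simp
  then have "(LINT x|lebesgue. c x \<bullet> V x) = (LINT x|lebesgue. u x \<bullet> Z x)"
    using zero by (simp add: set_integral_compact_support[OF C(2)])
  moreover have "integrable lebesgue (\<lambda>x. c x \<bullet> V x)"
    by (rule ess_cont_compact_support(2)[OF ess_cont_bilinear[OF bounded_bilinear_inner ec(2) eV] C]) (simp add: zero)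
  moreover have "integrable lebesgue (\<lambda>x. u x \<bullet> Z x)"
    by (rule ess_cont_compact_support(2)[OF ess_cont_bilinear[OF bounded_bilinear_inner ec(1) eZ] C]) (simp add: zero)
  ultimately have "(LINT x|lebesgue. u x \<bullet> Z x - c x \<bullet> V x) = 0" by simp
  moreover have "u x \<bullet> Z x - c x \<bullet> V x
      = \<eta> x * (u x \<bullet> e x - c x \<bullet> v x) + (\<Sum>i\<in>Basis. (g x \<bullet> i) * (u x \<bullet> T i (v x)))" for x
    by (simp add: Z_def V_def p_def q_def inner_add_right inner_sum_right algebra_simps)
  ultimately show ?thesis
    by (subst set_integral_compact_support[OF C(2)]) (auto simp: \<eta>(2) g0)
qed

text \<open>For the curl this says \<open>div curl = 0\<close>: antisymmetric coefficients meet symmetric second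
  derivatives.  The symmetry is seen on mollifications, where one derivative can be put on the test
  function and the other one on the kernel.\<close>
lemma weakly_div_curl:
  fixes u :: "vec3 \<Rightarrow> 'a::euclidean_space" and c :: vector_field
  assumes w: "weakly T \<Omega> u c" and lin: "\<And>i. linear (T i)" and anti: "\<And>i j. T i j = - T j i"
    and c: "ess_cont \<Omega> c" and \<Omega>: "open \<Omega>"
  shows "weakly (\<lambda>i r. r *\<^sub>R i) \<Omega> c (\<lambda>_. 0 :: real)"
  unfolding weakly_def
proof (intro allI impI)
  fix \<phi> :: scalar_field assume "test_function \<Omega> \<phi>"
  then obtain C where sm: "smooth_on UNIV \<phi>" and C: "compact C" "C \<subseteq> \<Omega>" and \<phi>0: "\<And>x. x \<notin> C \<Longrightarrow> \<phi> x = 0"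
    by (auto simp: test_function_def)
  obtain g where g: "has_grad \<phi> g" "\<And>v. smooth_on UNIV (\<lambda>x. g x \<bullet> v)" by (rule smooth_has_grad[OF sm]) blast
  have g0: "g x = 0" if "x \<notin> C" for x
    using has_grad_zero_off_closed[OF g(1) compact_imp_closed[OF C(1)]] \<phi>0 that by blast
  obtain C' \<delta> \<rho> where "mollifying \<Omega> C C' \<delta> \<rho>" using mollifying_exists[OF \<Omega> C] by blast
  note \<rho> = mollifyingD[OF this]
  have CC': "x \<in> C'" if "x \<in> C" for x
    by (rule ccontr) (use \<rho>(6)[of x x 0] \<rho>(5)[of 0] that in auto)
  have off: "x \<notin> C" if "x \<notin> C'" for x using CC' that by blast
  have si: "set_integrable lebesgue C' f" if "locally_integrable \<Omega> f" for f :: "vec3 \<Rightarrow> 'c::euclidean_space"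
    using that \<rho>(1,2) by (auto simp: locally_integrable_def)
  have ig: "integrable lebesgue g" "ess_cont UNIV g"
    using integrable_continuous_compact_support[OF has_gradD(2)[OF g(1)] C(1) g0]
      ess_cont_continuous_compact[OF has_gradD(2)[OF g(1)] C(1) g0] by auto
  have igi: "integrable lebesgue (\<lambda>x. g x \<bullet> i)" for i using ig(1) by (rule integrable_inner_left)
  have z: "conv g (\<rho> m) x = 0" if "x \<notin> C'" for m x
    by (rule conv_zero[OF \<rho>(3) g0 \<rho>(6)[OF that]])
  have TF: "(\<Sum>i\<in>Basis. T i (frechet_derivative (conv g (\<rho> m)) (at x) i)) = 0" for m x
  proof -
    obtain k where k: "has_grad (\<rho> m) k" "\<And>v. smooth_on UNIV (\<lambda>x. k x \<bullet> v)"
      using smooth_has_grad \<rho>(3)[of m] unfolding mollifier_def by metis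
    have k0: "k x = 0" if "norm x > \<delta> m" for x
      using has_grad_zero_off_closed[OF k(1), of "cball 0 (\<delta> m)" 0] mollifier_integrable(5)[OF \<rho>(3)] that by simp
    note m5 = mollifier_integrable(4,5)[OF \<rho>(3)[of m]]
    have D: "frechet_derivative (conv g (\<rho> m)) (at x) = (\<lambda>h. conv g (\<lambda>z. k z \<bullet> h) x)"
      using frechet_derivative_at[OF conv_has_derivative[OF ig(1) k(1) m5(2)]] by simp
    define H where "H j i = conv (\<lambda>z. g z \<bullet> j) (\<lambda>z. k z \<bullet> i) x" for i j
    have i\<phi>: "integrable lebesgue \<phi>"
      by (rule integrable_continuous_compact_support[OF has_gradD(3)[OF g(1)] C(1) \<phi>0])
    have sym: "H j i = H i j" for i j
    proof -
      have "(conv \<phi> (\<rho> m) has_derivative (\<lambda>h. conv \<phi> (\<lambda>z. k z \<bullet> h) x)) (at x)" for x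
        by (rule conv_has_derivative[OF i\<phi> k(1) m5(2)])
      moreover have "(conv \<phi> (\<rho> m) has_derivative (\<lambda>h. conv (\<lambda>z. g z \<bullet> h) (\<rho> m) x)) (at x)" for x
        by (rule has_derivative_conv_scalar[OF m5 g(1) C(1) \<phi>0])
      ultimately have eq: "(\<lambda>h. conv \<phi> (\<lambda>z. k z \<bullet> h) x) = (\<lambda>h. conv (\<lambda>z. g z \<bullet> h) (\<rho> m) x)" for x
        using has_derivative_unique by blast
      have K: "conv \<phi> (\<lambda>z. k z \<bullet> i) = conv (\<lambda>z. g z \<bullet> i) (\<rho> m)"
        using fun_cong[OF eq, of i] by (intro ext) simp
      have d1: "(conv \<phi> (\<lambda>z. k z \<bullet> i) has_derivative (\<lambda>h. conv (\<lambda>z. g z \<bullet> h) (\<lambda>z. k z \<bullet> i) x)) (at x)"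
        using k0 by (intro has_derivative_conv_scalar[OF smooth_derivative(3)[OF k(2)] _ g(1) C(1) \<phi>0, of "\<delta> m"]) auto
      have d2: "(conv (\<lambda>z. g z \<bullet> i) (\<rho> m) has_derivative (\<lambda>h. conv (\<lambda>z. g z \<bullet> i) (\<lambda>z. k z \<bullet> h) x)) (at x)"
        by (rule conv_has_derivative[OF igi k(1) m5(2)])
      show ?thesis using fun_cong[OF has_derivative_unique[OF d1[unfolded K] d2], of j] by (simp add: H_def)
    qed
    obtain M where M: "\<And>x. norm (k x) \<le> M"
      by (rule bounded_compact_support[OF has_gradD(2)[OF k(1)], of "cball 0 (\<delta> m)"]) (use k0 in auto)
    have ik: "integrable lebesgue (\<lambda>y. (k (x - y) \<bullet> i) *\<^sub>R g y)" for i
    proof (rule integrable_scale_bounded[OF ig(1), of "\<lambda>z. k z \<bullet> i" "M * norm i"])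
      show "continuous_on UNIV (\<lambda>z. k z \<bullet> i)" using has_gradD(2)[OF k(1)] by (intro continuous_intros)
      show "norm (k z \<bullet> i) \<le> M * norm i" for z
        using Cauchy_Schwarz_ineq2[of "k z" i] M[of z] mult_right_mono[of "norm (k z)" M "norm i"] by simp
    qed
    have comp: "conv g (\<lambda>z. k z \<bullet> i) x = (\<Sum>j\<in>Basis. H j i *\<^sub>R j)" for i
    proof -
      have "conv g (\<lambda>z. k z \<bullet> i) x \<bullet> j = H j i" for j
        using integral_inner_left[of j lebesgue "\<lambda>y. (k (x - y) \<bullet> i) *\<^sub>R g y"] ik
        by (simp add: conv_def H_def)
      then show ?thesis using euclidean_representation[of "conv g (\<lambda>z. k z \<bullet> i) x"] by simp
    qed
    define S where "S = (\<Sum>i\<in>Basis. \<Sum>j\<in>Basis. H j i *\<^sub>R T i j)"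
    have "S = (\<Sum>j\<in>Basis. \<Sum>i\<in>Basis. H j i *\<^sub>R T i j)" unfolding S_def by (rule sum.swap)
    also have "\<dots> = (\<Sum>j\<in>Basis. \<Sum>i\<in>Basis. - (H i j *\<^sub>R T j i))"
    proof (intro sum.cong refl)
      fix i j
      show "H j i *\<^sub>R T i j = - (H i j *\<^sub>R T j i)" using anti[of i j] sym[of j i] by simp
    qed
    also have "\<dots> = - S" by (simp add: S_def sum_negf)
    finally have "S + S = 0" by (metis add.right_inverse)
    then have "2 *\<^sub>R S = 0" by (simp only: scaleR_2)
    then have "S = 0" by simp
    then show ?thesis unfolding D comp S_def by (simp add: linear_sum[OF lin] linear_cmul[OF lin])
  qed
  have l: "(\<lambda>m. LINT x:\<Omega>|lebesgue. c x \<bullet> conv g (\<rho> m) x) \<longlonglongrightarrow> (LINT x:\<Omega>|lebesgue. c x \<bullet> g x)"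
    by (rule integral_mollified_tendsto[OF \<rho>(3,4,1,2) si[OF ess_cont_locally_integrable[OF c]] ig(2,1) z g0[OF off]])
  have "test_function \<Omega> (conv g (\<rho> m))" for m
    by (rule test_function_conv[OF \<rho>(3) ig(1) \<rho>(1,2) z])
  then have "(LINT x:\<Omega>|lebesgue. c x \<bullet> conv g (\<rho> m) x) = 0" for m
    using w by (simp add: weakly_def TF)
  then have "(LINT x:\<Omega>|lebesgue. c x \<bullet> g x) = 0" using l by (simp add: LIMSEQ_const_iff)
  moreover have "frechet_derivative \<phi> (at x) = (\<lambda>h. g x \<bullet> h)" for x
    using frechet_derivative_at[OF has_gradD(1)[OF g(1)]] by simp
  ultimately show "(LINT x:\<Omega>|lebesgue. 0 \<bullet> \<phi> x) =
     (LINT x:\<Omega>|lebesgue. c x \<bullet> (\<Sum>i\<in>Basis. frechet_derivative \<phi> (at x) i *\<^sub>R i))"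
    by (simp add: euclidean_representation)
qed

section \<open>Cut-off functions\<close>

lemma max0_square_derivative: "((\<lambda>t. (max 0 t)\<^sup>2) has_real_derivative 2 * max 0 t) (at (t::real))"
proof -
  consider "t > 0" | "t < 0" | "t = 0" by linarith
  then show ?thesis
  proof cases
    case 1
    have d: "((\<lambda>t. t\<^sup>2) has_real_derivative 2 * max 0 t) (at t)"
      using 1 by (auto intro!: derivative_eq_intros)
    have e: "\<forall>\<^sub>F s in nhds t. s\<^sup>2 = (max 0 s)\<^sup>2"
      using eventually_nhds_in_open[of "{0<..}" t] 1 by (auto elim!: eventually_mono)
    show ?thesis by (rule iffD1[OF DERIV_cong_ev[OF refl e refl] d])
  next
    case 2
    have d: "((\<lambda>t. 0) has_real_derivative 2 * max 0 t) (at t)" using 2 by simp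
    have e: "\<forall>\<^sub>F s in nhds t. 0 = (max 0 s)\<^sup>2"
      using eventually_nhds_in_open[of "{..<0}" t] 2 by (auto elim!: eventually_mono)
    show ?thesis by (rule iffD1[OF DERIV_cong_ev[OF refl e refl] d])
  next
    case 3
    have "((\<lambda>h. (max 0 h)\<^sup>2 / h) \<longlongrightarrow> 0) (at (0::real))"
    proof (rule Lim_null_comparison)
      show "((\<lambda>h. \<bar>h\<bar>) \<longlongrightarrow> 0) (at (0::real))" by (auto intro!: tendsto_eq_intros)
      show "\<forall>\<^sub>F h in at (0::real). norm ((max 0 h)\<^sup>2 / h) \<le> \<bar>h\<bar>"
        by (rule always_eventually) (auto simp: max_def power2_eq_square)
    qed
    then show ?thesis using 3 by (simp add: DERIV_def)
  qed
qed

text \<open>A \<open>C\<^sup>1\<close> step that descends from \<open>1\<close> at \<open>0\<close> to \<open>0\<close> at \<open>1\<close>, composed of two copies of the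
  \<open>C\<^sup>1\<close> function \<open>(max 0 t)\<^sup>2\<close>.\<close>
definition ramp :: "real \<Rightarrow> real" where "ramp t = (max 0 (1 - (max 0 t)\<^sup>2))\<^sup>2"
definition ramp' :: "real \<Rightarrow> real" where "ramp' t = - 4 * max 0 (1 - (max 0 t)\<^sup>2) * max 0 t"

lemma ramp_derivative: "(ramp has_real_derivative ramp' t) (at t)"
proof -
  have "((\<lambda>t. 1 - (max 0 t)\<^sup>2) has_real_derivative - (2 * max 0 t)) (at t)"
    using DERIV_diff[OF DERIV_const max0_square_derivative, of 1 t] by simp
  from DERIV_chain2[OF max0_square_derivative this] show ?thesis
    by (simp add: ramp_def[abs_def] ramp'_def mult_ac)
qed

lemma ramp_cont: "continuous_on UNIV ramp'"
  unfolding ramp'_def by (intro continuous_intros)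

lemma ramp_values:
  "t \<le> 0 \<Longrightarrow> ramp t = 1" "1 \<le> t \<Longrightarrow> ramp t = 0" "1 \<le> t \<Longrightarrow> ramp' t = 0" "0 \<le> ramp t" "ramp t \<le> 1" "\<bar>ramp' t\<bar> \<le> 4"
proof -
  have *: "(max 0 t)\<^sup>2 \<ge> 1" if "1 \<le> t" for t :: real using that by (auto simp: max_def)
  show "t \<le> 0 \<Longrightarrow> ramp t = 1" by (simp add: ramp_def max_def)
  have z: "max 0 (1 - (max 0 t)\<^sup>2) = 0" if "1 \<le> t" using *[OF that] by linarith
  show "1 \<le> t \<Longrightarrow> ramp t = 0" "1 \<le> t \<Longrightarrow> ramp' t = 0" unfolding ramp_def ramp'_def by (simp_all add: z)
  show "0 \<le> ramp t" by (simp add: ramp_def)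
  have m: "0 \<le> max 0 (1 - (max 0 t)\<^sup>2)" "max 0 (1 - (max 0 t)\<^sup>2) \<le> 1" by auto
  then show "ramp t \<le> 1" unfolding ramp_def by (metis power_le_one)
  show "\<bar>ramp' t\<bar> \<le> 4"
  proof (cases "1 \<le> t")
    case True
    then show ?thesis using z[OF True] by (simp add: ramp'_def)
  next
    case False
    then have "max 0 (1 - (max 0 t)\<^sup>2) * max 0 t \<le> 1 * 1"
      using m by (intro mult_mono) auto
    moreover have "0 \<le> max 0 (1 - (max 0 t)\<^sup>2) * max 0 t" using m by auto
    ultimately show ?thesis unfolding ramp'_def abs_le_iff by linarith
  qed
qed

lemma bump_exists:
  fixes x0 :: "'a::euclidean_space"
  assumes "r > 0"
  obtains \<beta> g where "has_grad \<beta> g" "\<And>x. 0 \<le> \<beta> x" "\<And>x. \<beta> x \<le> 1" "\<And>x. dist x0 x \<le> r \<Longrightarrow> \<beta> x = 1"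
    "\<And>x. 2 * r \<le> dist x0 x \<Longrightarrow> \<beta> x = 0" "\<And>x. norm (g x) \<le> 16 / r"
proof -
  define f where "f x = (1 / r\<^sup>2) * ((x - x0) \<bullet> (x - x0)) - 1" for x
  have f: "has_grad f (\<lambda>x. (2 / r\<^sup>2) *\<^sub>R (x - x0))"
    unfolding has_grad_def
  proof (intro conjI allI)
    fix x
    have "((\<lambda>x. c * ((x - x0) \<bullet> (x - x0)) - 1) has_derivative (\<lambda>h. c * ((x - x0) \<bullet> h + h \<bullet> (x - x0)))) (at x)" for c
      by (auto intro!: derivative_eq_intros)
    then have "(f has_derivative (\<lambda>h. (1 / r\<^sup>2) * ((x - x0) \<bullet> h + h \<bullet> (x - x0)))) (at x)" unfolding f_def .
    moreover have "(\<lambda>h. (1 / r\<^sup>2) * ((x - x0) \<bullet> h + h \<bullet> (x - x0))) = (\<lambda>h. ((2 / r\<^sup>2) *\<^sub>R (x - x0)) \<bullet> h)"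
      by (simp add: fun_eq_iff inner_commute[of _ "x - x0"])
    ultimately show "(f has_derivative (\<lambda>h. ((2 / r\<^sup>2) *\<^sub>R (x - x0)) \<bullet> h)) (at x)" by simp
  qed (intro continuous_intros)
  have fn: "f x = (dist x0 x / r)\<^sup>2 - 1" for x
    by (simp add: f_def dist_norm norm_minus_commute power2_norm_eq_inner power_divide flip: power2_norm_eq_inner)
  have le: "f x \<le> 0" if "dist x0 x \<le> r" for x
    using that assms power_mono[of "dist x0 x / r" 1 2] by (simp add: fn)
  have ge: "1 \<le> f x" if "2 * r \<le> dist x0 x" for x
  proof -
    have "2 \<le> dist x0 x / r" using that assms by (simp add: field_simps)
    then have "2\<^sup>2 \<le> (dist x0 x / r)\<^sup>2" by (intro power_mono) auto
    then show ?thesis by (simp add: fn)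
  qed
  show ?thesis
  proof (rule that[OF has_grad_chain[OF f ramp_derivative ramp_cont]])
    fix x
    show "norm (ramp' (f x) *\<^sub>R (2 / r\<^sup>2) *\<^sub>R (x - x0)) \<le> 16 / r"
    proof (cases "2 * r \<le> dist x0 x")
      case True
      then show ?thesis using ge ramp_values(3) assms by simp
    next
      case False
      then have "\<bar>ramp' (f x)\<bar> * ((2 / r\<^sup>2) * norm (x - x0)) \<le> 4 * ((2 / r\<^sup>2) * (2 * r))"
        using ramp_values(6) assms by (intro mult_mono) (auto simp: dist_norm norm_minus_commute)
      also have "\<dots> = 16 / r" using assms by (simp add: power2_eq_square)
      finally show ?thesis by simp
    qed
  qed (use le ge ramp_values in auto)
qed

text \<open>Vanishing two-dimensional content.  Such sets can be cut off at no cost, see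
  \<open>cutoff_off_balls\<close>, and the edges of a mesh are of this kind.\<close>
definition thin :: "vec3 set \<Rightarrow> bool" where
  "thin S \<longleftrightarrow> (\<forall>\<gamma>>0. \<exists>P :: (vec3 \<times> real) set. finite P \<and> (\<forall>(x, r)\<in>P. 0 < r \<and> r \<le> 1) \<and>
     S \<subseteq> (\<Union>(x, r)\<in>P. ball x r) \<and> (\<Sum>(x, r)\<in>P. r\<^sup>2) \<le> \<gamma>)"

lemma thinD:
  assumes "thin S" "\<gamma> > 0"
  shows "\<exists>P :: (vec3 \<times> real) set. finite P \<and> (\<forall>(x, r)\<in>P. 0 < r \<and> r \<le> 1) \<and>
     S \<subseteq> (\<Union>(x, r)\<in>P. ball x r) \<and> (\<Sum>(x, r)\<in>P. r\<^sup>2) \<le> \<gamma>"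
  using assms unfolding thin_def by (drule_tac spec, drule_tac mp)

lemma thin_Union:
  assumes "finite I" "\<And>i. i \<in> I \<Longrightarrow> thin (S i)"
  shows "thin (\<Union>i\<in>I. S i)"
  using assms
proof (induction I rule: finite_induct)
  case empty
  show ?case unfolding thin_def by (auto intro!: exI[of _ "{}"])
next
  case (insert i I)
  show ?case unfolding thin_def
  proof (intro allI impI)
    fix \<gamma> :: real assume "\<gamma> > 0"
    then have g: "\<gamma> / 2 > 0" by simp
    have thI: "thin (\<Union>i\<in>I. S i)" using insert by simp
    obtain P where P: "finite P" "\<forall>(x, r)\<in>P. 0 < r \<and> r \<le> 1"
      "(\<Union>i\<in>I. S i) \<subseteq> (\<Union>(x, r)\<in>P. ball x r)" "(\<Sum>(x, r)\<in>P. r\<^sup>2) \<le> \<gamma> / 2"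
      using thinD[OF thI g] by (elim exE conjE) (rule that)
    obtain Q where Q: "finite Q" "\<forall>(x, r)\<in>Q. 0 < r \<and> r \<le> 1"
      "S i \<subseteq> (\<Union>(x, r)\<in>Q. ball x r)" "(\<Sum>(x, r)\<in>Q. r\<^sup>2) \<le> \<gamma> / 2"
      using thinD[OF insert.prems[OF insertI1] g] by (elim exE conjE) (rule that)
    have "(\<Sum>(x, r)\<in>P \<union> Q. r\<^sup>2) \<le> (\<Sum>(x, r)\<in>P. r\<^sup>2) + (\<Sum>(x, r)\<in>Q. r\<^sup>2)"
      using P(1) Q(1) by (subst sum.union_inter[symmetric]) (auto intro: sum_nonneg)
    then show "\<exists>P. finite P \<and> (\<forall>(x, r)\<in>P. 0 < r \<and> r \<le> 1) \<and>
     (\<Union>i\<in>insert i I. S i) \<subseteq> (\<Union>(x, r)\<in>P. ball x r) \<and> (\<Sum>(x, r)\<in>P. r\<^sup>2) \<le> \<gamma>"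
      using P Q by (intro exI[of _ "P \<union> Q"]) auto
  qed
qed

text \<open>Each ball costs a gradient of size \<open>16 / r\<close> on a ball of volume \<open>O(r\<^sup>3)\<close>, hence a
  contribution \<open>O(r\<^sup>2)\<close> to the \<open>L\<^sup>1\<close> norm; multiplying cut-offs at most adds these up.\<close>
lemma cutoff_off_balls:
  fixes P :: "(vec3 \<times> real) set"
  assumes "finite P" and "\<forall>(x, r)\<in>P. 0 < r \<and> r \<le> 1"
  shows "\<exists>\<psi> g. has_grad \<psi> g \<and> (\<forall>x. 0 \<le> \<psi> x \<and> \<psi> x \<le> 1) \<and> (\<forall>(x, r)\<in>P. \<forall>y\<in>ball x r. \<psi> y = 0) \<and>
     integrable lebesgue (\<lambda>x. norm (g x) + (1 - \<psi> x)) \<and>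
     (LINT x|lebesgue. norm (g x) + (1 - \<psi> x)) \<le> (17 * 8 * unit_ball_vol 3) * (\<Sum>(x, r)\<in>P. r\<^sup>2)"
  using assms
proof (induction P rule: finite_induct)
  case empty
  show ?case by (intro exI[of _ "\<lambda>_. 1"] exI[of _ "\<lambda>_. 0"]) (auto intro: has_grad_const)
next
  case (insert p P)
  obtain x0 r where p: "p = (x0, r)" by force
  have r: "0 < r" "r \<le> 1" using insert.prems p by auto
  have Pr: "\<forall>(x, r)\<in>P. 0 < r \<and> r \<le> 1" using insert.prems by simp
  obtain \<psi> g where \<psi>: "has_grad \<psi> g" "\<forall>x. 0 \<le> \<psi> x \<and> \<psi> x \<le> 1" "\<forall>(x, r)\<in>P. \<forall>y\<in>ball x r. \<psi> y = 0"
     "integrable lebesgue (\<lambda>x. norm (g x) + (1 - \<psi> x))"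
     "(LINT x|lebesgue. norm (g x) + (1 - \<psi> x)) \<le> (17 * 8 * unit_ball_vol 3) * (\<Sum>(x, r)\<in>P. r\<^sup>2)"
    using insert.IH[OF Pr] by (elim exE conjE) (rule that)
  have \<psi>01: "0 \<le> \<psi> x" "\<psi> x \<le> 1" for x using \<psi>(2) by auto
  obtain \<beta> k where \<beta>: "has_grad \<beta> k" "\<And>x. 0 \<le> \<beta> x" "\<And>x. \<beta> x \<le> 1" "\<And>x. dist x0 x \<le> r \<Longrightarrow> \<beta> x = 1"
    "\<And>x. 2 * r \<le> dist x0 x \<Longrightarrow> \<beta> x = 0" "\<And>x. norm (k x) \<le> 16 / r"
    by (rule bump_exists[OF r(1), of x0]) (rule that)
  have k0: "k x = 0" if "2 * r < dist x0 x" for x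
    using has_grad_zero_off_closed[OF \<beta>(1), of "cball x0 (2 * r)" 0] \<beta>(5) that by auto
  define \<psi>' where "\<psi>' x = \<psi> x * (1 + (- 1) * \<beta> x)" for x
  define g' where "g' x = \<psi> x *\<^sub>R (0 + ((- 1) *\<^sub>R k x + \<beta> x *\<^sub>R 0)) + (1 + (- 1) * \<beta> x) *\<^sub>R g x" for x
  have g': "has_grad \<psi>' g'" unfolding \<psi>'_def g'_def
    by (intro has_grad_mult has_grad_add has_grad_const \<psi>(1) \<beta>(1))
  let ?h = "\<lambda>x. (16 / r + 1) * indicat_real (cball x0 (2 * r)) x"
  have ih: "integrable lebesgue ?h"
    using lmeasurable_cball[of x0 "2 * r"] unfolding lmeasurable_iff_integrable by (rule integrable_mult_right)
  have "measure lebesgue (cball x0 (2 * r)) = unit_ball_vol 3 * (2 * r) ^ 3"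
    using content_cball[of "2 * r" x0] r by simp
  then have "(LINT x|lebesgue. ?h x) = (16 / r + 1) * (unit_ball_vol 3 * (2 * r) ^ 3)" by simp
  also have "\<dots> = (16 + r) * 8 * unit_ball_vol 3 * r\<^sup>2" using r by (simp add: field_simps power2_eq_square power3_eq_cube)
  also have "\<dots> \<le> 17 * 8 * unit_ball_vol 3 * r\<^sup>2"
    using r by (intro mult_right_mono) (auto simp: unit_ball_vol_def)
  finally have hle: "(LINT x|lebesgue. ?h x) \<le> 17 * 8 * unit_ball_vol 3 * r\<^sup>2" .
  have bound: "norm (g' x) + (1 - \<psi>' x) \<le> (norm (g x) + (1 - \<psi> x)) + ?h x" for x
  proof -
    have "norm (g' x) \<le> norm (\<psi> x *\<^sub>R k x) + norm ((1 - \<beta> x) *\<^sub>R g x)"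
      unfolding g'_def using norm_triangle_ineq4[of "(1 - \<beta> x) *\<^sub>R g x" "\<psi> x *\<^sub>R k x"] by simp
    also have "\<dots> \<le> 1 * norm (k x) + 1 * norm (g x)"
      unfolding norm_scaleR using \<psi>01[of x] \<beta>(2,3)[of x] by (intro add_mono mult_right_mono) auto
    finally have 1: "norm (g' x) \<le> norm (k x) + norm (g x)" by simp
    have "\<psi> x * \<beta> x \<le> 1 * \<beta> x" using \<psi>01(2) \<beta>(2) by (intro mult_right_mono) auto
    then have 2: "1 - \<psi>' x \<le> (1 - \<psi> x) + \<beta> x" unfolding \<psi>'_def by (simp add: algebra_simps)
    have 3: "norm (k x) + \<beta> x \<le> ?h x"
    proof (cases "x \<in> cball x0 (2 * r)")
      case True
      then show ?thesis using \<beta>(6)[of x] \<beta>(3)[of x] by simp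
    next
      case False
      then show ?thesis using k0[of x] \<beta>(5)[of x] by simp
    qed
    show ?thesis using 1 2 3 by linarith
  qed
  have pos: "0 \<le> norm (g' x) + (1 - \<psi>' x)" for x
  proof -
    have "\<psi>' x \<le> 1 * 1" unfolding \<psi>'_def using \<psi>01[of x] \<beta>(2,3)[of x] by (intro mult_mono) auto
    then show ?thesis by simp
  qed
  have int: "integrable lebesgue (\<lambda>x. norm (g' x) + (1 - \<psi>' x))"
  proof (rule Bochner_Integration.integrable_bound[OF Bochner_Integration.integrable_add[OF \<psi>(4) ih]])
    have "continuous_on UNIV (\<lambda>x. norm (g' x) + (1 - \<psi>' x))"
      using has_gradD(2,3)[OF g'] by (intro continuous_intros)
    then have "(\<lambda>x. norm (g' x) + (1 - \<psi>' x)) \<in> borel_measurable borel" by (rule borel_measurable_continuous_onI)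
    then show "(\<lambda>x. norm (g' x) + (1 - \<psi>' x)) \<in> borel_measurable lebesgue" by (simp add: measurable_completion)
    show "AE x in lebesgue. norm (norm (g' x) + (1 - \<psi>' x)) \<le> norm ((norm (g x) + (1 - \<psi> x)) + ?h x)"
      using bound pos by (intro AE_I2) (smt (verit) real_norm_def)
  qed
  have "(LINT x|lebesgue. norm (g' x) + (1 - \<psi>' x)) \<le> (LINT x|lebesgue. (norm (g x) + (1 - \<psi> x)) + ?h x)"
    by (rule integral_mono[OF int Bochner_Integration.integrable_add[OF \<psi>(4) ih] bound])
  also have "\<dots> = (LINT x|lebesgue. norm (g x) + (1 - \<psi> x)) + (LINT x|lebesgue. ?h x)"
    by (rule Bochner_Integration.integral_add[OF \<psi>(4) ih])
  also have "\<dots> \<le> (17 * 8 * unit_ball_vol 3) * (\<Sum>(x, r)\<in>insert p P. r\<^sup>2)"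
    using insert.hyps hle \<psi>(5) by (simp add: p algebra_simps)
  finally have "(LINT x|lebesgue. norm (g' x) + (1 - \<psi>' x)) \<le> (17 * 8 * unit_ball_vol 3) * (\<Sum>(x, r)\<in>insert p P. r\<^sup>2)" .
  moreover have "0 \<le> \<psi>' x \<and> \<psi>' x \<le> 1" for x
    using \<psi>01[of x] \<beta>(2,3)[of x] mult_mono[of "\<psi> x" 1 "1 - \<beta> x" 1] by (simp add: \<psi>'_def)
  moreover have "\<forall>(x, r)\<in>insert p P. \<forall>y\<in>ball x r. \<psi>' y = 0"
    using \<psi>(3) \<beta>(4) by (auto simp: \<psi>'_def p)
  ultimately show ?case using g' int by blast
qed

section \<open>Gauss's theorem from local statements\<close>

text \<open>A partition of unity, produced one ball at a time: for a bump \<open>\<beta>\<close> that is \<open>1\<close> on a ball of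
  the cover, \<open>\<eta> \<beta>\<close> is handled by the local statement and \<open>\<eta> (1 - \<beta>)\<close> is supported in the other
  balls.\<close>
lemma C1_localize:
  fixes C :: "'a::euclidean_space set"
  assumes zero: "P (\<lambda>_. 0) (\<lambda>_. 0)"
    and add: "\<And>\<eta> g \<eta>' g' C. \<lbrakk>compact C; has_grad \<eta> g; has_grad \<eta>' g'; \<And>x. x \<notin> C \<Longrightarrow> \<eta> x = 0; \<And>x. x \<notin> C \<Longrightarrow> \<eta>' x = 0;
        P \<eta> g; P \<eta>' g'\<rbrakk> \<Longrightarrow> P (\<lambda>x. \<eta> x + \<eta>' x) (\<lambda>x. g x + g' x)"
    and loc: "\<And>x. x \<in> C \<Longrightarrow> \<exists>r>0. \<forall>\<eta> g. has_grad \<eta> g \<longrightarrow> (\<forall>y. r < dist x y \<longrightarrow> \<eta> y = 0) \<longrightarrow> P \<eta> g"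
    and C: "compact C" and \<eta>: "has_grad \<eta> g" "\<And>x. x \<notin> C \<Longrightarrow> \<eta> x = 0"
  shows "P \<eta> g"
proof -
  have "\<forall>x\<in>C. \<exists>r>0. \<forall>\<eta> g. has_grad \<eta> g \<longrightarrow> (\<forall>y. 2 * r \<le> dist x y \<longrightarrow> \<eta> y = 0) \<longrightarrow> P \<eta> g"
  proof
    fix x assume "x \<in> C"
    then obtain r where r: "r > 0" "\<And>\<eta> g. has_grad \<eta> g \<Longrightarrow> (\<And>y. r < dist x y \<Longrightarrow> \<eta> y = 0) \<Longrightarrow> P \<eta> g"
      using loc by blast
    show "\<exists>r>0. \<forall>\<eta> g. has_grad \<eta> g \<longrightarrow> (\<forall>y. 2 * r \<le> dist x y \<longrightarrow> \<eta> y = 0) \<longrightarrow> P \<eta> g"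
      using r(1) by (intro exI[of _ "r / 2"]) (auto intro!: r(2))
  qed
  then obtain r where r: "\<And>x. x \<in> C \<Longrightarrow> r x > 0"
    "\<And>x \<eta> g. x \<in> C \<Longrightarrow> has_grad \<eta> g \<Longrightarrow> (\<And>y. 2 * r x \<le> dist x y \<Longrightarrow> \<eta> y = 0) \<Longrightarrow> P \<eta> g"
    by metis
  obtain X where X: "X \<subseteq> C" "finite X" "C \<subseteq> (\<Union>x\<in>X. ball x (r x))"
    using compactE_image[OF C, of C "\<lambda>x. ball x (r x)"] r(1) by force
  have "P \<eta> g" if "finite X" "X \<subseteq> C" "compact S" "S \<subseteq> (\<Union>x\<in>X. ball x (r x))" "has_grad \<eta> g" "\<And>x. x \<notin> S \<Longrightarrow> \<eta> x = 0"
    for X S \<eta> g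
    using that
  proof (induction X arbitrary: S \<eta> g rule: finite_induct)
    case empty
    then have "\<eta> = (\<lambda>_. 0)" by auto
    moreover have "g = (\<lambda>_. 0)"
      using has_grad_zero_off_closed[OF empty(4), of "{}" 0] \<open>\<eta> = (\<lambda>_. 0)\<close> by auto
    ultimately show ?case using zero by simp
  next
    case (insert x X)
    have x: "x \<in> C" using insert.prems by simp
    obtain \<beta> k where \<beta>: "has_grad \<beta> k" "\<And>y. 0 \<le> \<beta> y" "\<And>y. \<beta> y \<le> 1" "\<And>y. dist x y \<le> r x \<Longrightarrow> \<beta> y = 1"
      "\<And>y. 2 * r x \<le> dist x y \<Longrightarrow> \<beta> y = 0" "\<And>y. norm (k y) \<le> 16 / r x"
      by (rule bump_exists[OF r(1)[OF x], of x]) (rule that)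
    let ?\<eta>1 = "\<lambda>y. \<eta> y * \<beta> y" and ?\<eta>2 = "\<lambda>y. \<eta> y * (1 + (- 1) * \<beta> y)"
    let ?g1 = "\<lambda>y. \<eta> y *\<^sub>R k y + \<beta> y *\<^sub>R g y"
    let ?g2 = "\<lambda>y. \<eta> y *\<^sub>R (0 + ((- 1) *\<^sub>R k y + \<beta> y *\<^sub>R 0)) + (1 + (- 1) * \<beta> y) *\<^sub>R g y"
    have h1: "has_grad ?\<eta>1 ?g1" by (rule has_grad_mult[OF insert.prems(4) \<beta>(1)])
    have h2: "has_grad ?\<eta>2 ?g2"
      by (intro has_grad_mult[OF insert.prems(4)] has_grad_add[OF has_grad_const] has_grad_mult[OF has_grad_const \<beta>(1)])
    have "P ?\<eta>1 ?g1" by (rule r(2)[OF x h1]) (use \<beta>(5) in auto)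
    moreover have "P ?\<eta>2 ?g2"
    proof (rule insert.IH[OF _ _ _ h2])
      show "X \<subseteq> C" using insert.prems by simp
      show "compact (S - ball x (r x))" using insert.prems(2) by (intro compact_diff) auto
      show "S - ball x (r x) \<subseteq> (\<Union>x\<in>X. ball x (r x))" using insert.prems(3) by auto
      show "?\<eta>2 y = 0" if "y \<notin> S - ball x (r x)" for y
        using that insert.prems(5)[of y] \<beta>(4)[of y] by auto
    qed
    ultimately have "P (\<lambda>y. ?\<eta>1 y + ?\<eta>2 y) (\<lambda>y. ?g1 y + ?g2 y)"
      using insert.prems(5) by (intro add[OF insert.prems(2) h1 h2]) auto
    moreover have "(\<lambda>y. ?\<eta>1 y + ?\<eta>2 y) = \<eta>" by (simp add: fun_eq_iff algebra_simps)
    moreover have "(\<lambda>y. ?g1 y + ?g2 y) = g" by (simp add: fun_eq_iff algebra_simps)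
    ultimately show ?case by simp
  qed
  from this[OF X(2,1) C X(3) \<eta>] show ?thesis .
qed

lemma abs_small_imp_zero:
  fixes x :: real
  assumes "\<And>\<gamma>. \<gamma> > 0 \<Longrightarrow> \<bar>x\<bar> \<le> B * \<gamma>" "0 \<le> B"
  shows "x = 0"
proof (rule ccontr)
  assume "x \<noteq> 0"
  define \<gamma> where "\<gamma> = \<bar>x\<bar> / (2 * (B + 1))"
  have \<gamma>: "\<gamma> > 0" "2 * (B + 1) * \<gamma> = \<bar>x\<bar>" using \<open>x \<noteq> 0\<close> assms(2) by (simp_all add: \<gamma>_def)
  then have "B * \<gamma> < \<bar>x\<bar>" using mult_nonneg_nonneg[OF assms(2) less_imp_le[OF \<gamma>(1)]] by (simp add: algebra_simps)
  then show False using assms(1)[OF \<gamma>(1)] by linarith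
qed

lemma integral_norm_bound_AE:
  fixes f :: "'a \<Rightarrow> 'b::{banach,second_countable_topology}"
  assumes "integrable M f" "integrable M g" "AE x in M. norm (f x) \<le> g x"
  shows "norm (integral\<^sup>L M f) \<le> integral\<^sup>L M g"
  using order_trans[OF integral_norm_bound integral_mono_AE[OF integrable_norm[OF assms(1)] assms(2,3)]] .

abbreviation flux_balance :: "vec3 set \<Rightarrow> vector_field \<Rightarrow> scalar_field \<Rightarrow> scalar_field \<Rightarrow> vector_field \<Rightarrow> bool" where
  "flux_balance \<Omega> w d \<eta> g \<equiv> (LINT x:\<Omega>|lebesgue. \<eta> x * d x + g x \<bullet> w x) = 0"

abbreviation local_balance :: "vec3 set \<Rightarrow> vector_field \<Rightarrow> scalar_field \<Rightarrow> vec3 \<Rightarrow> bool" where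
  "local_balance \<Omega> w d z \<equiv>
     \<exists>r>0. \<forall>\<eta> g. has_grad \<eta> g \<longrightarrow> (\<forall>y. r < dist z y \<longrightarrow> \<eta> y = 0) \<longrightarrow> flux_balance \<Omega> w d \<eta> g"

text \<open>The weak form of \<open>div w = d\<close> inside \<open>\<Omega>\<close>.  The point of the two variants above is that
  their test functions may be nonzero at the boundary.\<close>
abbreviation interior_balance :: "vec3 set \<Rightarrow> vector_field \<Rightarrow> scalar_field \<Rightarrow> bool" where
  "interior_balance \<Omega> w d \<equiv> \<forall>\<eta> g C. compact C \<longrightarrow> C \<subseteq> \<Omega> \<longrightarrow> has_grad \<eta> g \<longrightarrow> (\<forall>x. x \<notin> C \<longrightarrow> \<eta> x = 0) \<longrightarrow>
     flux_balance \<Omega> w d \<eta> g"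

text \<open>A test function equal to \<open>1\<close> on \<open>\<Omega>\<close> picks out the integral of \<open>d\<close>.  It is
  admissible once it is multiplied with a cut-off that vanishes near \<open>E\<close>, and thinness of \<open>E\<close> makes
  the error arbitrarily small.\<close>
lemma gauss_from_local:
  fixes w :: vector_field and d :: scalar_field
  assumes \<Omega>: "open \<Omega>" "bounded \<Omega>" and ec: "ess_cont \<Omega> w" "ess_cont \<Omega> d"
    and interior: "interior_balance \<Omega> w d"
    and boundary: "\<And>x. x \<in> frontier \<Omega> - E \<Longrightarrow> local_balance \<Omega> w d x"
    and E: "thin E"
  shows "(LINT x:\<Omega>|lebesgue. d x) = 0"
proof -
  define \<Lambda> where "\<Lambda> \<eta> g = (LINT x:\<Omega>|lebesgue. \<eta> x * d x + g x \<bullet> w x)" for \<eta> :: scalar_field and g :: vector_field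
  have m\<Omega>: "\<Omega> \<in> lmeasurable" using \<Omega> by (simp add: lmeasurable_open)
  have ecd: "ess_cont \<Omega> (\<lambda>x. \<eta> x * d x)" and ecw: "ess_cont \<Omega> (\<lambda>x. g x \<bullet> w x)"
    if "ess_cont \<Omega> \<eta>" "ess_cont \<Omega> g" for \<eta> :: scalar_field and g :: vector_field
    using ess_cont_bilinear[OF bounded_bilinear_mult that(1) ec(2)] ess_cont_bilinear[OF bounded_bilinear_inner that(2) ec(1)] by auto
  have ecC: "ess_cont \<Omega> \<eta>" "ess_cont \<Omega> g" if "has_grad \<eta> g" "compact C" "\<And>x. x \<notin> C \<Longrightarrow> \<eta> x = 0" for \<eta> g C
    using ess_cont_continuous_compact[OF has_gradD(3)[OF that(1)] that(2,3)]
      ess_cont_continuous_compact[OF has_gradD(2)[OF that(1)] that(2)]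
      has_grad_zero_off_closed[OF that(1) compact_imp_closed[OF that(2)] that(3)] by auto
  have si: "set_integrable lebesgue \<Omega> (\<lambda>x. \<eta> x * d x + g x \<bullet> w x)" if "ess_cont \<Omega> \<eta>" "ess_cont \<Omega> g" for \<eta> g
    using ess_cont_add[OF ecd[OF that] ecw[OF that]] m\<Omega> by (rule ess_cont_set_integrable) simp
  have away: "\<Lambda> \<eta> g = 0" if C: "compact C" "C \<inter> E = {}" and \<eta>: "has_grad \<eta> g" "\<And>x. x \<notin> C \<Longrightarrow> \<eta> x = 0" for \<eta> g C
  proof (rule C1_localize[where P="\<lambda>\<eta> g. \<Lambda> \<eta> g = 0", OF _ _ _ C(1) \<eta>])
    show "\<Lambda> (\<lambda>_. 0) (\<lambda>_. 0) = 0" by (simp add: \<Lambda>_def)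
    show "\<Lambda> (\<lambda>x. \<eta> x + \<eta>' x) (\<lambda>x. g x + g' x) = 0"
      if "compact C" "has_grad \<eta> g" "has_grad \<eta>' g'" "\<And>x. x \<notin> C \<Longrightarrow> \<eta> x = 0" "\<And>x. x \<notin> C \<Longrightarrow> \<eta>' x = 0"
        "\<Lambda> \<eta> g = 0" "\<Lambda> \<eta>' g' = 0" for \<eta> g \<eta>' g' C
    proof -
      have "\<Lambda> (\<lambda>x. \<eta> x + \<eta>' x) (\<lambda>x. g x + g' x)
        = (LINT x:\<Omega>|lebesgue. (\<eta> x * d x + g x \<bullet> w x) + (\<eta>' x * d x + g' x \<bullet> w x))"
        by (simp add: \<Lambda>_def algebra_simps inner_add_left)
      also have "\<dots> = \<Lambda> \<eta> g + \<Lambda> \<eta>' g'" unfolding \<Lambda>_def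
        by (rule set_integral_add(2)[OF si[OF ecC[OF that(2,1,4)]] si[OF ecC[OF that(3,1,5)]]])
      finally show ?thesis using that by simp
    qed
    fix x assume "x \<in> C"
    then have "x \<notin> E" using C(2) by blast
    consider "x \<in> \<Omega>" | "x \<notin> closure \<Omega>" | "x \<in> frontier \<Omega> - E"
      using \<open>x \<notin> E\<close> \<Omega>(1) by (auto simp: frontier_def interior_open)
    then show "\<exists>r>0. \<forall>\<eta> g. has_grad \<eta> g \<longrightarrow> (\<forall>y. r < dist x y \<longrightarrow> \<eta> y = 0) \<longrightarrow> \<Lambda> \<eta> g = 0"
    proof cases
      case 1
      then obtain r where r: "r > 0" "cball x r \<subseteq> \<Omega>" using \<Omega>(1) open_contains_cball by blast
      have "\<Lambda> \<eta> g = 0" if "has_grad \<eta> g" "\<forall>y. r < dist x y \<longrightarrow> \<eta> y = 0" for \<eta> g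
        unfolding \<Lambda>_def by (rule interior[rule_format, OF compact_cball r(2) that(1)]) (use that(2) in auto)
      then show ?thesis using r(1) by blast
    next
      case 2
      then obtain r where r: "r > 0" "cball x r \<subseteq> - closure \<Omega>"
        using open_contains_cball[of "- closure \<Omega>"] by auto
      have "\<Lambda> \<eta> g = 0" if \<eta>: "has_grad \<eta> g" "\<forall>y. r < dist x y \<longrightarrow> \<eta> y = 0" for \<eta> g
      proof -
        have "\<eta> y = 0 \<and> g y = 0" if "y \<in> \<Omega>" for y
        proof -
          have "y \<notin> cball x r" using r(2) that closure_subset by blast
          then show ?thesis using has_grad_zero_off_closed[OF \<eta>(1), of "cball x r" 0] \<eta>(2) by auto
        qed
        then show ?thesis unfolding \<Lambda>_def set_lebesgue_integral_def
          by (intro integral_eq_zero_AE AE_I2) (auto simp: indicator_def)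
      qed
      then show ?thesis using r(1) by blast
    next
      case 3
      then show ?thesis using boundary unfolding \<Lambda>_def by blast
    qed
  qed
  obtain R where R: "R > 0" "\<Omega> \<subseteq> ball 0 R" using bounded_subset_ballD[OF \<Omega>(2), of 0] by blast
  obtain \<beta> k where \<beta>: "has_grad \<beta> k" "\<And>x. 0 \<le> \<beta> x" "\<And>x. \<beta> x \<le> 1" "\<And>x. dist (0::vec3) x \<le> R \<Longrightarrow> \<beta> x = 1"
    "\<And>x. 2 * R \<le> dist 0 x \<Longrightarrow> \<beta> x = 0" "\<And>x. norm (k x) \<le> 16 / R"
    by (rule bump_exists[OF R(1), of 0]) (rule that)
  have k0: "k x = 0" if "x \<in> \<Omega>" for x
  proof (rule has_grad_zero_off_closed[OF \<beta>(1), of "- ball 0 R" 1])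
    show "\<beta> x = 1" if "x \<notin> - ball 0 R" for x using \<beta>(4)[of x] that by simp
    show "x \<notin> - ball 0 R" using R(2) that by auto
  qed (rule closed_Compl[OF open_ball])
  obtain N b where N: "negligible N" "b \<ge> 0" "\<And>x. x \<in> \<Omega> \<Longrightarrow> x \<notin> N \<Longrightarrow> isCont w x"
    "\<And>x. x \<in> \<Omega> \<Longrightarrow> x \<notin> N \<Longrightarrow> norm (w x) \<le> b" by (rule ess_contE[OF ec(1)]) (rule that)
  obtain N' b' where N': "negligible N'" "b' \<ge> 0" "\<And>x. x \<in> \<Omega> \<Longrightarrow> x \<notin> N' \<Longrightarrow> isCont d x"
    "\<And>x. x \<in> \<Omega> \<Longrightarrow> x \<notin> N' \<Longrightarrow> norm (d x) \<le> b'" by (rule ess_contE[OF ec(2)]) (rule that)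
  define B where "B = (b + b') * (17 * 8 * unit_ball_vol 3)"
  have B: "B \<ge> 0" using N(2) N'(2) by (simp add: B_def unit_ball_vol_def)
  have est: "\<bar>LINT x:\<Omega>|lebesgue. d x\<bar> \<le> B * \<gamma>" if "\<gamma> > 0" for \<gamma>
  proof -
    obtain P where P: "finite P" "\<forall>(x, r)\<in>P. 0 < r \<and> r \<le> 1"
      "E \<subseteq> (\<Union>(x, r)\<in>P. ball x r)" "(\<Sum>(x, r)\<in>P. r\<^sup>2) \<le> \<gamma>"
      using thinD[OF E \<open>\<gamma> > 0\<close>] by (elim exE conjE) (rule that)
    obtain \<psi> g where \<psi>: "has_grad \<psi> g" "\<forall>x. 0 \<le> \<psi> x \<and> \<psi> x \<le> 1" "\<forall>(x, r)\<in>P. \<forall>y\<in>ball x r. \<psi> y = 0"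
     "integrable lebesgue (\<lambda>x. norm (g x) + (1 - \<psi> x))"
     "(LINT x|lebesgue. norm (g x) + (1 - \<psi> x)) \<le> (17 * 8 * unit_ball_vol 3) * (\<Sum>(x, r)\<in>P. r\<^sup>2)"
      using cutoff_off_balls[OF P(1,2)] by (elim exE conjE) (rule that)
    let ?U = "\<Union>(x, r)\<in>P. ball x r"
    let ?\<eta> = "\<lambda>x. \<beta> x * \<psi> x" and ?g = "\<lambda>x. \<beta> x *\<^sub>R g x + \<psi> x *\<^sub>R k x"
    have h: "has_grad ?\<eta> ?g" by (rule has_grad_mult[OF \<beta>(1) \<psi>(1)])
    have C: "compact (cball 0 (2 * R) - ?U)" by (intro compact_diff open_UN) auto
    have h0: "?\<eta> x = 0" if "x \<notin> cball 0 (2 * R) - ?U" for x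
      using that \<beta>(5)[of x] \<psi>(3) by auto
    have "\<Lambda> ?\<eta> ?g = 0" by (rule away[OF C _ h h0]) (use P(3) in auto)
    have e\<psi>: "ess_cont \<Omega> ?\<eta>" "ess_cont \<Omega> ?g" by (rule ecC(1)[OF h C h0], assumption) (rule ecC(2)[OF h C h0])
    have on: "?\<eta> x = \<psi> x" "?g x = g x" if "x \<in> \<Omega>" for x
      using \<beta>(4)[of x] k0[OF that] R(2) that by (auto simp: subset_iff)
    have "(LINT x:\<Omega>|lebesgue. d x) = (LINT x:\<Omega>|lebesgue. d x) - \<Lambda> ?\<eta> ?g" using \<open>\<Lambda> ?\<eta> ?g = 0\<close> by simp
    also have "\<dots> = (LINT x:\<Omega>|lebesgue. d x - (?\<eta> x * d x + ?g x \<bullet> w x))"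
      unfolding \<Lambda>_def using si[OF e\<psi>] ess_cont_set_integrable[OF ec(2) m\<Omega>]
      by (subst set_integral_diff(2)) auto
    also have "\<bar>\<dots>\<bar> \<le> (LINT x|lebesgue. (b + b') * (norm (g x) + (1 - \<psi> x)))"
      unfolding set_lebesgue_integral_def real_norm_def[symmetric]
    proof (rule integral_norm_bound_AE)
      show "integrable lebesgue (\<lambda>x. indicat_real \<Omega> x *\<^sub>R (d x - (?\<eta> x * d x + ?g x \<bullet> w x)))"
        using set_integral_diff(1)[OF ess_cont_set_integrable[OF ec(2) m\<Omega>] si[OF e\<psi>]] by (simp add: set_integrable_def)
      show "integrable lebesgue (\<lambda>x. (b + b') * (norm (g x) + (1 - \<psi> x)))" using \<psi>(4) by (rule integrable_mult_right)
      show "AE x in lebesgue. norm (indicat_real \<Omega> x *\<^sub>R (d x - (?\<eta> x * d x + ?g x \<bullet> w x))) \<le> (b + b') * (norm (g x) + (1 - \<psi> x))"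
        using AE_not_negligible[OF N(1)] AE_not_negligible[OF N'(1)]
      proof eventually_elim
        case (elim x)
        show ?case
        proof (cases "x \<in> \<Omega>")
          case True
          have p: "0 \<le> 1 - \<psi> x" using \<psi>(2)[rule_format, of x] by simp
          have "norm (d x - (?\<eta> x * d x + ?g x \<bullet> w x)) = \<bar>(1 - \<psi> x) * d x - g x \<bullet> w x\<bar>"
            unfolding on[OF True] by (simp add: algebra_simps)
          also have "\<dots> \<le> (1 - \<psi> x) * \<bar>d x\<bar> + \<bar>g x \<bullet> w x\<bar>"
            using abs_triangle_ineq4[of "(1 - \<psi> x) * d x" "g x \<bullet> w x"] p by (simp add: abs_mult)
          also have "\<dots> \<le> (1 - \<psi> x) * b' + norm (g x) * b"
          proof (rule add_mono)
            show "(1 - \<psi> x) * \<bar>d x\<bar> \<le> (1 - \<psi> x) * b'"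
              using p N'(4)[OF True elim(2)] by (intro mult_left_mono) auto
            show "\<bar>g x \<bullet> w x\<bar> \<le> norm (g x) * b"
              using Cauchy_Schwarz_ineq2[of "g x" "w x"] mult_left_mono[OF N(4)[OF True elim(1)], of "norm (g x)"] by simp
          qed
          also have "\<dots> \<le> (b + b') * (norm (g x) + (1 - \<psi> x))"
            using p N(2) N'(2) by (simp add: algebra_simps) (smt (verit) mult_nonneg_nonneg norm_ge_zero mult_left_le)
          finally show ?thesis using True by simp
        next
          case False
          then show ?thesis using N(2) N'(2) \<psi>(2)[rule_format, of x] by simp
        qed
      qed
    qed
    also have "\<dots> = (b + b') * (LINT x|lebesgue. norm (g x) + (1 - \<psi> x))" by simp
    also have "\<dots> \<le> (b + b') * ((17 * 8 * unit_ball_vol 3) * \<gamma>)"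
      using N(2) N'(2) P(4) by (intro mult_left_mono order_trans[OF \<psi>(5)]) (auto simp: unit_ball_vol_def)
    also have "\<dots> = B * \<gamma>" by (simp add: B_def)
    finally show ?thesis .
  qed
  show ?thesis by (rule abs_small_imp_zero[OF est B])
qed

section \<open>A smooth piece of the boundary\<close>

text \<open>Of the order of \<open>1 / \<epsilon>\<close> disjoint translates of the slab in its normal direction fit into a
  slightly larger ball.\<close>
lemma slab_measure_bound:
  fixes a p :: "'a::euclidean_space"
  assumes "a \<noteq> 0"
  shows "\<exists>K e0. 0 \<le> K \<and> 0 < e0 \<and> (\<forall>\<epsilon>. 0 < \<epsilon> \<and> \<epsilon> < e0 \<longrightarrow>
     measure lebesgue {q\<in>cball p R. b - 2 * \<epsilon> \<le> a \<bullet> q \<and> a \<bullet> q \<le> b} \<le> K * \<epsilon>)"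
proof -
  define u where "u = (1 / (a \<bullet> a)) *\<^sub>R a"
  have au: "a \<bullet> u = 1" using assms by (simp add: u_def)
  then have u0: "norm u > 0" by auto
  define V where "V = measure lebesgue (cball p (R + 1))"
  have V: "V \<ge> 0" by (simp add: V_def)
  have "measure lebesgue {q\<in>cball p R. b - 2 * \<epsilon> \<le> a \<bullet> q \<and> a \<bullet> q \<le> b} \<le> (6 * norm u * V) * \<epsilon>"
    if \<epsilon>: "0 < \<epsilon>" "\<epsilon> < 1 / (6 * norm u)" for \<epsilon>
  proof -
    define A where "A = {q\<in>cball p R. b - 2 * \<epsilon> \<le> a \<bullet> q \<and> a \<bullet> q \<le> b}"
    have "A = cball p R \<inter> {q. b - 2 * \<epsilon> \<le> a \<bullet> q} \<inter> {q. a \<bullet> q \<le> b}" by (auto simp: A_def)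
    then have "compact A"
      using closed_halfspace_le[of a b] closed_halfspace_ge[of "b - 2 * \<epsilon>" a]
      by (auto intro!: compact_Int_closed)
    then have mA: "A \<in> lmeasurable" by (rule lmeasurable_compact)
    define x where "x = 1 / (3 * \<epsilon> * norm u)"
    have x2: "x \<ge> 2" using \<epsilon> u0 by (simp add: x_def field_simps)
    define n where "n = nat \<lfloor>x\<rfloor>"
    have n: "real n \<le> x" "x / 2 \<le> real n" using x2 by (simp_all add: n_def) linarith
    define t where "t k = (3 * \<epsilon> * real k) *\<^sub>R u" for k
    have at: "a \<bullet> t k = 3 * \<epsilon> * real k" for k by (simp add: t_def au)
    have mt: "(+) (t k) ` A \<in> lmeasurable" for k by (rule measurable_translation[OF mA])
    have disj: "disjoint_family_on (\<lambda>k. (+) (t k) ` A) {..<n}"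
    proof (unfold disjoint_family_on_def, intro ballI impI equals0I)
      fix k l y assume "k \<noteq> l" and "y \<in> (+) (t k) ` A \<inter> (+) (t l) ` A"
      then obtain q q' where q: "q \<in> A" "q' \<in> A" "t k + q = t l + q'" by blast
      then have "a \<bullet> (t k + q) = a \<bullet> (t l + q')" by simp
      then have "3 * \<epsilon> * real k + a \<bullet> q = 3 * \<epsilon> * real l + a \<bullet> q'" by (simp add: inner_add_right at)
      then have "\<bar>3 * \<epsilon> * (real k - real l)\<bar> \<le> 2 * \<epsilon>" using q(1,2) by (auto simp: A_def algebra_simps abs_le_iff)
      moreover have "\<bar>3 * \<epsilon> * (real k - real l)\<bar> \<ge> 3 * \<epsilon> * 1"
        unfolding abs_mult using \<open>k \<noteq> l\<close> \<epsilon>(1) by (intro mult_mono) auto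
      ultimately show False using \<epsilon>(1) by linarith
    qed
    have "(\<Sum>k<n. measure lebesgue ((+) (t k) ` A)) = measure lebesgue (\<Union>k<n. (+) (t k) ` A)"
    proof (rule measure_finite_Union[symmetric, OF finite_lessThan _ disj])
      show "(\<lambda>k. (+) (t k) ` A) ` {..<n} \<subseteq> sets lebesgue" using fmeasurableD[OF mt] by blast
      show "emeasure lebesgue ((+) (t k) ` A) \<noteq> \<infinity>" for k using fmeasurableD2[OF mt] unfolding infinity_ennreal_def .
    qed
    also have "\<dots> \<le> V" unfolding V_def
    proof (rule measure_mono_fmeasurable)
      show "(\<Union>k<n. (+) (t k) ` A) \<subseteq> cball p (R + 1)"
      proof (intro UN_least subsetI)
        fix k y assume "k \<in> {..<n}" "y \<in> (+) (t k) ` A"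
        then obtain q where q: "q \<in> cball p R" "y = t k + q" and k: "real k \<le> real n" by (auto simp: A_def)
        have "norm (t k) = 3 * \<epsilon> * norm u * real k" using \<epsilon> by (simp add: t_def)
        also have "\<dots> \<le> 3 * \<epsilon> * norm u * x" using k n(1) \<epsilon> by (intro mult_left_mono) auto
        also have "\<dots> = 1" using \<epsilon> u0 by (simp add: x_def)
        finally have "norm (t k) \<le> 1" .
        then show "y \<in> cball p (R + 1)"
          using q norm_triangle_ineq4[of "p - q" "t k"] by (simp add: dist_norm algebra_simps)
      qed
      show "(\<Union>k<n. (+) (t k) ` A) \<in> sets lebesgue" using mt by (intro sets.finite_UN) (auto simp: fmeasurable_def)
    qed (rule lmeasurable_cball)
    finally have "real n * measure lebesgue A \<le> V" by (simp add: measure_translation)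
    moreover have "x / 2 * measure lebesgue A \<le> real n * measure lebesgue A" using n by (intro mult_right_mono) auto
    ultimately have "x / 2 * measure lebesgue A \<le> V" by linarith
    then have "measure lebesgue A \<le> V / (x / 2)" using x2 by (simp add: field_simps)
    also have "\<dots> = (6 * norm u * V) * \<epsilon>" by (simp add: x_def)
    finally show ?thesis by (simp add: A_def)
  qed
  then show ?thesis using V u0 by (intro exI[of _ "6 * norm u * V"] exI[of _ "1 / (6 * norm u)"]) auto
qed

text \<open>The product of \<open>\<eta>\<close> with \<open>ramp (s / \<epsilon> + 2)\<close> is supported inside \<open>\<Omega>\<close> and differs from
  \<open>\<eta>\<close> only in a layer of volume \<open>O(\<epsilon>)\<close>.  Its gradient is of size \<open>1 / \<epsilon>\<close> there, but it enters
  multiplied with \<open>w' \<bullet> gs\<close>, which is small near the boundary.\<close>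
lemma boundary_local:
  fixes w :: vector_field and d :: scalar_field
  assumes ec: "ess_cont \<Omega> w" "ess_cont \<Omega> d"
    and interior: "interior_balance \<Omega> w d"
    and \<Omega>: "open \<Omega>" "bounded \<Omega>" and N: "open N" "z \<in> N"
    and s: "\<And>y. y \<in> N \<Longrightarrow> (s has_derivative (\<lambda>h. gs y \<bullet> h)) (at y)" "continuous_on N gs"
    and \<Omega>N: "\<Omega> \<inter> N = {y\<in>N. s y < 0}"
    and w': "continuous_on N w'" "\<And>y. y \<in> \<Omega> \<inter> N \<Longrightarrow> w y = w' y" "\<And>y. y \<in> N \<Longrightarrow> s y = 0 \<Longrightarrow> w' y \<bullet> gs y = 0"
    and strip: "0 \<le> K" "0 < e0" "\<And>\<epsilon>. 0 < \<epsilon> \<Longrightarrow> \<epsilon> < e0 \<Longrightarrow>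
       \<exists>Z\<in>lmeasurable. {y\<in>N. - 2 * \<epsilon> \<le> s y \<and> s y \<le> 0} \<subseteq> Z \<and> measure lebesgue Z \<le> K * \<epsilon>"
  shows "local_balance \<Omega> w d z"
proof -
  obtain r where r: "r > 0" "cball z r \<subseteq> N" using N open_contains_cball by blast
  let ?C = "cball z r"
  have "(LINT x:\<Omega>|lebesgue. \<eta> x * d x + g x \<bullet> w x) = 0" if \<eta>: "has_grad \<eta> g" "\<forall>y. r < dist z y \<longrightarrow> \<eta> y = 0" for \<eta> g
  proof -
    define \<Lambda> where "\<Lambda> = (LINT x:\<Omega>|lebesgue. \<eta> x * d x + g x \<bullet> w x)"
    have \<eta>0: "\<eta> y = 0" if "y \<notin> ?C" for y using \<eta>(2) that by auto
    have g0: "g y = 0" if "y \<notin> ?C" for y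
      using has_grad_zero_off_closed[OF \<eta>(1), of ?C 0] \<eta>0 that by auto
    have m\<Omega>: "\<Omega> \<in> lmeasurable" using \<Omega> by (simp add: lmeasurable_open)
    obtain M where M: "M > 0" "\<And>x. norm (\<eta> x) \<le> M"
      by (rule bounded_compact_support[OF has_gradD(3)[OF \<eta>(1)] compact_cball[of z r]]) (use \<eta>0 in auto)
    have ecdw: "ess_cont \<Omega> (\<lambda>x. \<eta> x * d x + g x \<bullet> w x)" if "has_grad \<eta> g" "\<And>y. y \<notin> ?C \<Longrightarrow> \<eta> y = 0" for \<eta> g
    proof -
      have "ess_cont \<Omega> \<eta>" by (rule ess_cont_continuous_compact[OF has_gradD(3)[OF that(1)] compact_cball that(2)])
      moreover have "ess_cont \<Omega> g"
        by (rule ess_cont_continuous_compact[OF has_gradD(2)[OF that(1)] compact_cball[of z r]])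
           (use has_grad_zero_off_closed[OF that(1), of ?C 0] that(2) in auto)
      ultimately show ?thesis
        using ec by (intro ess_cont_add ess_cont_bilinear[OF bounded_bilinear_mult] ess_cont_bilinear[OF bounded_bilinear_inner])
    qed
    have ec\<eta>: "ess_cont \<Omega> (\<lambda>x. \<eta> x * d x + g x \<bullet> w x)" by (rule ecdw[OF \<eta>(1) \<eta>0])
    obtain Nn b where Nn: "negligible Nn" "b \<ge> 0" "\<And>x. x \<in> \<Omega> \<Longrightarrow> x \<notin> Nn \<Longrightarrow> isCont (\<lambda>x. \<eta> x * d x + g x \<bullet> w x) x"
      "\<And>x. x \<in> \<Omega> \<Longrightarrow> x \<notin> Nn \<Longrightarrow> norm (\<eta> x * d x + g x \<bullet> w x) \<le> b" by (rule ess_contE[OF ec\<eta>]) (rule that)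
    have cs: "continuous_on N s"
      using s(1) by (meson has_derivative_continuous continuous_at_imp_continuous_on)
    have est: "\<bar>\<Lambda>\<bar> \<le> (b * K + 4 * M * K) * \<gamma>" if \<gamma>: "\<gamma> > 0" for \<gamma>
    proof -
      \<comment> \<open>the points where the flux is not yet small: a compact set that avoids the zero set of \<open>s\<close>\<close>
      define Q where "Q = {y\<in>?C. s y \<le> 0 \<and> \<gamma> \<le> \<bar>w' y \<bullet> gs y\<bar>}"
      have cC: "continuous_on ?C s" "continuous_on ?C w'" "continuous_on ?C gs"
        using cs w'(1) s(2) r(2) continuous_on_subset by blast+
      have "\<exists>\<epsilon>1>0. \<forall>y\<in>?C. - 2 * \<epsilon>1 \<le> s y \<longrightarrow> s y \<le> 0 \<longrightarrow> \<bar>w' y \<bullet> gs y\<bar> \<le> \<gamma>"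
      proof (cases "Q = {}")
        case True
        then have "\<forall>y\<in>?C. s y \<le> 0 \<longrightarrow> \<bar>w' y \<bullet> gs y\<bar> \<le> \<gamma>" unfolding Q_def by (smt (verit) empty_Collect_eq)
        then show ?thesis by (intro exI[of _ 1]) auto
      next
        case False
        have cl: "closed {y\<in>?C. s y \<le> 0}" "closed {y\<in>?C. \<gamma> \<le> \<bar>w' y \<bullet> gs y\<bar>}"
          by (intro continuous_on_closed_Collect_le closed_cball continuous_intros cC)+
        have "Q = ?C \<inter> ({y\<in>?C. s y \<le> 0} \<inter> {y\<in>?C. \<gamma> \<le> \<bar>w' y \<bullet> gs y\<bar>})" by (auto simp: Q_def)
        then have "compact Q" using compact_Int_closed[OF compact_cball closed_Int[OF cl], of z r] by simp
        then obtain y0 where y0: "y0 \<in> Q" "\<And>y. y \<in> Q \<Longrightarrow> s y \<le> s y0"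
        proof -
          have "continuous_on Q s" by (rule continuous_on_subset[OF cC(1)]) (auto simp: Q_def)
          then have "\<exists>y0\<in>Q. \<forall>y\<in>Q. s y \<le> s y0" using continuous_attains_sup \<open>compact Q\<close> False by blast
          then show ?thesis using that by blast
        qed
        have "s y0 \<noteq> 0" using y0(1) w'(3)[of y0] r(2) \<gamma> by (auto simp: Q_def)
        then have neg: "s y0 < 0" using y0(1) by (auto simp: Q_def)
        have "\<bar>w' y \<bullet> gs y\<bar> \<le> \<gamma>" if "y \<in> ?C" "- 2 * (- s y0 / 4) \<le> s y" "s y \<le> 0" for y
        proof (rule ccontr)
          assume "\<not> ?thesis"
          then have "y \<in> Q" using that by (auto simp: Q_def)
          then show False using y0(2)[of y] that(2) neg by simp
        qed
        then show ?thesis using neg by (intro exI[of _ "- s y0 / 4"]) auto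
      qed
      then obtain \<epsilon>1 where \<epsilon>1: "\<epsilon>1 > 0" "\<And>y. y \<in> ?C \<Longrightarrow> - 2 * \<epsilon>1 \<le> s y \<Longrightarrow> s y \<le> 0 \<Longrightarrow> \<bar>w' y \<bullet> gs y\<bar> \<le> \<gamma>" by blast
      define \<epsilon> where "\<epsilon> = min (min \<epsilon>1 \<gamma>) (e0 / 2)"
      have \<epsilon>: "0 < \<epsilon>" "\<epsilon> \<le> \<epsilon>1" "\<epsilon> \<le> \<gamma>" "\<epsilon> < e0" using \<epsilon>1 \<gamma> strip(2) by (auto simp: \<epsilon>_def)
      obtain Z where Z: "Z \<in> lmeasurable" "{y\<in>N. - 2 * \<epsilon> \<le> s y \<and> s y \<le> 0} \<subseteq> Z" "measure lebesgue Z \<le> K * \<epsilon>"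
        using strip(3)[OF \<epsilon>(1,4)] by blast
      define f where "f y = ramp ((1 / \<epsilon>) * s y + 2)" for y
      define f' where "f' y = ramp' ((1 / \<epsilon>) * s y + 2) / \<epsilon>" for y
      have f1: "f y = 1" "f' y = 0" if "s y < - 2 * \<epsilon>" for y
      proof -
        have "(1 / \<epsilon>) * s y + 2 \<le> 0" using that \<epsilon>(1) by (simp add: field_simps)
        then show "f y = 1" "f' y = 0" using ramp_values(1) by (auto simp: f_def f'_def ramp'_def max_def)
      qed
      have f0: "f y = 0" if "- \<epsilon> < s y" for y
      proof -
        have "1 \<le> (1 / \<epsilon>) * s y + 2" using that \<epsilon>(1) by (simp add: field_simps)
        then show "f y = 0" using ramp_values(2) by (simp add: f_def)
      qed
      have f'b: "\<bar>f' y\<bar> \<le> 4 / \<epsilon>" for y using ramp_values(6)[of "(1 / \<epsilon>) * s y + 2"] \<epsilon>(1) by (simp add: f'_def divide_right_mono)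
      define h where "h y = (if y \<in> N then \<eta> y * f y else 0)" for y
      define G where "G y = (if y \<in> N then f y *\<^sub>R g y + (\<eta> y * f' y) *\<^sub>R gs y else 0)" for y
      have hG: "has_grad h G"
        unfolding has_grad_def
      proof (intro conjI allI)
        fix y
        show "(h has_derivative (\<lambda>v. G y \<bullet> v)) (at y)"
        proof (cases "y \<in> N")
          case True
          have "((\<lambda>y. c * s y + 2) has_derivative (\<lambda>v. c * (gs y \<bullet> v))) (at y)" for c
            by (auto intro!: derivative_eq_intros s(1)[OF True])
          note this[of "1 / \<epsilon>"]
          from has_derivative_compose[OF this ramp_derivative[THEN has_field_derivative_imp_has_derivative]]
          have "(f has_derivative (\<lambda>v. f' y * (gs y \<bullet> v))) (at y)"
            by (simp add: f_def[abs_def] f'_def)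
          from has_derivative_mult[OF has_gradD(1)[OF \<eta>(1)] this]
          have "((\<lambda>y. \<eta> y * f y) has_derivative (\<lambda>v. G y \<bullet> v)) (at y)"
            using True by (simp add: G_def inner_add_left mult_ac add.commute)
          then show ?thesis
            by (rule has_derivative_transform_within_open[OF _ N(1) True]) (simp add: h_def)
        next
          case False
          then have y: "y \<in> - ?C" using r(2) by blast
          have "((\<lambda>_. 0) has_derivative (\<lambda>v. G y \<bullet> v)) (at y)" using False by (simp add: G_def)
          then show ?thesis
            by (rule has_derivative_transform_within_open[OF _ _ y]) (auto simp: h_def \<eta>0)
        qed
      next
        have "continuous_on N G"
        proof (rule continuous_on_eq)
          have cl: "continuous_on N (\<lambda>y. (1 / \<epsilon>) * s y + 2)"
            by (rule continuous_on_add[OF continuous_on_mult_left[OF cs] continuous_on_const])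
          have "continuous_on UNIV ramp" unfolding ramp_def by (intro continuous_intros)
          then have cf: "continuous_on N f" unfolding f_def by (rule continuous_on_compose2[OF _ cl]) simp
          have "continuous_on N (\<lambda>y. ramp' ((1 / \<epsilon>) * s y + 2) * (1 / \<epsilon>))"
            by (rule continuous_on_mult_right[OF continuous_on_compose2[OF ramp_cont cl]]) simp
          then have "continuous_on N f'" by (simp add: f'_def)
          then show "continuous_on N (\<lambda>y. f y *\<^sub>R g y + (\<eta> y * f' y) *\<^sub>R gs y)"
            using cf has_gradD(2,3)[OF \<eta>(1)] by (intro continuous_intros s(2)) (auto intro: continuous_on_subset)
        qed (simp add: G_def)
        moreover have "continuous_on (- ?C) G"
          by (rule continuous_on_eq[of _ "\<lambda>_. 0"]) (auto simp: G_def \<eta>0 g0)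
        ultimately have "continuous_on (N \<union> - ?C) G" by (intro continuous_on_open_Un N) auto
        moreover have "N \<union> - ?C = UNIV" using r(2) by blast
        ultimately show "continuous_on UNIV G" by simp
      qed
      have h0: "h y = 0" if "y \<notin> ?C" for y using \<eta>0[OF that] by (simp add: h_def)
      have "(LINT x:\<Omega>|lebesgue. h x * d x + G x \<bullet> w x) = 0"
      proof (rule interior[rule_format, OF _ _ hG])
        have cl: "closed {y\<in>?C. s y \<le> - \<epsilon>}"
          by (intro continuous_on_closed_Collect_le closed_cball continuous_intros cC)
        have "{y\<in>?C. s y \<le> - \<epsilon>} = ?C \<inter> {y\<in>?C. s y \<le> - \<epsilon>}" by auto
        then show "compact {y\<in>?C. s y \<le> - \<epsilon>}" using compact_Int_closed[OF compact_cball cl, of z r] by simp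
        show "{y\<in>?C. s y \<le> - \<epsilon>} \<subseteq> \<Omega>" using \<Omega>N r(2) \<epsilon>(1) by force
        show "h y = 0" if "y \<notin> {y\<in>?C. s y \<le> - \<epsilon>}" for y
          using that h0[of y] f0[of y] by (auto simp: h_def)
      qed
      then have "\<Lambda> = (LINT x:\<Omega>|lebesgue. \<eta> x * d x + g x \<bullet> w x) - (LINT x:\<Omega>|lebesgue. h x * d x + G x \<bullet> w x)"
        by (simp add: \<Lambda>_def)
      also have "\<dots> = (LINT x:\<Omega>|lebesgue. (\<eta> x * d x + g x \<bullet> w x) - (h x * d x + G x \<bullet> w x))"
        using ess_cont_set_integrable[OF ecdw[OF hG h0] m\<Omega>] ess_cont_set_integrable[OF ec\<eta> m\<Omega>]
        by (subst set_integral_diff(2)) auto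
      also have "\<bar>\<dots>\<bar> \<le> (LINT x|lebesgue. (b + 4 * M * \<gamma> / \<epsilon>) * indicat_real Z x)"
        unfolding set_lebesgue_integral_def real_norm_def[symmetric]
      proof (rule integral_norm_bound_AE)
        show "integrable lebesgue (\<lambda>x. indicat_real \<Omega> x *\<^sub>R ((\<eta> x * d x + g x \<bullet> w x) - (h x * d x + G x \<bullet> w x)))"
          using set_integral_diff(1)[OF ess_cont_set_integrable[OF ec\<eta> m\<Omega>] ess_cont_set_integrable[OF ecdw[OF hG h0] m\<Omega>]]
          by (simp add: set_integrable_def)
        have "integrable lebesgue (indicat_real Z)" using Z(1) by (simp add: lmeasurable_iff_integrable)
        then show "integrable lebesgue (\<lambda>x. (b + 4 * M * \<gamma> / \<epsilon>) * indicat_real Z x)" by (rule integrable_mult_right)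
        show "AE x in lebesgue. norm (indicat_real \<Omega> x *\<^sub>R ((\<eta> x * d x + g x \<bullet> w x) - (h x * d x + G x \<bullet> w x))) \<le> (b + 4 * M * \<gamma> / \<epsilon>) * indicat_real Z x"
          using AE_not_negligible[OF Nn(1)]
        proof eventually_elim
          case (elim x)
          have pos: "0 \<le> (b + 4 * M * \<gamma> / \<epsilon>)" using Nn(2) M(1) \<gamma> \<epsilon>(1) by simp
          consider "x \<notin> \<Omega>" | "x \<in> \<Omega>" "x \<notin> ?C" | "x \<in> \<Omega>" "x \<in> ?C" "s x < - 2 * \<epsilon>" | "x \<in> \<Omega>" "x \<in> ?C" "- 2 * \<epsilon> \<le> s x"
            by linarith
          then show ?case
          proof cases
            case 1
            then show ?thesis using pos by simp
          next
            case 2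
            then show ?thesis using pos \<eta>0[of x] g0[of x] by (simp add: h_def G_def)
          next
            case 3
            then show ?thesis using pos f1[of x] r(2) by (auto simp: h_def G_def)
          next
            case 4
            then have xN: "x \<in> N" "s x < 0" using r(2) \<Omega>N by auto
            then have xZ: "x \<in> Z" using Z(2) 4 by auto
            have "(\<eta> x * d x + g x \<bullet> w x) - (h x * d x + G x \<bullet> w x)
               = (1 - f x) * (\<eta> x * d x + g x \<bullet> w x) - \<eta> x * f' x * (w' x \<bullet> gs x)"
              using xN w'(2)[of x] 4 by (simp add: h_def G_def algebra_simps inner_add_left inner_commute)
            also have "\<bar>\<dots>\<bar> \<le> \<bar>(1 - f x) * (\<eta> x * d x + g x \<bullet> w x)\<bar> + \<bar>\<eta> x * f' x * (w' x \<bullet> gs x)\<bar>"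
              by (rule abs_triangle_ineq4)
            also have "\<dots> \<le> 1 * b + M * (4 / \<epsilon>) * \<gamma>"
              unfolding abs_mult
            proof (intro add_mono mult_mono)
              show "\<bar>1 - f x\<bar> \<le> 1" using ramp_values(4,5) by (simp add: f_def abs_le_iff)
              show "\<bar>\<eta> x * d x + g x \<bullet> w x\<bar> \<le> b" using Nn(4)[of x] 4 elim by simp
              show "\<bar>\<eta> x\<bar> \<le> M" using M(2)[of x] by simp
              show "\<bar>f' x\<bar> \<le> 4 / \<epsilon>" by (rule f'b)
              show "\<bar>w' x \<bullet> gs x\<bar> \<le> \<gamma>" using \<epsilon>1(2)[of x] 4 xN \<epsilon>(2) by auto
            qed (use M \<epsilon> in auto)
            finally show ?thesis using 4 xZ by (simp add: mult_ac)
          qed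
        qed
      qed
      also have "\<dots> = (b + 4 * M * \<gamma> / \<epsilon>) * measure lebesgue Z" by simp
      also have "\<dots> \<le> (b + 4 * M * \<gamma> / \<epsilon>) * (K * \<epsilon>)"
        using Z(3) Nn(2) M(1) \<gamma> \<epsilon>(1) by (intro mult_left_mono) auto
      also have "\<dots> = b * K * \<epsilon> + 4 * M * K * \<gamma>" using \<epsilon>(1) by (simp add: field_simps)
      also have "\<dots> \<le> (b * K + 4 * M * K) * \<gamma>"
        using mult_left_mono[OF \<epsilon>(3), of "b * K"] Nn(2) strip(1) by (simp add: algebra_simps)
      finally show ?thesis .
    qed
    have "0 \<le> b * K + 4 * M * K"
      using Nn(2) strip(1) M(1) by (intro add_nonneg_nonneg mult_nonneg_nonneg) auto
    with est have "\<Lambda> = 0" by (rule abs_small_imp_zero)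
    then show ?thesis by (simp add: \<Lambda>_def)
  qed
  then show ?thesis using r(1) by blast
qed

section \<open>Cells and meshes\<close>

lemma smooth_on_open_derivative:
  fixes f :: "'a::euclidean_space \<Rightarrow> 'b::euclidean_space"
  assumes "smooth_on U f" "open U"
  shows "\<And>x. x \<in> U \<Longrightarrow> (f has_derivative frechet_derivative f (at x)) (at x)"
    and "\<And>v. continuous_on U (\<lambda>x. frechet_derivative f (at x) v)" and "continuous_on U f"
proof -
  have c: "Ck_on 0 f U" "Ck_on (Suc 0) f U" using assms(1) unfolding smooth_on_def by (simp_all del: Ck_on.simps)
  show "(f has_derivative frechet_derivative f (at x)) (at x)" if "x \<in> U" for x
    using c(2) that assms(2) by (simp add: frechet_derivative_works[symmetric] differentiable_on_eq_differentiable_at)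
  show "\<And>v. continuous_on U (\<lambda>x. frechet_derivative f (at x) v)" "continuous_on U f" using c by simp_all
qed

text \<open>Gives a name to the inverse chart whose existence is part of \<open>is_cell\<close>.\<close>
locale cell_chart =
  fixes P :: "vec3 set" and T S :: "vec3 \<Rightarrow> vec3" and U :: "vec3 set"
  assumes poly: "polytope P" and int: "interior P \<noteq> {}" and U: "open U" "P \<subseteq> U" "smooth_on U T"
    and S: "open (T ` U)" "smooth_on (T ` U) S" "\<And>x. x \<in> U \<Longrightarrow> S (T x) = x"
begin

lemma inj: "x \<in> U \<Longrightarrow> y \<in> U \<Longrightarrow> T x = T y \<Longrightarrow> x = y" using S(3) by metis
lemma TS: "y \<in> T ` U \<Longrightarrow> T (S y) = y" "y \<in> T ` U \<Longrightarrow> S y \<in> U" using S(3) by auto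
lemma compact_P: "compact P" by (rule polytope_imp_compact[OF poly])
lemma convex_P: "convex P" by (rule polytope_imp_convex[OF poly])
lemma contT: "continuous_on U T" by (rule smooth_on_open_derivative(3)[OF U(3,1)])
lemma contS: "continuous_on (T ` U) S" by (rule smooth_on_open_derivative(3)[OF S(2,1)])
lemma compact_cell: "compact (T ` P)"
  using contT U(2) compact_P continuous_on_subset compact_continuous_image by metis

lemma open_image: "open W \<Longrightarrow> W \<subseteq> U \<Longrightarrow> open (T ` W)"
proof -
  assume W: "open W" "W \<subseteq> U"
  have "T ` W = T ` U \<inter> S -` W"
  proof (intro set_eqI iffI)
    fix y assume "y \<in> T ` U \<inter> S -` W"
    then have "S y \<in> W" "T (S y) = y" using TS by auto
    then show "y \<in> T ` W" by (metis imageI)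
  qed (use W S(3) in auto)
  then show "open (T ` W)" using continuous_open_preimage[OF contS S(1) W(1)] by simp
qed

lemma interior_cell: "interior (T ` P) = T ` interior P"
proof
  have "open (T ` interior P)" using interior_subset U(2) by (intro open_image) auto
  then show "T ` interior P \<subseteq> interior (T ` P)" by (intro interior_maximal) (auto simp: image_mono interior_subset)
  show "interior (T ` P) \<subseteq> T ` interior P"
  proof
    fix y assume y: "y \<in> interior (T ` P)"
    then obtain p where p: "p \<in> P" "y = T p" using interior_subset by blast
    have "open (U \<inter> T -` interior (T ` P))" by (rule continuous_open_preimage[OF contT U(1) open_interior])
    moreover have "U \<inter> T -` interior (T ` P) \<subseteq> P"
    proof
      fix q assume "q \<in> U \<inter> T -` interior (T ` P)"
      then obtain p' where "q \<in> U" "p' \<in> P" "T q = T p'" using interior_subset by blast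
      then show "q \<in> P" using inj U(2) by blast
    qed
    ultimately have "p \<in> interior P" using p y U(2) by (intro interiorI) auto
    then show "y \<in> T ` interior P" using p by blast
  qed
qed

lemma derivT: "x \<in> U \<Longrightarrow> (T has_derivative frechet_derivative T (at x)) (at x)"
  by (rule smooth_on_open_derivative(1)[OF U(3,1)])

lemma negligible_image: "negligible A \<Longrightarrow> A \<subseteq> U \<Longrightarrow> negligible (T ` A)"
  using derivT
  by (intro negligible_differentiable_image_negligible)
     (auto simp: differentiable_on_def differentiable_def intro: has_derivative_at_withinI)

lemma negligible_cell_boundary: "negligible (T ` P - interior (T ` P))"
proof (rule negligible_subset)
  have fP: "frontier P \<subseteq> P" using compact_P compact_imp_closed frontier_subset_closed by blast
  show "negligible (T ` frontier P)"
    using fP U(2) by (intro negligible_image negligible_convex_frontier[OF convex_P]) auto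
  show "T ` P - interior (T ` P) \<subseteq> T ` frontier P"
    unfolding interior_cell using closure_subset by (auto simp: frontier_def)
qed

lemma cell_subset_closure: "T ` P \<subseteq> closure (interior (T ` P))"
proof -
  have "P \<subseteq> closure (interior P)" using convex_closure_interior[OF convex_P int] closure_subset by blast
  moreover have "T ` (closure (interior P)) \<subseteq> closure (T ` interior P)"
  proof (rule image_closure_subset)
    have "closure (interior P) \<subseteq> P"
      using compact_P compact_imp_closed closure_minimal interior_subset by metis
    then show "continuous_on (closure (interior P)) T" using contT U(2) continuous_on_subset by (metis order_trans)
  qed (auto simp: closure_subset)
  ultimately show ?thesis unfolding interior_cell by blast
qed

lemma lipschitz: "\<exists>c>0. \<forall>x\<in>P. \<forall>y\<in>P. norm (T x - T y) \<le> c * norm (x - y)"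
proof -
  let ?D = "\<lambda>x. frechet_derivative T (at x)"
  have "\<exists>B. \<forall>x\<in>P. norm (?D x i) \<le> B" for i
  proof -
    have "continuous_on P (\<lambda>x. ?D x i)"
      using smooth_on_open_derivative(2)[OF U(3,1)] U(2) continuous_on_subset by blast
    then have "bounded ((\<lambda>x. ?D x i) ` P)" using compact_P compact_continuous_image compact_imp_bounded by blast
    then show ?thesis by (auto simp: bounded_iff)
  qed
  then obtain B where B: "\<And>i x. x \<in> P \<Longrightarrow> norm (?D x i) \<le> B i" by metis
  define c where "c = (\<Sum>i\<in>Basis. B i) + 1"
  obtain p where p: "p \<in> P" using int interior_subset by blast
  have "0 \<le> B i" for i using B[OF p, of i] norm_ge_zero order_trans by blast
  then have "c > 0" unfolding c_def by (simp add: sum_nonneg add_nonneg_pos)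
  moreover have "norm (T x - T y) \<le> c * norm (x - y)" if "x \<in> P" "y \<in> P" for x y
  proof (rule differentiable_bound[OF convex_P _ _ that])
    fix x assume x: "x \<in> P"
    then show "(T has_derivative ?D x) (at x within P)" using derivT U(2) has_derivative_at_withinI by blast
    have lin: "linear (?D x)" using derivT[of x] x U(2) has_derivative_linear by blast
    show "onorm (?D x) \<le> c"
    proof (rule onorm_le)
      fix h
      have "?D x h = ?D x (\<Sum>i\<in>Basis. (h \<bullet> i) *\<^sub>R i)" by (simp add: euclidean_representation)
      also have "\<dots> = (\<Sum>i\<in>Basis. (h \<bullet> i) *\<^sub>R ?D x i)" by (simp add: linear_sum[OF lin] linear_scale[OF lin])
      also have "norm \<dots> \<le> (\<Sum>i\<in>Basis. norm h * B i)"
        by (intro sum_norm_le) (auto intro!: mult_mono B[OF x] Basis_le_norm)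
      also have "\<dots> = norm h * (\<Sum>i\<in>Basis. B i)" by (simp add: sum_distrib_left)
      also have "\<dots> \<le> c * norm h" by (simp add: c_def algebra_simps)
      finally show "norm (?D x h) \<le> c * norm h" .
    qed
  qed
  ultimately show ?thesis by blast
qed

end

text \<open>A segment falls into \<open>n\<close> pieces of length \<open>O(1 / n)\<close>; covering their images by \<open>n\<close> balls
  of radius \<open>O(1 / n)\<close> gives a sum of squared radii \<open>O(1 / n)\<close>.\<close>
lemma thin_lipschitz_collinear:
  fixes T :: "vec3 \<Rightarrow> vec3"
  assumes "collinear G" "bounded G" and c: "c > 0" "\<And>x y. x \<in> G \<Longrightarrow> y \<in> G \<Longrightarrow> norm (T x - T y) \<le> c * norm (x - y)"
  shows "thin (T ` G)"
proof (cases "G = {}")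
  case True
  then show ?thesis unfolding thin_def by (auto intro!: exI[of _ "{}"])
next
  case False
  then obtain a where a: "a \<in> G" by blast
  obtain u where u: "\<And>x y. x \<in> G \<Longrightarrow> y \<in> G \<Longrightarrow> \<exists>c. x - y = c *\<^sub>R u"
    using assms(1) unfolding collinear_def by blast
  obtain v :: vec3 and t where v: "norm v = 1" and t: "\<And>x. x \<in> G \<Longrightarrow> x = a + t x *\<^sub>R v"
  proof (cases "u = 0")
    case True
    then have "x = a" if "x \<in> G" for x using u[OF that a] by simp
    moreover obtain v :: vec3 where "norm v = 1" using vector_choose_size[of 1] by auto
    ultimately show ?thesis using that[of v "\<lambda>_. 0"] by simp
  next
    case nz: False
    obtain k where k: "\<And>x. x \<in> G \<Longrightarrow> x - a = k x *\<^sub>R u" using u[OF _ a] by metis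
    show ?thesis
    proof (rule that[of "u /\<^sub>R norm u" "\<lambda>x. k x * norm u"])
      show "norm (u /\<^sub>R norm u) = 1" using nz by simp
      show "x = a + (k x * norm u) *\<^sub>R (u /\<^sub>R norm u)" if "x \<in> G" for x
      proof -
        have "(k x * norm u) *\<^sub>R (u /\<^sub>R norm u) = x - a" using nz k[OF that] by simp
        then show ?thesis by simp
      qed
    qed
  qed
  have dist: "norm (x - y) = \<bar>t x - t y\<bar>" if "x \<in> G" "y \<in> G" for x y
  proof -
    have "x - y = (a + t x *\<^sub>R v) - (a + t y *\<^sub>R v)"
      using t[OF that(1)] t[OF that(2)] by (rule arg_cong2[where f=minus])
    also have "\<dots> = (t x - t y) *\<^sub>R v" by (simp add: scaleR_left_diff_distrib)
    finally have "x - y = (t x - t y) *\<^sub>R v" .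
    then show ?thesis using v by simp
  qed
  obtain R where R: "R > 0" "\<And>x. x \<in> G \<Longrightarrow> \<bar>t x\<bar> < R"
  proof -
    obtain B where B: "B > 0" "\<And>x. x \<in> G \<Longrightarrow> norm x \<le> B" using assms(2) by (auto simp: bounded_pos)
    have "\<bar>t x\<bar> < 2 * B + 1" if "x \<in> G" for x
    proof -
      have "norm (t x *\<^sub>R v) = norm (x - a)" using arg_cong[OF t[OF that], of "\<lambda>z. norm (z - a)"] by simp
      also have "\<dots> \<le> norm x + norm a" by (rule norm_triangle_ineq4)
      finally show ?thesis using v B(2)[OF that] B(2)[OF a] by simp
    qed
    then show ?thesis using that[of "2 * B + 1"] B(1) by simp
  qed
  define C where "C = 2 * c * R"
  have C: "C > 0" using c R by (simp add: C_def)
  show ?thesis unfolding thin_def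
  proof (intro allI impI)
    fix \<gamma> :: real assume \<gamma>: "\<gamma> > 0"
    obtain n :: nat where n: "n > max C (2 * C\<^sup>2 / \<gamma>)" "n > 0"
      using reals_Archimedean2[of "max (max C (2 * C\<^sup>2 / \<gamma>)) 1"] by (metis max_less_iff_conj of_nat_0_less_iff zero_less_one less_trans)
    define \<delta> where "\<delta> = 2 * R / n"
    have \<delta>: "\<delta> > 0" using R n(2) by (simp add: \<delta>_def)
    define r where "r = C / n"
    have rc: "r = c * \<delta>" by (simp add: r_def C_def \<delta>_def)
    have r: "r > 0" "r \<le> 1" using C n by (simp_all add: r_def field_simps)
    define k where "k x = nat \<lfloor>(t x + R) / \<delta>\<rfloor>" for x
    have pos: "0 \<le> (t x + R) / \<delta>" if "x \<in> G" for x using R(2)[OF that] \<delta> by simp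
    have kn: "k x \<le> n" if "x \<in> G" for x
    proof -
      have "(t x + R) / \<delta> \<le> 2 * R / \<delta>" using R(2)[OF that] \<delta> by (intro divide_right_mono) auto
      also have "\<dots> = n" using R n(2) by (simp add: \<delta>_def)
      finally have "\<lfloor>(t x + R) / \<delta>\<rfloor> \<le> int n" by (simp add: floor_le_iff)
      then show ?thesis by (simp add: k_def)
    qed
    have close: "norm (T x - T y) < r" if "x \<in> G" "y \<in> G" "k x = k y" for x y
    proof -
      have "\<lfloor>(t x + R) / \<delta>\<rfloor> = \<lfloor>(t y + R) / \<delta>\<rfloor>" using that pos by (simp add: k_def nat_eq_iff)
      then have "\<bar>(t x + R) / \<delta> - (t y + R) / \<delta>\<bar> < 1" by linarith
      then have "\<bar>(t x - t y) / \<delta>\<bar> < 1" by (simp add: diff_divide_distrib[symmetric])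
      then have "\<bar>t x - t y\<bar> < \<delta>" using \<delta> by (simp add: abs_divide)
      then have "c * norm (x - y) < c * \<delta>" using c(1) dist[OF that(1,2)] by simp
      then show ?thesis using c(2)[OF that(1,2)] rc by linarith
    qed
    define x where "x i = (SOME x. x \<in> G \<and> k x = i)" for i
    have x: "x (k y) \<in> G \<and> k (x (k y)) = k y" if "y \<in> G" for y
      unfolding x_def by (rule someI[of _ y]) (use that in auto)
    define P where "P = (\<lambda>i. (T (x i), r)) ` {..n}"
    have "(\<Sum>(x, r)\<in>P. r\<^sup>2) \<le> (\<Sum>i\<le>n. r\<^sup>2)"
      unfolding P_def using sum_image_le[of "{..n}" "\<lambda>(x, r). r\<^sup>2" "\<lambda>i. (T (x i), r)"] by (simp add: o_def)
    also have "\<dots> = (real n + 1) * (C / n)\<^sup>2" by (simp add: r_def)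
    also have "\<dots> \<le> (2 * real n) * (C / n)\<^sup>2" using n(2) by (intro mult_right_mono) auto
    also have "\<dots> = 2 * C\<^sup>2 / n" using n(2) by (simp add: power2_eq_square)
    also have "\<dots> \<le> \<gamma>" using n \<gamma> by (simp add: field_simps)
    finally have "(\<Sum>(x, r)\<in>P. r\<^sup>2) \<le> \<gamma>" .
    moreover have "T ` G \<subseteq> (\<Union>(x, r)\<in>P. ball x r)"
    proof
      fix z assume "z \<in> T ` G"
      then obtain y where y: "y \<in> G" "z = T y" by blast
      have "norm (T (x (k y)) - T y) < r" using x[OF y(1)] y(1) by (intro close) auto
      then have "z \<in> ball (T (x (k y))) r" using y by (simp add: dist_norm)
      moreover have "(T (x (k y)), r) \<in> P" using kn[OF y(1)] by (auto simp: P_def)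
      ultimately show "z \<in> (\<Union>(x, r)\<in>P. ball x r)" by blast
    qed
    moreover have "finite P" "\<forall>(x, r)\<in>P. 0 < r \<and> r \<le> 1" using r by (auto simp: P_def)
    ultimately show "\<exists>P. finite P \<and> (\<forall>(x, r)\<in>P. 0 < r \<and> r \<le> 1) \<and> T ` G \<subseteq> (\<Union>(x, r)\<in>P. ball x r) \<and> (\<Sum>(x, r)\<in>P. r\<^sup>2) \<le> \<gamma>"
      by blast
  qed
qed

lemma is_cell_chart:
  assumes "is_cell K"
  shows "\<exists>S U. cell_chart (fst K) (snd K) S U"
  using assms unfolding is_cell_def cell_chart_def by metis

lemma cell_set_translate: "cell_set (translate_cell l K) = (+) l ` cell_set K"
  by (auto simp: cell_set_def translate_cell_def)

lemma spatial_domain_periods: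
  assumes "spatial_domain L \<Omega>"
  shows "countable L" "0 \<in> L" "\<And>l l'. l \<in> L \<Longrightarrow> l' \<in> L \<Longrightarrow> l - l' \<in> L" "open \<Omega>"
proof -
  have "countable L \<and> 0 \<in> L \<and> (\<forall>l\<in>L. \<forall>l'\<in>L. l - l' \<in> L)"
  proof (cases "L = {0}")
    case False
    then obtain p :: "3 \<Rightarrow> vec3" where L: "L = range (\<lambda>k :: 3 \<Rightarrow> int. \<Sum>i\<in>UNIV. of_int (k i) *\<^sub>R p i)"
      using assms by (auto simp: spatial_domain_def full_lattice_def)
    let ?f = "\<lambda>k :: 3 \<Rightarrow> int. \<Sum>i\<in>UNIV. of_int (k i) *\<^sub>R p i"
    have "?f k - ?f k' \<in> L" for k k'
      unfolding L
      by (intro image_eqI[of _ _ "\<lambda>i. k i - k' i"]) (simp_all add: sum_subtractf scaleR_diff_left)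
    moreover have "?f (\<lambda>_. 0) \<in> L" unfolding L by (rule rangeI)
    moreover have "countable L" unfolding L by simp
    ultimately show ?thesis by (auto simp: L)
  qed simp
  then show "countable L" "0 \<in> L" "\<And>l l'. l \<in> L \<Longrightarrow> l' \<in> L \<Longrightarrow> l - l' \<in> L" by auto
  show "open \<Omega>" using assms by (simp add: spatial_domain_def)
qed

lemma fe_meshD:
  assumes "fe_mesh L M \<Omega>"
  shows "finite M" "\<And>K. K \<in> M \<Longrightarrow> is_cell K" "closure \<Omega> = (\<Union>l\<in>L. \<Union>K\<in>M. (+) l ` cell_set K)"
    "frontier \<Omega> = \<Union>(boundary_facets L M)"
proof -
  show "finite M" "\<And>K. K \<in> M \<Longrightarrow> is_cell K" "frontier \<Omega> = \<Union>(boundary_facets L M)"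
    using assms by (auto simp: fe_mesh_def)
  have "closure \<Omega> = (\<Union>K\<in>all_cells L M. cell_set K)" using assms by (simp add: fe_mesh_def)
  then show "closure \<Omega> = (\<Union>l\<in>L. \<Union>K\<in>M. (+) l ` cell_set K)"
    unfolding all_cells_def by (force simp: cell_set_translate[symmetric])
qed

lemma mesh_cell:
  assumes "fe_mesh L M \<Omega>" "K \<in> M"
  shows "compact (cell_set K)" "negligible (cell_set K - interior (cell_set K))"
proof -
  obtain S U where "cell_chart (fst K) (snd K) S U" using is_cell_chart[OF fe_meshD(2)[OF assms]] by blast
  then interpret cell_chart "fst K" "snd K" S U .
  show "compact (cell_set K)" "negligible (cell_set K - interior (cell_set K))"
    using compact_cell negligible_cell_boundary by (simp_all add: cell_set_def)
qed

lemma mesh_union: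
  assumes mesh: "fe_mesh L M \<Omega>"
  defines "D \<equiv> \<Union>K\<in>M. cell_set K"
  shows "compact D" "negligible (D - interior D)"
proof -
  note fin = fe_meshD(1)[OF mesh] and cell = mesh_cell[OF mesh]
  show "compact D" unfolding D_def using fin cell(1) by (intro compact_UN) auto
  have "negligible (\<Union>K\<in>M. cell_set K - interior (cell_set K))" using fin cell(2) by (intro negligible_Union) auto
  moreover have "D - interior D \<subseteq> (\<Union>K\<in>M. cell_set K - interior (cell_set K))"
  proof
    fix x assume x: "x \<in> D - interior D"
    then obtain K where K: "K \<in> M" "x \<in> cell_set K" by (auto simp: D_def)
    have "interior (cell_set K) \<subseteq> interior D" using K(1) by (intro interior_mono) (auto simp: D_def)
    then show "x \<in> (\<Union>K\<in>M. cell_set K - interior (cell_set K))" using x K by blast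
  qed
  ultimately show "negligible (D - interior D)" using negligible_subset by blast
qed

text \<open>The points on facets form a null set, being a countable union of null sets, and
  periodicity reduces the bound to the finitely many cells of one period.\<close>
lemma mesh_field_ess_cont:
  fixes f :: "vec3 \<Rightarrow> 'b::euclidean_space"
  assumes dom: "spatial_domain L \<Omega>" and mesh: "fe_mesh L M \<Omega>"
    and f: "periodic L f" "cellwise_smooth (all_cells L M) f"
  shows "ess_cont \<Omega> f"
proof -
  note L = spatial_domain_periods[OF dom] and m = fe_meshD[OF mesh]
  define N where "N = (\<Union>l\<in>L. \<Union>K\<in>M. (+) l ` (cell_set K - interior (cell_set K)))"
  have "negligible ((+) l ` (cell_set K - interior (cell_set K)))" if K: "K \<in> M" for l K
    by (rule negligible_translation[OF mesh_cell(2)[OF mesh K]])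
  then have N: "negligible N" unfolding N_def
    using L(1) m(1) by (intro negligible_countable_Union) (auto intro!: negligible_Union countable_image)
  have inK: "translate_cell 0 K \<in> all_cells L M" "cell_set (translate_cell 0 K) = cell_set K" if "K \<in> M" for K
    using that L(2) unfolding all_cells_def by (blast, simp add: cell_set_translate)
  have "\<exists>b. \<forall>x\<in>interior (cell_set K). norm (f x) \<le> b" if K: "K \<in> M" for K
  proof -
    obtain U g where g: "cell_set K \<subseteq> U" "smooth_on U g" "\<And>x. x \<in> interior (cell_set K) \<Longrightarrow> f x = g x"
      using f(2) inK[OF K] unfolding cellwise_smooth_def by metis
    have "continuous_on (cell_set K) g" using g(1,2) smooth_on_def Ck_on.simps(1) continuous_on_subset by metis
    then have "bounded (g ` cell_set K)"
      using mesh_cell(1)[OF mesh K] compact_continuous_image compact_imp_bounded by blast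
    then obtain b where "\<And>x. x \<in> cell_set K \<Longrightarrow> norm (g x) \<le> b" by (auto simp: bounded_iff)
    then show ?thesis using g(3) interior_subset by (intro exI[of _ b]) auto
  qed
  then obtain b where b: "\<And>K x. K \<in> M \<Longrightarrow> x \<in> interior (cell_set K) \<Longrightarrow> norm (f x) \<le> b K" by metis
  have loc: "\<exists>l\<in>L. \<exists>K\<in>M. x \<in> (+) l ` interior (cell_set K)" if "x \<in> \<Omega>" "x \<notin> N" for x
  proof -
    have "x \<in> closure \<Omega>" using that closure_subset by blast
    then obtain l K where "l \<in> L" "K \<in> M" "x \<in> (+) l ` cell_set K" unfolding m(3) by blast
    then show ?thesis using that(2) unfolding N_def by blast
  qed
  show ?thesis
  proof (rule ess_contI[OF N])
    fix x assume x: "x \<in> \<Omega>" "x \<notin> N"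
    obtain l K where lK: "l \<in> L" "K \<in> M" "x \<in> (+) l ` interior (cell_set K)" using loc[OF x] by blast
    let ?K = "translate_cell l K"
    have "?K \<in> all_cells L M" using lK unfolding all_cells_def by blast
    then obtain U g where g: "open U" "cell_set ?K \<subseteq> U" "smooth_on U g" "\<And>x. x \<in> interior (cell_set ?K) \<Longrightarrow> f x = g x"
      using f(2) unfolding cellwise_smooth_def by metis
    have xi: "x \<in> interior (cell_set ?K)" using lK(3) by (simp add: cell_set_translate interior_translation)
    have "continuous_on U g" using g(3) smooth_on_def Ck_on.simps(1) by metis
    then have "isCont g x" using g(1,2) xi interior_subset by (metis continuous_on_eq_continuous_at subsetD)
    moreover have "\<forall>\<^sub>F y in nhds x. f y = g y"
      using eventually_nhds_in_open[OF open_interior xi] by (rule eventually_mono) (rule g(4))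
    ultimately show "isCont f x" using isCont_cong by blast
    obtain y where y: "y \<in> interior (cell_set K)" "x = l + y" using lK(3) by blast
    then have "f x = f y" using f(1) lK(1) unfolding periodic_def by (metis add.commute)
    also have "norm (f y) \<le> b K" using b lK(2) y(1) by blast
    also have "b K \<le> (\<Sum>K\<in>M. \<bar>b K\<bar>)" using m(1) lK(2) member_le_sum[of K M "\<lambda>K. \<bar>b K\<bar>"] by force
    finally show "norm (f x) \<le> (\<Sum>K\<in>M. \<bar>b K\<bar>)" .
  qed
qed

section \<open>The boundary of a meshed domain\<close>

lemma slab_image_measure:
  fixes T :: "vec3 \<Rightarrow> vec3"
  assumes der: "\<And>x. x \<in> cball p \<rho> \<Longrightarrow> (T has_derivative T' x) (at x)"
    and cont: "\<And>v. continuous_on (cball p \<rho>) (\<lambda>x. T' x v)" and a: "a \<noteq> 0"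
  shows "\<exists>K e0. 0 \<le> K \<and> 0 < e0 \<and> (\<forall>\<epsilon>. 0 < \<epsilon> \<and> \<epsilon> < e0 \<longrightarrow>
     (\<exists>Z\<in>lmeasurable. T ` {q\<in>cball p \<rho>. b - 2 * \<epsilon> \<le> a \<bullet> q \<and> a \<bullet> q \<le> b} \<subseteq> Z \<and> measure lebesgue Z \<le> K * \<epsilon>))"
proof -
  let ?d = "\<lambda>x. \<bar>det (matrix (T' x))\<bar>"
  have cd: "continuous_on (cball p \<rho>) ?d"
    unfolding det_3 matrix_def by (simp, intro continuous_intros cont)
  have "bounded (?d ` cball p \<rho>)"
    using compact_continuous_image[OF cd compact_cball] compact_imp_bounded by blast
  then obtain B where B: "B > 0" "\<And>x. x \<in> cball p \<rho> \<Longrightarrow> ?d x \<le> B" by (auto simp: bounded_pos)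
  obtain K e0 where K: "0 \<le> K" "0 < e0" "\<And>\<epsilon>. 0 < \<epsilon> \<Longrightarrow> \<epsilon> < e0 \<Longrightarrow>
     measure lebesgue {q\<in>cball p \<rho>. b - 2 * \<epsilon> \<le> a \<bullet> q \<and> a \<bullet> q \<le> b} \<le> K * \<epsilon>"
    using slab_measure_bound[OF a, of p \<rho> b] by (elim exE conjE) (rule that, auto)
  have "\<exists>Z\<in>lmeasurable. T ` {q\<in>cball p \<rho>. b - 2 * \<epsilon> \<le> a \<bullet> q \<and> a \<bullet> q \<le> b} \<subseteq> Z \<and> measure lebesgue Z \<le> (B * K) * \<epsilon>"
    if \<epsilon>: "0 < \<epsilon>" "\<epsilon> < e0" for \<epsilon>
  proof -
    define A where "A = {q\<in>cball p \<rho>. b - 2 * \<epsilon> \<le> a \<bullet> q \<and> a \<bullet> q \<le> b}"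
    have "A = cball p \<rho> \<inter> ({q. b - 2 * \<epsilon> \<le> a \<bullet> q} \<inter> {q. a \<bullet> q \<le> b})" by (auto simp: A_def)
    moreover have "closed {q. b - 2 * \<epsilon> \<le> a \<bullet> q}" "closed {q. a \<bullet> q \<le> b}"
      using closed_halfspace_le[of a b] closed_halfspace_ge[of "b - 2 * \<epsilon>" a] by auto
    ultimately have cA: "compact A" by (metis compact_Int_closed compact_cball closed_Int)
    have AC: "A \<subseteq> cball p \<rho>" by (auto simp: A_def)
    have derA: "(T has_derivative T' x) (at x within A)" if "x \<in> A" for x
      using der that AC has_derivative_at_withinI by blast
    have "set_integrable lborel A ?d"
      using borel_integrable_compact[OF cA continuous_on_subset[OF cd AC]] by (simp add: set_integrable_def)
    then have iA: "?d integrable_on A" by (rule set_borel_integral_eq_integral(1))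
    have dB: "?d x \<le> B" if "x \<in> A" for x using B(2) AC that by blast
    have "T ` A \<in> lmeasurable"
      by (rule measurable_bounded_differentiable_image[OF lmeasurable_compact[OF cA] derA iA dB])
    moreover have "measure lebesgue (T ` A) \<le> B * measure lebesgue A"
      by (rule measure_bounded_differentiable_image[OF lmeasurable_compact[OF cA] derA iA dB])
    then have "measure lebesgue (T ` A) \<le> (B * K) * \<epsilon>"
    proof -
      have "measure lebesgue A \<le> K * \<epsilon>" using K(3)[OF \<epsilon>] unfolding A_def .
      then have "B * measure lebesgue A \<le> B * (K * \<epsilon>)" using B(1) by (intro mult_left_mono) auto
      with \<open>measure lebesgue (T ` A) \<le> B * measure lebesgue A\<close> show ?thesis by (simp add: mult.assoc)
    qed
    ultimately show ?thesis unfolding A_def by blast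
  qed
  then have "\<forall>\<epsilon>. 0 < \<epsilon> \<and> \<epsilon> < e0 \<longrightarrow> (\<exists>Z\<in>lmeasurable.
      T ` {q\<in>cball p \<rho>. b - 2 * \<epsilon> \<le> a \<bullet> q \<and> a \<bullet> q \<le> b} \<subseteq> Z \<and> measure lebesgue Z \<le> (B * K) * \<epsilon>)"
    by blast
  moreover have "0 \<le> B * K" using B(1) K(1) by simp
  ultimately show ?thesis using K(2) by blast
qed

lemma facet_unique:
  assumes "convex P" "F facet_of P" "F' face_of P" "F' \<noteq> P" "p \<in> rel_interior F" "p \<in> F'"
  shows "F' = F"
proof (rule ccontr)
  assume "F' \<noteq> F"
  have "F \<subseteq> P" using assms(2) facet_of_imp_subset by blast
  then have sub: "F \<subseteq> F'" by (intro subset_of_face_of[OF assms(3)]) (use assms in auto)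
  have "F face_of F'"
    using face_of_subset[OF facet_of_imp_face_of[OF assms(2)] sub face_of_imp_subset[OF assms(3)]] .
  then have "aff_dim F < aff_dim F'"
    using face_of_aff_dim_lt[OF face_of_imp_convex[OF assms(3)]] \<open>F' \<noteq> F\<close> by blast
  moreover have "aff_dim F' < aff_dim P" by (rule face_of_aff_dim_lt[OF assms(1,3,4)])
  ultimately show False using assms(2) by (simp add: facet_of_def)
qed

text \<open>Close to a relatively interior point of a facet, the polytope is a half-space: the open
  half-ball on the inner side is connected, meets the interior and avoids all facets, so it cannot
  leave the interior.\<close>
lemma polytope_near_facet:
  assumes poly: "polytope P" and int: "interior P \<noteq> {}" and F: "F facet_of P" and p: "p \<in> rel_interior F"
  obtains a b W where "a \<noteq> 0" "F = P \<inter> {x. a \<bullet> x = b}" "P \<subseteq> {x. a \<bullet> x \<le> b}" "open W" "p \<in> W"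
    "\<And>q F'. q \<in> W \<Longrightarrow> F' facet_of P \<Longrightarrow> q \<in> F' \<Longrightarrow> F' = F" "\<And>q. q \<in> W \<Longrightarrow> q \<in> F \<Longrightarrow> q \<in> rel_interior F"
    "\<And>\<rho> q. ball p \<rho> \<subseteq> W \<Longrightarrow> q \<in> ball p \<rho> \<Longrightarrow> a \<bullet> q < b \<Longrightarrow> q \<in> interior P"
    "\<And>\<rho> q. ball p \<rho> \<subseteq> W \<Longrightarrow> q \<in> ball p \<rho> \<Longrightarrow> a \<bullet> q = b \<Longrightarrow> q \<in> F"
proof -
  have cvx: "convex P" and cl: "closed P" using poly polytope_imp_convex polytope_imp_closed by auto
  have ph: "polyhedron P" using poly by (rule polytope_imp_polyhedron)
  have Ff: "F face_of P" using F by (rule facet_of_imp_face_of)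
  have FP: "F \<noteq> P" using F by auto
  have "F exposed_face_of P" using exposed_face_of_polyhedron[OF ph] Ff by blast
  then obtain a b where ab: "P \<subseteq> {x. a \<bullet> x \<le> b}" "F = P \<inter> {x. a \<bullet> x = b}" by (auto simp: exposed_face_of_def)
  have a: "a \<noteq> 0"
  proof
    assume "a = 0"
    then have "F = {} \<or> F = P" using ab(2) by auto
    then show False using FP F by (auto simp: facet_of_def)
  qed
  define X where "X = \<Union>{F'. F' facet_of P \<and> F' \<noteq> F}"
  have "closed X" unfolding X_def
  proof (rule closed_Union)
    show "finite {F'. F' facet_of P \<and> F' \<noteq> F}" using finite_polytope_facets[OF poly] by (rule rev_finite_subset) auto
    show "\<forall>F'\<in>{F'. F' facet_of P \<and> F' \<noteq> F}. closed F'"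
      using face_of_imp_closed[OF cvx cl] facet_of_imp_face_of by blast
  qed
  define W where "W = - X \<inter> - rel_frontier F"
  have W: "open W" using \<open>closed X\<close> by (auto simp: W_def)
  have pF: "p \<in> F" using p rel_interior_subset by blast
  have pW: "p \<in> W"
  proof -
    have "F' = F" if "F' facet_of P" "p \<in> F'" for F'
    proof -
      have "F' \<noteq> P" using that(1) facet_of_irrefl by blast
      then show ?thesis by (rule facet_unique[OF cvx F facet_of_imp_face_of[OF that(1)] _ p that(2)])
    qed
    then have "p \<notin> X" by (auto simp: X_def)
    then show ?thesis using p by (auto simp: W_def rel_frontier_def)
  qed
  have uniq: "F' = F" if "q \<in> W" "F' facet_of P" "q \<in> F'" for q F'
    using that by (auto simp: W_def X_def)
  have ri: "q \<in> rel_interior F" if "q \<in> W" "q \<in> F" for q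
    using that closure_subset by (auto simp: W_def rel_frontier_def)
  have ip: "interior P \<subseteq> {x. a \<bullet> x < b}" using interior_mono[OF ab(1)] a by simp
  have inside: "q \<in> interior P" if "ball p \<rho> \<subseteq> W" "q \<in> ball p \<rho>" "a \<bullet> q < b" for \<rho> q
  proof (rule ccontr)
    assume "q \<notin> interior P"
    define H where "H = ball p \<rho> \<inter> {x. a \<bullet> x < b}"
    have "connected H" unfolding H_def by (intro convex_connected convex_Int convex_ball convex_halfspace_lt)
    moreover have "H \<inter> interior P \<noteq> {}"
    proof -
      have "\<rho> > 0" using that(2) by (metis ball_empty empty_iff not_le)
      moreover have "p \<in> closure (interior P)"
        using pF facet_of_imp_subset[OF F] convex_closure_interior[OF cvx int] closure_subset by blast
      ultimately obtain q' where "q' \<in> interior P" "dist q' p < \<rho>" using closure_approachable by blast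
      then show ?thesis using ip by (auto simp: H_def dist_commute)
    qed
    moreover have "H - interior P \<noteq> {}" using that \<open>q \<notin> interior P\<close> by (auto simp: H_def)
    ultimately obtain y where y: "y \<in> H" "y \<in> frontier (interior P)" using connected_Int_frontier by blast
    then have "y \<in> frontier P" using frontier_interior_subset by blast
    then have "y \<in> \<Union>{F'. F' facet_of P}"
      using rel_frontier_of_polyhedron[OF ph] rel_frontier_nonempty_interior[OF int] by simp
    then obtain F' where "F' facet_of P" "y \<in> F'" by blast
    then have "y \<in> F" using uniq[of y F'] y(1) that(1) by (auto simp: H_def)
    then show False using y(1) ab(2) by (auto simp: H_def)
  qed
  have on: "q \<in> F" if W: "ball p \<rho> \<subseteq> W" "q \<in> ball p \<rho>" "a \<bullet> q = b" for \<rho> q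
  proof -
    have "q \<in> closure P"
    proof (unfold closure_approachable, intro allI impI)
      fix e :: real assume e: "e > 0"
      obtain r where r: "r > 0" "ball q r \<subseteq> ball p \<rho>" using open_contains_ball W(2) open_ball by blast
      define t where "t = min e r / (2 * norm a)"
      have t: "t > 0" "t * norm a < min e r" using e r a by (auto simp: t_def)
      have "q - t *\<^sub>R a \<in> ball q r" using t by (simp add: dist_norm)
      moreover have "a \<bullet> (q - t *\<^sub>R a) < b" using W(3) t(1) a by (simp add: inner_diff_right)
      ultimately have "q - t *\<^sub>R a \<in> P" using inside[OF W(1)] r(2) interior_subset by blast
      moreover have "dist (q - t *\<^sub>R a) q < e" using t by (simp add: dist_norm)
      ultimately show "\<exists>y\<in>P. dist y q < e" by blast
    qed
    then show ?thesis using cl ab(2) W(3) by simp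
  qed
  show ?thesis by (rule that[OF a ab(2,1) W pW uniq ri inside on])
qed

lemma aff_dim_full: "interior (P :: vec3 set) \<noteq> {} \<Longrightarrow> aff_dim P = 3"
  using low_dim_interior[of P] by auto

lemma all_cells_trivial: "all_cells {0} M = M"
proof -
  have "translate_cell 0 K = K" for K by (simp add: translate_cell_def)
  then show ?thesis by (auto simp: all_cells_def)
qed

text \<open>A second cell through the point would contain the whole facet as the image of one of
  its proper faces.  Invariance of dimension makes this face a facet, so that the boundary facet would
  be an interior one.\<close>
lemma boundary_point_in_one_cell:
  assumes mesh: "fe_mesh {0} M \<Omega>" and K: "K \<in> M" and K': "K' \<in> M" "K' \<noteq> K"
    and F: "F facet_of fst K" "snd K ` F \<in> boundary_facets {0} M" and p: "p \<in> rel_interior F"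
  shows "snd K p \<notin> cell_set K'"
proof
  assume z: "snd K p \<in> cell_set K'"
  obtain S U where "cell_chart (fst K) (snd K) S U" using is_cell_chart[OF fe_meshD(2)[OF mesh K]] by blast
  then interpret k: cell_chart "fst K" "snd K" S U .
  obtain S' U' where "cell_chart (fst K') (snd K') S' U'" using is_cell_chart[OF fe_meshD(2)[OF mesh K'(1)]] by blast
  then interpret k': cell_chart "fst K'" "snd K'" S' U' .
  have FP: "F \<subseteq> fst K" using F(1) facet_of_imp_subset by blast
  have pF: "p \<in> F" using p rel_interior_subset by blast
  have "meet_in_common_face K (translate_cell 0 K')" using mesh K K' by (auto simp: fe_mesh_def)
  then have "meet_in_common_face K K'" by (simp add: translate_cell_def)
  then obtain F' G where F': "F' face_of fst K" "F' \<noteq> fst K" and G: "G face_of fst K'" "G \<noteq> fst K'"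
    and eq: "cell_set K \<inter> cell_set K' = snd K ` F'" "snd K ` F' = snd K' ` G"
    unfolding meet_in_common_face_def by (elim exE conjE) (rule that)
  have "snd K p \<in> snd K ` F'" using z pF FP eq(1) by (auto simp: cell_set_def)
  then obtain p' where p': "p' \<in> F'" "snd K p = snd K p'" by blast
  then have "p = p'" using k.inj[of p p'] k.U(2) FP pF face_of_imp_subset[OF F'(1)] by blast
  then have FF: "F' = F" using facet_unique[OF k.convex_P F(1) F' p] p'(1) by blast
  have GP: "G \<subseteq> fst K'" using G(1) face_of_imp_subset by blast
  have TG: "snd K ` F = snd K' ` G" using eq(2) FF by simp
  have "aff_dim F \<le> aff_dim G"
  proof (rule invariance_of_dimension_convex_domain)
    show "convex F" using face_of_imp_convex facet_of_imp_face_of F(1) by blast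
    have sub: "snd K ` F \<subseteq> snd K' ` U'" using TG GP k'.U(2) by blast
    show "continuous_on F (S' \<circ> snd K)"
      by (intro continuous_on_compose continuous_on_subset[OF k.contT] continuous_on_subset[OF k'.contS] sub)
         (use FP k.U(2) in auto)
    show "S' \<circ> snd K \<in> F \<rightarrow> affine hull G"
    proof
      fix q assume "q \<in> F"
      then obtain g where "g \<in> G" "snd K q = snd K' g" using TG by blast
      then show "(S' \<circ> snd K) q \<in> affine hull G" using k'.S(3)[of g] GP k'.U(2) hull_inc[of g G affine] by auto
    qed
    show "inj_on (S' \<circ> snd K) F"
    proof (rule inj_onI)
      fix q r assume qr: "q \<in> F" "r \<in> F" "(S' \<circ> snd K) q = (S' \<circ> snd K) r"
      have m: "snd K q \<in> snd K' ` U'" "snd K r \<in> snd K' ` U'" by (rule subsetD[OF sub], rule imageI, rule qr)+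
      have "snd K q = snd K' (S' (snd K q))" by (rule k'.TS(1)[OF m(1), symmetric])
      also have "S' (snd K q) = S' (snd K r)" using qr(3) by (simp only: o_apply)
      also have "snd K' (S' (snd K r)) = snd K r" by (rule k'.TS(1)[OF m(2)])
      finally show "q = r" by (rule k.inj[rotated 2]) (use FP k.U(2) qr(1,2) in blast)+
    qed
  qed
  moreover have "aff_dim F = 2" using F(1) aff_dim_full[OF k.int] by (simp add: facet_of_def)
  moreover have "aff_dim G < aff_dim (fst K')" by (rule face_of_aff_dim_lt[OF k'.convex_P G])
  ultimately have "G facet_of fst K'"
    using G(1) pF TG aff_dim_full[OF k'.int] by (auto simp: facet_of_def)
  then have "snd K ` F \<in> cell_facets K'" using TG by (auto simp: cell_facets_def)
  moreover have "snd K ` F \<in> cell_facets K" using F(1) by (auto simp: cell_facets_def)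
  ultimately have "snd K ` F \<in> interior_facets {0} M"
    using K K' unfolding interior_facets_def all_cells_trivial by auto
  then show False using F(2) by (simp add: boundary_facets_def)
qed

text \<open>The inverse chart of the only cell nearby flattens the boundary.  In particular the
  boundary has a unit normal at these points, which is what gives content to the boundary
  conditions on traces.\<close>
lemma boundary_chart:
  assumes mesh: "fe_mesh {0} M \<Omega>" and \<Omega>: "open \<Omega>" and K: "K \<in> M"
    and F: "F facet_of fst K" "snd K ` F \<in> boundary_facets {0} M" and p: "p \<in> rel_interior F"
    and V: "open V" "cell_set K \<subseteq> V"
  obtains N s gs k e0 where "open N" "snd K p \<in> N" "N \<subseteq> V"
    "\<And>y. y \<in> N \<Longrightarrow> (s has_derivative (\<lambda>h. gs y \<bullet> h)) (at y)" "continuous_on N gs"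
    "\<Omega> \<inter> N = {y\<in>N. s y < 0}" "\<Omega> \<inter> N \<subseteq> interior (cell_set K)"
    "\<And>y. y \<in> N \<Longrightarrow> s y = 0 \<Longrightarrow> y \<in> snd K ` rel_interior F \<and> outward_unit_normal \<Omega> y (gs y /\<^sub>R norm (gs y))"
    "0 \<le> k" "0 < e0" "\<And>\<epsilon>. 0 < \<epsilon> \<Longrightarrow> \<epsilon> < e0 \<Longrightarrow>
       \<exists>Z\<in>lmeasurable. {y\<in>N. - 2 * \<epsilon> \<le> s y \<and> s y \<le> 0} \<subseteq> Z \<and> measure lebesgue Z \<le> k * \<epsilon>"
proof -
  obtain S U where "cell_chart (fst K) (snd K) S U" using is_cell_chart[OF fe_meshD(2)[OF mesh K]] by blast
  then interpret cell_chart "fst K" "snd K" S U .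
  define T where "T = snd K"
  define P where "P = fst K"
  note m = fe_meshD[OF mesh]
  have FP: "F \<subseteq> P" using F(1) facet_of_imp_subset by (simp add: P_def)
  have pF: "p \<in> F" using p rel_interior_subset by blast
  have PU: "P \<subseteq> U" using U(2) by (simp add: P_def)
  obtain a b W where a: "a \<noteq> 0" and ab: "F = P \<inter> {x. a \<bullet> x = b}" "P \<subseteq> {x. a \<bullet> x \<le> b}" and W: "open W" "p \<in> W"
    and uniq: "\<And>q F'. q \<in> W \<Longrightarrow> F' facet_of P \<Longrightarrow> q \<in> F' \<Longrightarrow> F' = F"
    and ri: "\<And>q. q \<in> W \<Longrightarrow> q \<in> F \<Longrightarrow> q \<in> rel_interior F"
    and inside: "\<And>\<rho> q. ball p \<rho> \<subseteq> W \<Longrightarrow> q \<in> ball p \<rho> \<Longrightarrow> a \<bullet> q < b \<Longrightarrow> q \<in> interior P"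
    and on: "\<And>\<rho> q. ball p \<rho> \<subseteq> W \<Longrightarrow> q \<in> ball p \<rho> \<Longrightarrow> a \<bullet> q = b \<Longrightarrow> q \<in> F"
    by (rule polytope_near_facet[OF poly int F(1) p, folded P_def]) (rule that)
  define X where "X = (\<Union>K'\<in>M - {K}. cell_set K')"
  have "closed (cell_set K')" if K': "K' \<in> M" for K'
    by (rule compact_imp_closed[OF mesh_cell(1)[OF mesh K']])
  then have "closed X" unfolding X_def using m(1) by (intro closed_UN) auto
  have pX: "T p \<notin> X" using boundary_point_in_one_cell[OF mesh K _ _ F p] by (auto simp: X_def T_def)
  define W' where "W' = W \<inter> (U \<inter> T -` (- X \<inter> V))"
  have "open (U \<inter> T -` (- X \<inter> V))"
    unfolding T_def using \<open>closed X\<close> V(1) by (intro continuous_open_preimage[OF contT U(1)]) auto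
  then have oW': "open W'" using W(1) by (auto simp: W'_def)
  have "T p \<in> V" using V(2) FP pF by (auto simp: cell_set_def T_def P_def)
  then have "p \<in> W'" using W(2) pX pF FP PU by (auto simp: W'_def)
  then obtain \<rho> where \<rho>: "\<rho> > 0" "cball p \<rho> \<subseteq> W'" using oW' open_contains_cball by blast
  have bW: "ball p \<rho> \<subseteq> W" "ball p \<rho> \<subseteq> U" "T ` ball p \<rho> \<inter> X = {}" "T ` ball p \<rho> \<subseteq> V" "cball p \<rho> \<subseteq> U"
  proof -
    have c: "q \<in> W \<and> q \<in> U \<and> T q \<notin> X \<and> T q \<in> V" if "q \<in> cball p \<rho>" for q
      using \<rho>(2) that by (auto simp: W'_def)
    have bc: "ball p \<rho> \<subseteq> cball p \<rho>" by (rule ball_subset_cball)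
    show "ball p \<rho> \<subseteq> W" "ball p \<rho> \<subseteq> U" "T ` ball p \<rho> \<inter> X = {}" "T ` ball p \<rho> \<subseteq> V" "cball p \<rho> \<subseteq> U"
      using c bc by blast+
  qed
  define N where "N = T ` ball p \<rho>"
  define s where "s y = a \<bullet> S y - b" for y
  define D where "D y = frechet_derivative S (at y)" for y
  define gs where "gs y = (\<Sum>i\<in>Basis. (a \<bullet> D y i) *\<^sub>R i)" for y
  have oN: "open N" unfolding N_def T_def by (rule open_image) (use bW in auto)
  have NTU: "N \<subseteq> T ` U" using bW by (auto simp: N_def)
  have ST: "S (T q) = q" if "q \<in> U" for q using S(3) that by (simp add: T_def)
  have dS: "(S has_derivative D y) (at y)" if "y \<in> N" for y
    unfolding D_def using smooth_on_open_derivative(1)[OF S(2,1)] NTU that by (auto simp: T_def)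
  have gsD: "gs y \<bullet> h = a \<bullet> D y h" if "y \<in> N" for y h
  proof -
    have lin: "linear (D y)" using dS[OF that] has_derivative_linear by blast
    have "a \<bullet> D y h = a \<bullet> D y (\<Sum>i\<in>Basis. (h \<bullet> i) *\<^sub>R i)" by (simp add: euclidean_representation)
    also have "\<dots> = (\<Sum>i\<in>Basis. (h \<bullet> i) * (a \<bullet> D y i))"
      by (simp add: linear_sum[OF lin] linear_scale[OF lin] inner_sum_right)
    also have "\<dots> = gs y \<bullet> h" unfolding gs_def inner_sum_left by (simp add: inner_commute mult.commute)
    finally show ?thesis by simp
  qed
  have ds: "(s has_derivative (\<lambda>h. gs y \<bullet> h)) (at y)" if "y \<in> N" for y
    unfolding s_def gsD[OF that] by (auto intro!: derivative_eq_intros dS[OF that])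
  have cgs: "continuous_on N gs"
  proof -
    have "continuous_on N (\<lambda>y. D y i)" for i
      unfolding D_def by (rule continuous_on_subset[OF smooth_on_open_derivative(2)[OF S(2,1)] NTU[unfolded T_def]])
    then show ?thesis unfolding gs_def by (intro continuous_intros)
  qed
  have inP: "q \<in> P" if q: "q \<in> ball p \<rho>" "T q \<in> closure \<Omega>" for q
  proof -
    have "closure \<Omega> = (\<Union>K\<in>M. cell_set K)" using m(3) by simp
    then obtain K' where K': "K' \<in> M" "T q \<in> cell_set K'" using q(2) by blast
    have "K' = K" using bW(3) q(1) K' unfolding X_def by blast
    then obtain q' where "q' \<in> P" "T q = T q'" using K'(2) by (auto simp: cell_set_def T_def P_def)
    moreover have "q \<in> U" "q' \<in> U" using calculation(1) bW(2) q(1) PU by blast+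
    ultimately show ?thesis using inj[of q q'] by (metis T_def)
  qed
  have fr: "T ` F \<subseteq> frontier \<Omega>" using F(2) m(4) by (auto simp: T_def)
  have dj: "\<Omega> \<inter> frontier \<Omega> = {}" using \<Omega> by (simp add: frontier_def interior_open)
  have sT: "s (T q) = a \<bullet> q - b" if "q \<in> U" for q using ST[OF that] by (simp add: s_def)
  have neg: "T q \<in> \<Omega> \<longleftrightarrow> a \<bullet> q < b" if q: "q \<in> ball p \<rho>" for q
  proof
    assume O: "T q \<in> \<Omega>"
    then have "q \<in> P" using inP[OF q] closure_subset by blast
    moreover have "q \<notin> F" using O fr dj by blast
    ultimately show "a \<bullet> q < b" using ab by force
  next
    assume lt: "a \<bullet> q < b"
    have "q \<in> P" using inside[OF bW(1) q lt] interior_subset by blast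
    then have cl: "T q \<in> closure \<Omega>" using m(3) K by (auto simp: cell_set_def T_def P_def)
    show "T q \<in> \<Omega>"
    proof (rule ccontr)
      assume "T q \<notin> \<Omega>"
      then have "T q \<in> frontier \<Omega>" using cl \<Omega> by (simp add: frontier_def interior_open)
      then obtain e where e: "e \<in> boundary_facets {0} M" "T q \<in> e" using m(4) by blast
      then obtain K2 F2 where K2: "K2 \<in> M" "F2 facet_of fst K2" "e = snd K2 ` F2"
        unfolding boundary_facets_def all_cells_trivial by (auto simp: cell_facets_def)
      then have "T q \<in> cell_set K2" using e(2) facet_of_imp_subset by (force simp: cell_set_def)
      then have "K2 = K" using bW(3) q K2(1) unfolding X_def by blast
      then obtain q' where q': "q' \<in> F2" "T q = T q'" "F2 facet_of P" using K2 e(2) by (auto simp: T_def P_def)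
      moreover have "q \<in> U" "q' \<in> U" using bW(2) q PU facet_of_imp_subset[OF q'(3)] calculation(1) by blast+
      ultimately have "q = q'" using inj[of q q'] by (metis T_def)
      then have "q \<in> F" using uniq[of q F2] q' q bW(1) by auto
      then show False using ab(1) lt by simp
    qed
  qed
  have \<Omega>N: "\<Omega> \<inter> N = {y\<in>N. s y < 0}"
    using neg sT bW(2) by (auto simp: N_def subset_iff)
  have \<Omega>i: "\<Omega> \<inter> N \<subseteq> interior (cell_set K)"
  proof -
    have "interior (cell_set K) = T ` interior P" using interior_cell by (simp add: cell_set_def T_def P_def)
    then show ?thesis using neg inside[OF bW(1)] by (auto simp: N_def)
  qed
  have zero: "y \<in> snd K ` rel_interior F \<and> outward_unit_normal \<Omega> y (gs y /\<^sub>R norm (gs y))" if y: "y \<in> N" "s y = 0" for y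
  proof -
    obtain q where q: "q \<in> ball p \<rho>" "y = T q" using y(1) by (auto simp: N_def)
    have aq: "a \<bullet> q = b" using y(2) sT[of q] q bW(2) by auto
    have qF: "q \<in> F" by (rule on[OF bW(1) q(1) aq])
    have qr: "q \<in> rel_interior F" using ri qF q(1) bW(1) by blast
    have nz: "gs y \<noteq> 0"
    proof
      assume g0: "gs y = 0"
      have qU: "q \<in> U" using q bW(2) by blast
      have "(T has_derivative frechet_derivative T (at q)) (at q)" using derivT[OF qU] by (simp add: T_def)
      from has_derivative_compose[OF this ds[OF y(1), unfolded q(2)]]
      have "((\<lambda>x. s (T x)) has_derivative (\<lambda>h. 0)) (at q)" using g0 q(2) by simp
      then have "((\<lambda>x. a \<bullet> x - b) has_derivative (\<lambda>h. 0)) (at q)"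
        by (rule has_derivative_transform_within_open[OF _ U(1) qU]) (rule sT)
      moreover have "((\<lambda>x. a \<bullet> x - b) has_derivative (\<lambda>h. a \<bullet> h)) (at q)" by (auto intro!: derivative_eq_intros)
      ultimately have "(\<lambda>h. 0) = (\<lambda>h. a \<bullet> h)" by (rule has_derivative_unique)
      then have "a \<bullet> a = 0" by metis
      then show False using a by simp
    qed
    have fd: "frechet_derivative s (at y) = (\<lambda>h. gs y \<bullet> h)" if "y \<in> N" for y
      by (rule frechet_derivative_at[OF ds[OF that], symmetric])
    have "outward_unit_normal \<Omega> y (gs y /\<^sub>R norm (gs y))"
      unfolding outward_unit_normal_def
    proof (intro conjI exI[of _ N] exI[of _ s] exI[of _ "norm (gs y)"])
      show "y \<in> frontier \<Omega>" using fr qF q(2) by blast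
      show "norm (gs y /\<^sub>R norm (gs y)) = 1" using nz by simp
      show "Ck_on 1 s N"
      proof -
        have "s differentiable_on N"
          using ds unfolding differentiable_on_def differentiable_def by (metis has_derivative_at_withinI)
        moreover have "continuous_on N (\<lambda>y. frechet_derivative s (at y) v)" for v
        proof (rule continuous_on_eq[of _ "\<lambda>y. gs y \<bullet> v"])
          show "continuous_on N (\<lambda>y. gs y \<bullet> v)" by (intro continuous_intros cgs)
        qed (simp add: fd)
        ultimately show ?thesis by simp
      qed
      show "frontier \<Omega> \<inter> N = {y\<in>N. s y = 0}"
      proof (intro set_eqI iffI)
        fix y assume y: "y \<in> frontier \<Omega> \<inter> N"
        then obtain q where q: "q \<in> ball p \<rho>" "y = T q" by (auto simp: N_def)
        have "q \<in> P" using inP[OF q(1)] y q(2) by (auto simp: frontier_def)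
        moreover have "\<not> a \<bullet> q < b" using neg[OF q(1)] y q(2) dj by blast
        ultimately have "a \<bullet> q = b" using ab(2) by force
        then show "y \<in> {y\<in>N. s y = 0}" using y sT[of q] q bW(2) by auto
      next
        fix y assume y: "y \<in> {y\<in>N. s y = 0}"
        then obtain q where q: "q \<in> ball p \<rho>" "y = T q" by (auto simp: N_def)
        then have "a \<bullet> q = b" using y sT[of q] bW(2) by auto
        then have "q \<in> F" by (rule on[OF bW(1) q(1)])
        then show "y \<in> frontier \<Omega> \<inter> N" using fr q y by blast
      qed
      show "0 < norm (gs y)" using nz by simp
      show "classical_grad s y = norm (gs y) *\<^sub>R (gs y /\<^sub>R norm (gs y))"
        using nz y(1) by (simp add: classical_grad_def pd_def fd vec_eq_iff inner_axis)
    qed (use oN y(1) \<Omega>N in auto)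
    then show ?thesis using q(2) qr by (auto simp: T_def)
  qed
  have "\<exists>k e0. 0 \<le> k \<and> 0 < e0 \<and> (\<forall>\<epsilon>. 0 < \<epsilon> \<and> \<epsilon> < e0 \<longrightarrow>
     (\<exists>Z\<in>lmeasurable. T ` {q\<in>cball p \<rho>. b - 2 * \<epsilon> \<le> a \<bullet> q \<and> a \<bullet> q \<le> b} \<subseteq> Z \<and> measure lebesgue Z \<le> k * \<epsilon>))"
  proof (rule slab_image_measure[OF _ _ a])
    show "(T has_derivative frechet_derivative T (at x)) (at x)" if "x \<in> cball p \<rho>" for x
      unfolding T_def by (rule derivT) (use that bW(5) in blast)
    show "continuous_on (cball p \<rho>) (\<lambda>x. frechet_derivative T (at x) v)" for v
      unfolding T_def by (rule continuous_on_subset[OF smooth_on_open_derivative(2)[OF U(3,1)] bW(5)])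
  qed
  then obtain k e0 where ke: "0 \<le> k" "0 < e0" "\<forall>\<epsilon>. 0 < \<epsilon> \<and> \<epsilon> < e0 \<longrightarrow>
     (\<exists>Z\<in>lmeasurable. T ` {q\<in>cball p \<rho>. b - 2 * \<epsilon> \<le> a \<bullet> q \<and> a \<bullet> q \<le> b} \<subseteq> Z \<and> measure lebesgue Z \<le> k * \<epsilon>)"
    by (elim exE conjE) (rule that)
  have strip: "\<exists>Z\<in>lmeasurable. {y\<in>N. - 2 * \<epsilon> \<le> s y \<and> s y \<le> 0} \<subseteq> Z \<and> measure lebesgue Z \<le> k * \<epsilon>"
    if \<epsilon>: "0 < \<epsilon>" "\<epsilon> < e0" for \<epsilon>
  proof -
    obtain Z where Z: "Z \<in> lmeasurable" "T ` {q\<in>cball p \<rho>. b - 2 * \<epsilon> \<le> a \<bullet> q \<and> a \<bullet> q \<le> b} \<subseteq> Z" "measure lebesgue Z \<le> k * \<epsilon>"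
      using ke(3)[rule_format, OF conjI[OF \<epsilon>]] by blast
    have "{y\<in>N. - 2 * \<epsilon> \<le> s y \<and> s y \<le> 0} \<subseteq> T ` {q\<in>cball p \<rho>. b - 2 * \<epsilon> \<le> a \<bullet> q \<and> a \<bullet> q \<le> b}"
    proof
      fix y assume y: "y \<in> {y\<in>N. - 2 * \<epsilon> \<le> s y \<and> s y \<le> 0}"
      then obtain q where q: "q \<in> ball p \<rho>" "y = T q" by (auto simp: N_def)
      then show "y \<in> T ` {q\<in>cball p \<rho>. b - 2 * \<epsilon> \<le> a \<bullet> q \<and> a \<bullet> q \<le> b}"
        using y sT[of q] bW(2) by auto
    qed
    then have "{y\<in>N. - 2 * \<epsilon> \<le> s y \<and> s y \<le> 0} \<subseteq> Z" using Z(2) by (rule order_trans)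
    then show ?thesis using Z(1,3) by blast
  qed
  show ?thesis
  proof (rule that[OF oN _ _ ds cgs \<Omega>N \<Omega>i zero ke(1,2) strip])
    show "snd K p \<in> N" using \<rho>(1) by (simp add: N_def T_def)
    show "N \<subseteq> V" using bW(4) by (simp add: N_def)
  qed
qed

text \<open>\<open>w'\<close> represents the one-sided values of \<open>w\<close> from the cell \<open>K\<close>.\<close>
abbreviation zero_flux_on :: "vec3 set \<Rightarrow> cell set \<Rightarrow> vec3 set \<Rightarrow> vector_field \<Rightarrow> cell \<Rightarrow> bool" where
  "zero_flux_on L M \<Omega> w K \<equiv> \<exists>V w'. open V \<and> cell_set K \<subseteq> V \<and> continuous_on V w' \<and>
     (\<forall>x\<in>interior (cell_set K). w x = w' x) \<and>
     (\<forall>F. F facet_of fst K \<and> snd K ` F \<in> boundary_facets L M \<longrightarrow>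
       (\<forall>x\<in>snd K ` rel_interior F. \<forall>n. outward_unit_normal \<Omega> x n \<longrightarrow> w' x \<bullet> n = 0))"

lemma gauss_meshed_domain:
  fixes w :: vector_field and d :: scalar_field
  assumes mesh: "fe_mesh {0} M \<Omega>" and \<Omega>: "open \<Omega>" "bounded \<Omega>" and ec: "ess_cont \<Omega> w" "ess_cont \<Omega> d"
    and interior: "interior_balance \<Omega> w d"
    and trace: "\<And>K. K \<in> M \<Longrightarrow> zero_flux_on {0} M \<Omega> w K"
  shows "(LINT x:\<Omega>|lebesgue. d x) = 0"
proof -
  note m = fe_meshD[OF mesh]
  \<comment> \<open>the mesh edges\<close>
  define E where "E = (\<Union>K\<in>M. \<Union>F\<in>{F. F facet_of fst K}. \<Union>G\<in>{G. G facet_of F}. snd K ` G)"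
  have "thin E"
    unfolding E_def
  proof (intro thin_Union m(1))
    fix K F assume K: "K \<in> M" and F: "F \<in> {F. F facet_of fst K}"
    obtain S U where "cell_chart (fst K) (snd K) S U" using is_cell_chart[OF m(2)[OF K]] by blast
    then interpret cell_chart "fst K" "snd K" S U .
    have "polytope F" using F face_of_polytope_polytope[OF poly] facet_of_imp_face_of by blast
    then show "finite {G. G facet_of F}" by (rule finite_polytope_facets)
    fix G assume G: "G \<in> {G. G facet_of F}"
    then have GP: "G \<subseteq> fst K" using F facet_of_imp_subset by blast
    obtain c where c: "c > 0" "\<forall>x\<in>fst K. \<forall>y\<in>fst K. norm (snd K x - snd K y) \<le> c * norm (x - y)" using lipschitz by blast
    have "aff_dim G \<le> 1" using F G aff_dim_full[OF int] by (auto simp: facet_of_def)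
    then have "collinear G" by (simp add: collinear_aff_dim)
    then show "thin (snd K ` G)"
    proof (rule thin_lipschitz_collinear)
      show "bounded G" using GP compact_P compact_imp_bounded bounded_subset by blast
    qed (use c GP in auto)
  next
    fix K assume K: "K \<in> M"
    obtain S U where "cell_chart (fst K) (snd K) S U" using is_cell_chart[OF m(2)[OF K]] by blast
    then interpret cell_chart "fst K" "snd K" S U .
    show "finite {F. F facet_of fst K}" by (rule finite_polytope_facets[OF poly])
  qed
  show ?thesis
  proof (rule gauss_from_local[OF \<Omega> ec interior _ \<open>thin E\<close>])
    fix z assume z: "z \<in> frontier \<Omega> - E"
    then obtain e where e: "e \<in> boundary_facets {0} M" "z \<in> e" using m(4) by blast
    then obtain K F where K: "K \<in> M" "F facet_of fst K" "e = snd K ` F"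
      unfolding boundary_facets_def all_cells_trivial by (auto simp: cell_facets_def)
    obtain p where p: "p \<in> F" "z = snd K p" using e K by blast
    obtain S U where "cell_chart (fst K) (snd K) S U" using is_cell_chart[OF m(2)[OF K(1)]] by blast
    then interpret cell_chart "fst K" "snd K" S U .
    have pF: "polytope F" using K(2) face_of_polytope_polytope[OF poly] facet_of_imp_face_of by blast
    have "p \<notin> rel_frontier F"
    proof
      assume "p \<in> rel_frontier F"
      then obtain G where "G facet_of F" "p \<in> G"
        using rel_frontier_of_polyhedron[OF polytope_imp_polyhedron[OF pF]] by blast
      then have "z \<in> E" using K(1,2) p(2) unfolding E_def by blast
      then show False using z by simp
    qed
    then have pr: "p \<in> rel_interior F" using p(1) closure_subset by (auto simp: rel_frontier_def)
    obtain V w' where V: "open V" "cell_set K \<subseteq> V" and w': "continuous_on V w'"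
       "\<forall>x\<in>interior (cell_set K). w x = w' x"
       "\<forall>F. F facet_of fst K \<and> snd K ` F \<in> boundary_facets {0} M \<longrightarrow>
         (\<forall>x\<in>snd K ` rel_interior F. \<forall>n. outward_unit_normal \<Omega> x n \<longrightarrow> w' x \<bullet> n = 0)"
      using trace[OF K(1)] by (elim exE conjE) (rule that)
    have eF: "snd K ` F \<in> boundary_facets {0} M" using e K by simp
    obtain N s gs k e0 where N: "open N" "snd K p \<in> N" "N \<subseteq> V"
      and s: "\<And>y. y \<in> N \<Longrightarrow> (s has_derivative (\<lambda>h. gs y \<bullet> h)) (at y)" "continuous_on N gs"
      and \<Omega>N: "\<Omega> \<inter> N = {y\<in>N. s y < 0}" "\<Omega> \<inter> N \<subseteq> interior (cell_set K)"
      and n: "\<And>y. y \<in> N \<Longrightarrow> s y = 0 \<Longrightarrow> y \<in> snd K ` rel_interior F \<and> outward_unit_normal \<Omega> y (gs y /\<^sub>R norm (gs y))"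
      and st: "0 \<le> k" "0 < e0" "\<And>\<epsilon>. 0 < \<epsilon> \<Longrightarrow> \<epsilon> < e0 \<Longrightarrow>
       \<exists>Z\<in>lmeasurable. {y\<in>N. - 2 * \<epsilon> \<le> s y \<and> s y \<le> 0} \<subseteq> Z \<and> measure lebesgue Z \<le> k * \<epsilon>"
      by (rule boundary_chart[OF mesh \<Omega>(1) K(1,2) eF pr V]) (rule that)
    have tr: "w' y \<bullet> gs y = 0" if "y \<in> N" "s y = 0" for y
    proof -
      have "w' y \<bullet> (gs y /\<^sub>R norm (gs y)) = 0" using w'(3) K(2) eF n[OF that] by blast
      then show ?thesis by auto
    qed
    show "local_balance \<Omega> w d z"
    proof (rule boundary_local[OF ec interior \<Omega> N(1) _ s \<Omega>N(1) continuous_on_subset[OF w'(1) N(3)] _ tr st])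
      show "z \<in> N" using N(2) p(2) by simp
      show "w y = w' y" if "y \<in> \<Omega> \<inter> N" for y using that \<Omega>N(2) w'(2) by blast
    qed
  qed
qed

section \<open>Periodic domains\<close>

lemma translate_integral:
  fixes f :: "vec3 \<Rightarrow> 'b::euclidean_space"
  assumes "integrable lebesgue f"
  shows "integrable lebesgue (\<lambda>y. f (y + l))" "(LINT y|lebesgue. f (y + l)) = integral\<^sup>L lebesgue f"
  using lebesgue_reflect_translate[of 1 f l] assms by auto

lemma common_face_negligible:
  assumes K: "is_cell K" and meet: "meet_in_common_face K K'"
  shows "negligible (cell_set K \<inter> cell_set K')"
proof -
  obtain S U where "cell_chart (fst K) (snd K) S U" using is_cell_chart[OF K] by blast
  then interpret cell_chart "fst K" "snd K" S U .
  obtain F where F: "F face_of fst K" "F \<noteq> fst K" "cell_set K \<inter> cell_set K' = snd K ` F"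
    using meet unfolding meet_in_common_face_def by blast
  have "F \<subseteq> frontier (fst K)"
    using face_of_subset_rel_frontier[OF F(1,2)] rel_frontier_nonempty_interior[OF int] by simp
  then have "negligible F" using negligible_convex_frontier[OF convex_P] negligible_subset by blast
  then have "negligible (snd K ` F)" using face_of_imp_subset[OF F(1)] U(2) by (intro negligible_image) auto
  then show ?thesis by (simp add: F(3))
qed

locale tiling =
  fixes L D :: "vec3 set"
  assumes L: "countable L" "0 \<in> L" "\<And>l l'. l \<in> L \<Longrightarrow> l' \<in> L \<Longrightarrow> l - l' \<in> L"
    and D: "compact D" "(\<Union>l\<in>L. (+) l ` D) = UNIV" "negligible (D - interior D)"
      "\<And>l. l \<in> L \<Longrightarrow> l \<noteq> 0 \<Longrightarrow> negligible (D \<inter> (+) l ` D)"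
begin

lemma L_minus: "l \<in> L \<Longrightarrow> - l \<in> L" using L(3)[OF L(2), of l] by simp

lemma tile_iff: "y \<in> (+) l ` A \<longleftrightarrow> y - l \<in> A" for y l :: vec3
  by (auto simp: image_iff intro!: bexI[of _ "y - l"])

lemma tiles_overlap:
  assumes "l \<in> L" "l' \<in> L" "l \<noteq> l'"
  shows "negligible ((+) l ` D \<inter> (+) l' ` D)"
proof -
  have "(+) l ` D \<inter> (+) l' ` D = (+) l ` (D \<inter> (+) (l' - l) ` D)"
    by (intro set_eqI) (simp only: Int_iff tile_iff, simp)
  then show ?thesis using D(4)[of "l' - l"] L(3)[OF assms(2,1)] assms(3) negligible_translation by auto
qed

lemma lmeasurable_D: "D \<in> lmeasurable" by (rule lmeasurable_compact[OF D(1)])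

lemma measure_D_pos: "measure lebesgue D > 0"
proof (rule ccontr)
  assume "\<not> ?thesis"
  then have "measure lebesgue D = 0" by (metis less_eq_real_def measure_nonneg)
  then have "negligible D" using negligible_iff_measure lmeasurable_D by blast
  then have "negligible (\<Union>l\<in>L. (+) l ` D)"
    using L(1) by (intro negligible_countable_Union) (auto intro: negligible_translation)
  then have "negligible (UNIV :: vec3 set)" by (simp add: D(2))
  then show False using open_not_negligible[of "UNIV :: vec3 set"] by simp
qed

text \<open>Tiles have equal positive volume and negligible overlaps, so a bounded region has
  room for finitely many of them.\<close>
lemma finite_tiles:
  assumes "bounded Z"
  shows "finite {l\<in>L. Z \<inter> (+) l ` D \<noteq> {}}"
proof (rule ccontr)
  define J where "J = {l\<in>L. Z \<inter> (+) l ` D \<noteq> {}}"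
  assume "infinite {l\<in>L. Z \<inter> (+) l ` D \<noteq> {}}"
  then have inf: "infinite J" by (simp add: J_def)
  obtain R where R: "\<And>x. x \<in> Z \<Longrightarrow> norm x \<le> R" using assms by (auto simp: bounded_iff)
  obtain B where B: "\<And>x. x \<in> D \<Longrightarrow> norm x \<le> B" using compact_imp_bounded[OF D(1)] by (auto simp: bounded_iff)
  have sub: "(+) l ` D \<subseteq> cball 0 (R + 2 * B)" if "l \<in> J" for l
  proof
    fix y assume "y \<in> (+) l ` D"
    then obtain e where e: "e \<in> D" "y = l + e" by blast
    obtain d where d: "d \<in> D" "l + d \<in> Z" using \<open>l \<in> J\<close> by (auto simp: J_def)
    have "norm l \<le> norm (l + d) + norm d" using norm_triangle_ineq4[of "l + d" d] by simp
    then have "norm y \<le> R + 2 * B" using norm_triangle_ineq[of l e] R[OF d(2)] B[OF d(1)] B[OF e(1)] e(2) by simp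
    then show "y \<in> cball 0 (R + 2 * B)" by simp
  qed
  define V where "V = measure lebesgue (cball (0::vec3) (R + 2 * B))"
  obtain n :: nat where n: "real n * measure lebesgue D > V"
    using reals_Archimedean3[OF measure_D_pos] by blast
  obtain J' where J': "J' \<subseteq> J" "finite J'" "card J' = n"
    using infinite_arbitrarily_large[OF inf, of n] by blast
  have m: "(+) l ` D \<in> lmeasurable" for l by (rule measurable_translation[OF lmeasurable_D])
  have "real n * measure lebesgue D = (\<Sum>l\<in>J'. measure lebesgue ((+) l ` D))"
    using J'(3) by (simp add: measure_translation)
  also have "\<dots> = measure lebesgue (\<Union>l\<in>J'. (+) l ` D)"
  proof (rule measure_negligible_finite_Union_image[symmetric, OF J'(2) m])
    show "pairwise (\<lambda>x y. negligible ((+) x ` D \<inter> (+) y ` D)) J'"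
      unfolding pairwise_def using J'(1) tiles_overlap by (auto simp: J_def)
  qed
  also have "\<dots> \<le> V" unfolding V_def
  proof (rule measure_mono_fmeasurable)
    show "(\<Union>l\<in>J'. (+) l ` D) \<subseteq> cball 0 (R + 2 * B)" using sub J'(1) by blast
    show "(\<Union>l\<in>J'. (+) l ` D) \<in> sets lebesgue" using J'(2) m by (intro sets.finite_UN) (auto simp: fmeasurable_def)
  qed (rule lmeasurable_cball)
  finally show False using n by simp
qed

text \<open>Points in two different tiles form a countable union of null sets.\<close>
lemma tile_count:
  assumes "finite J" "J \<subseteq> L"
  shows "AE y in lebesgue. (\<exists>l\<in>J. y - l \<in> D) \<longrightarrow> (\<Sum>l\<in>J. indicat_real D (y - l)) = 1"
proof -
  define N where "N = (\<Union>p\<in>{p\<in>L \<times> L. fst p \<noteq> snd p}. (+) (fst p) ` D \<inter> (+) (snd p) ` D)"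
  have "negligible N" unfolding N_def
  proof (rule negligible_countable_Union)
    show "countable ((\<lambda>p. (+) (fst p) ` D \<inter> (+) (snd p) ` D) ` {p\<in>L \<times> L. fst p \<noteq> snd p})"
      using L(1) by (intro countable_image countable_subset[OF _ countable_SIGMA[of L "\<lambda>_. L"]]) auto
  qed (use tiles_overlap in auto)
  from AE_not_negligible[OF this] show ?thesis
  proof eventually_elim
    case (elim y)
    show ?case
    proof
      assume "\<exists>l\<in>J. y - l \<in> D"
      then obtain l where l: "l \<in> J" "y - l \<in> D" by blast
      have "indicat_real D (y - l') = (if l' = l then 1 else 0)" if l': "l' \<in> J" for l'
      proof (cases "l' = l")
        case False
        have "y - l' \<notin> D"
        proof
          assume "y - l' \<in> D"
          then have "y \<in> (+) (fst (l, l')) ` D \<inter> (+) (snd (l, l')) ` D" using l(2) by (simp only: Int_iff tile_iff fst_conv snd_conv)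
          moreover have "(l, l') \<in> {p\<in>L \<times> L. fst p \<noteq> snd p}" using l(1) l' assms(2) False by auto
          ultimately have "y \<in> N" unfolding N_def by blast
          then show False using elim by blast
        qed
        then show ?thesis using False by simp
      qed (use l in simp)
      then have "(\<Sum>l'\<in>J. indicat_real D (y - l')) = (\<Sum>l'\<in>J. if l' = l then 1 else 0)" by (intro sum.cong) auto
      then show "(\<Sum>l'\<in>J. indicat_real D (y - l')) = 1" using l(1) assms(1) by simp
    qed
  qed
qed

text \<open>Let \<open>\<phi>\<close> be the mollified indicator of \<open>D\<close>.  Its translates add up to \<open>1\<close>, so their
  gradients add up to zero, and unfolding the balance for \<open>\<phi>\<close> over the tiles leaves the integral of
  \<open>d\<close> over one of them.\<close>
lemma gauss_tiling:
  fixes w :: vector_field and d :: scalar_field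
  assumes per: "periodic L w" "periodic L d" and ec: "ess_cont UNIV w" "ess_cont UNIV d"
    and interior: "\<And>\<eta> g C. \<lbrakk>compact C; has_grad \<eta> g; \<And>x. x \<notin> C \<Longrightarrow> \<eta> x = 0\<rbrakk> \<Longrightarrow>
      (LINT x|lebesgue. \<eta> x * d x + g x \<bullet> w x) = 0"
  shows "(LINT x:D|lebesgue. d x) = 0"
proof -
  obtain \<rho> :: scalar_field where \<rho>: "mollifier 1 \<rho>" using mollifier_exists[of 1] by auto
  note \<rho>i = mollifier_integrable[OF \<rho>]
  let ?ind = "indicat_real D"
  have i1: "integrable lebesgue ?ind" using lmeasurable_D by (simp add: lmeasurable_iff_integrable)
  define \<phi> where "\<phi> = conv ?ind \<rho>"
  have "smooth_on UNIV \<phi>" unfolding \<phi>_def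
    by (rule conv_smooth[OF i1, of _ 1]) (use \<rho> \<rho>i(5) in \<open>auto simp: mollifier_def\<close>)
  then obtain g where g: "has_grad \<phi> g" using smooth_has_grad by metis
  define Z where "Z = (\<Union>x\<in>D. \<Union>y\<in>cball 0 1. {x + y})"
  have cZ: "compact Z" unfolding Z_def by (rule compact_sums'[OF D(1) compact_cball])
  have Zin: "x \<in> Z" if "y \<in> D" "dist x y \<le> 1" for x y
  proof -
    have "x = y + (x - y)" "x - y \<in> cball 0 1" using that(2) by (auto simp: dist_norm norm_minus_commute)
    then show ?thesis using that(1) unfolding Z_def by blast
  qed
  have \<phi>0: "\<phi> x = 0" if "x \<notin> Z" for x
  proof (rule ccontr)
    assume "\<phi> x \<noteq> 0"
    then obtain y where "y \<in> D" "dist x y < 1" using mollify_support[OF \<rho>, of D "?ind" x] by (auto simp: \<phi>_def)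
    then show False using Zin[of y x] that by simp
  qed
  have g0: "g x = 0" if "x \<notin> Z" for x
    using has_grad_zero_off_closed[OF g compact_imp_closed[OF cZ] \<phi>0] that by blast
  define J where "J = {l\<in>L. Z \<inter> (+) l ` D \<noteq> {}}"
  have J: "finite J" "J \<subseteq> L" using finite_tiles[OF compact_imp_bounded[OF cZ]] by (auto simp: J_def)
  have sum\<phi>: "(\<Sum>l\<in>J. \<phi> (x + l)) = 1" if x: "x \<in> D" for x
  proof -
    have sh: "\<phi> (x + l) = (LINT y|lebesgue. \<rho> (x - y) * ?ind (y + l))"
      and ish: "integrable lebesgue (\<lambda>y. \<rho> (x - y) * ?ind (y + l))" for l
      using translate_integral[OF mollifier_scale_integrable[OF \<rho> i1, of "x + l"], of l]
      by (simp_all add: \<phi>_def conv_def algebra_simps)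
    have "(\<Sum>l\<in>J. \<phi> (x + l)) = (LINT y|lebesgue. (\<Sum>l\<in>J. \<rho> (x - y) * ?ind (y + l)))"
      unfolding sh by (rule Bochner_Integration.integral_sum[symmetric]) (rule ish)
    also have "\<dots> = (LINT y|lebesgue. \<rho> (x - y))"
    proof (rule integral_cong_AE)
      show "(\<lambda>y. \<Sum>l\<in>J. \<rho> (x - y) * ?ind (y + l)) \<in> borel_measurable lebesgue"
        using ish by (intro borel_measurable_sum) auto
      show "(\<lambda>y. \<rho> (x - y)) \<in> borel_measurable lebesgue" using \<rho>i(2) by auto
      have "AE y in lebesgue. (\<exists>l\<in>uminus ` J. y - l \<in> D) \<longrightarrow> (\<Sum>l\<in>uminus ` J. ?ind (y - l)) = 1"
        by (rule tile_count) (use J L_minus in auto)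
      then show "AE y in lebesgue. (\<Sum>l\<in>J. \<rho> (x - y) * ?ind (y + l)) = \<rho> (x - y)"
      proof eventually_elim
        case (elim y)
        show ?case
        proof (cases "\<rho> (x - y) = 0")
          case False
          then have xy: "dist x y < 1" using \<rho> by (force simp: mollifier_def dist_norm)
          obtain l' where l': "l' \<in> L" "y - l' \<in> D" using D(2) tile_iff by blast
          have "x - l' \<in> Z" by (rule Zin[OF l'(2)]) (use xy in \<open>simp add: dist_norm\<close>)
          moreover have "x - l' \<in> (+) (- l') ` D" using x by simp
          ultimately have "- l' \<in> J" using L_minus[OF l'(1)] unfolding J_def by blast
          then have "\<exists>l\<in>uminus ` J. y - l \<in> D" using l'(2) by (metis image_eqI minus_minus)
          then have "(\<Sum>l\<in>uminus ` J. ?ind (y - l)) = 1" using elim by blast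
          then have "(\<Sum>l\<in>J. ?ind (y + l)) = 1" by (subst (asm) sum.reindex) auto
          then show ?thesis by (simp add: sum_distrib_left[symmetric])
        qed simp
      qed
    qed
    also have "\<dots> = 1" by (rule \<rho>i(3))
    finally show ?thesis .
  qed
  have sumg: "(\<Sum>l\<in>J. g (x + l)) = 0" if x: "x \<in> interior D" for x
  proof -
    have "((\<lambda>x. \<Sum>l\<in>J. \<phi> (x + l)) has_derivative (\<lambda>h. \<Sum>l\<in>J. g (x + l) \<bullet> h)) (at x)"
    proof (rule has_derivative_sum)
      fix l
      have "((\<lambda>x. x + l) has_derivative (\<lambda>h. h)) (at x)" by (auto intro!: derivative_eq_intros)
      from has_derivative_compose[OF this has_gradD(1)[OF g]]
      show "((\<lambda>x. \<phi> (x + l)) has_derivative (\<lambda>h. g (x + l) \<bullet> h)) (at x)" .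
    qed
    moreover have "((\<lambda>x. \<Sum>l\<in>J. \<phi> (x + l)) has_derivative (\<lambda>h. 0)) (at x)"
      by (rule has_derivative_transform_within_open[OF has_derivative_const[of 1] open_interior x])
         (use sum\<phi> interior_subset in auto)
    ultimately have "(\<lambda>h. \<Sum>l\<in>J. g (x + l) \<bullet> h) = (\<lambda>h. 0)" by (rule has_derivative_unique)
    then have "(\<Sum>l\<in>J. g (x + l)) \<bullet> (\<Sum>l\<in>J. g (x + l)) = 0" unfolding inner_sum_left by metis
    then show ?thesis by simp
  qed
  define h where "h x = \<phi> x * d x + g x \<bullet> w x" for x
  have h0: "h x = 0" if "x \<notin> Z" for x using \<phi>0[OF that] g0[OF that] by (simp add: h_def)
  have ih: "integrable lebesgue h"
  proof (rule ess_cont_compact_support(2)[OF _ cZ _ h0])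
    show "ess_cont UNIV h" unfolding h_def
      by (intro ess_cont_add ess_cont_bilinear[OF bounded_bilinear_mult] ess_cont_bilinear[OF bounded_bilinear_inner] ec
          ess_cont_continuous_compact[OF has_gradD(3)[OF g] cZ \<phi>0] ess_cont_continuous_compact[OF has_gradD(2)[OF g] cZ g0])
  qed auto
  have ihl: "integrable lebesgue (\<lambda>x. ?ind (x - l) * h x)" for l
  proof -
    have eq: "?ind (x - l) * h x = h x * indicat_real ((+) l ` D) x" for x by (simp add: indicator_def tile_iff)
    have "(+) l ` D \<in> sets lebesgue" using measurable_translation[OF lmeasurable_D] by (rule fmeasurableD)
    then show ?thesis unfolding eq using ih by (rule integrable_real_mult_indicator)
  qed
  have ihD: "integrable lebesgue (\<lambda>x. ?ind x * h (x + l))" and eqD: "(LINT x|lebesgue. ?ind (x - l) * h x) = (LINT x|lebesgue. ?ind x * h (x + l))" for l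
    using translate_integral[OF ihl[of l], of l] by simp_all
  have "0 = (LINT x|lebesgue. h x)" using interior[OF cZ g \<phi>0] by (simp add: h_def)
  also have "\<dots> = (LINT x|lebesgue. (\<Sum>l\<in>J. ?ind (x - l) * h x))"
  proof (rule integral_cong_AE)
    show "h \<in> borel_measurable lebesgue" using ih by auto
    show "(\<lambda>x. \<Sum>l\<in>J. ?ind (x - l) * h x) \<in> borel_measurable lebesgue" using ihl by (intro borel_measurable_sum) auto
    show "AE x in lebesgue. h x = (\<Sum>l\<in>J. ?ind (x - l) * h x)"
      using tile_count[OF J]
    proof eventually_elim
      case (elim x)
      show ?case
      proof (cases "x \<in> Z")
        case True
        obtain l where l: "l \<in> L" "x - l \<in> D" using D(2) tile_iff by blast
        then have "l \<in> J" using True unfolding J_def tile_iff[symmetric] by blast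
        then have "(\<Sum>l\<in>J. ?ind (x - l)) = 1" using elim l by blast
        then show ?thesis by (simp add: sum_distrib_right[symmetric])
      qed (simp add: h0)
    qed
  qed
  also have "\<dots> = (\<Sum>l\<in>J. LINT x|lebesgue. ?ind x * h (x + l))"
    unfolding eqD[symmetric] by (rule Bochner_Integration.integral_sum) (rule ihl)
  also have "\<dots> = (LINT x|lebesgue. (\<Sum>l\<in>J. ?ind x * h (x + l)))"
    by (rule Bochner_Integration.integral_sum[symmetric]) (rule ihD)
  also have "\<dots> = (LINT x|lebesgue. ?ind x *\<^sub>R d x)"
  proof (rule integral_cong_AE)
    show "(\<lambda>x. \<Sum>l\<in>J. ?ind x * h (x + l)) \<in> borel_measurable lebesgue" using ihD by (intro borel_measurable_sum) auto
    show "(\<lambda>x. ?ind x *\<^sub>R d x) \<in> borel_measurable lebesgue"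
      by (rule ess_cont_measurable[OF ec(2) fmeasurableD[OF lmeasurable_D]]) simp
    show "AE x in lebesgue. (\<Sum>l\<in>J. ?ind x * h (x + l)) = ?ind x *\<^sub>R d x"
      using AE_not_negligible[OF D(3)]
    proof eventually_elim
      case (elim x)
      show ?case
      proof (cases "x \<in> D")
        case True
        have "h (x + l) = \<phi> (x + l) * d x + g (x + l) \<bullet> w x" if "l \<in> J" for l
          using per that J(2) unfolding periodic_def h_def by (metis subsetD)
        then have "(\<Sum>l\<in>J. h (x + l)) = (\<Sum>l\<in>J. \<phi> (x + l)) * d x + (\<Sum>l\<in>J. g (x + l)) \<bullet> w x"
          by (simp add: sum.distrib sum_distrib_right inner_sum_left)
        also have "\<dots> = d x" using True elim sum\<phi> sumg by simp
        finally show ?thesis using True by simp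
      qed simp
    qed
  qed
  finally show ?thesis by (simp add: set_lebesgue_integral_def)
qed

end

text \<open>Gauss's theorem without boundary term.  On a bounded domain the flux through the
  boundary vanishes by the trace condition, on a torus there is no boundary.\<close>
theorem gauss_zero_flux:
  fixes w :: vector_field and d :: scalar_field
  assumes dom: "spatial_domain L \<Omega>" and mesh: "fe_mesh L M \<Omega>"
    and per: "periodic L w" "periodic L d" and ec: "ess_cont \<Omega> w" "ess_cont \<Omega> d"
    and interior: "interior_balance \<Omega> w d"
    and trace: "\<And>K. K \<in> all_cells L M \<Longrightarrow> zero_flux_on L M \<Omega> w K"
  shows "(LINT x:period_cell M \<Omega>|lebesgue. d x) = 0"
proof -
  note m = fe_meshD[OF mesh] and p = spatial_domain_periods[OF dom]
  consider "L = {0}" "bounded \<Omega>" | "\<Omega> = UNIV" using dom by (auto simp: spatial_domain_def)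
  then show ?thesis
  proof cases
    case 1
    have "\<Omega> \<subseteq> (\<Union>K\<in>M. cell_set K)" using m(3) closure_subset[of \<Omega>] 1 by simp
    then have "period_cell M \<Omega> = \<Omega>" by (auto simp: period_cell_def)
    moreover have "(LINT x:\<Omega>|lebesgue. d x) = 0"
      by (rule gauss_meshed_domain[OF mesh[unfolded 1(1)] p(4) 1(2) ec interior trace[unfolded 1(1) all_cells_trivial]])
    ultimately show ?thesis by simp
  next
    case 2
    define D where "D = (\<Union>K\<in>M. cell_set K)"
    have Dp: "period_cell M \<Omega> = D" using 2 by (simp add: period_cell_def D_def)
    have tl: "(+) l ` D = (\<Union>K\<in>M. (+) l ` cell_set K)" for l by (auto simp: D_def)
    interpret tiling L D
    proof
      show "countable L" "0 \<in> L" "\<And>l l'. l \<in> L \<Longrightarrow> l' \<in> L \<Longrightarrow> l - l' \<in> L" by (fact p)+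
      show "compact D" "negligible (D - interior D)" unfolding D_def by (rule mesh_union[OF mesh])+
      show "(\<Union>l\<in>L. (+) l ` D) = UNIV" using m(3) 2 by (simp add: tl)
      fix l assume l: "l \<in> L" "l \<noteq> 0"
      have "negligible (cell_set K \<inter> (+) l ` cell_set K')" if "K \<in> M" "K' \<in> M" for K K'
      proof -
        have meet: "meet_in_common_face K (translate_cell l K')" using mesh that l unfolding fe_mesh_def by blast
        show ?thesis using common_face_negligible[OF m(2)[OF that(1)] meet] unfolding cell_set_translate .
      qed
      then have "negligible (\<Union>K'\<in>M. cell_set K \<inter> (+) l ` cell_set K')" if "K \<in> M" for K
        using m(1) that by (intro negligible_Union) blast+
      then have "negligible (\<Union>K\<in>M. \<Union>K'\<in>M. cell_set K \<inter> (+) l ` cell_set K')"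
        using m(1) by (intro negligible_Union) blast+
      moreover have "D \<inter> (+) l ` D = (\<Union>K\<in>M. \<Union>K'\<in>M. cell_set K \<inter> (+) l ` cell_set K')" unfolding tl by (auto simp: D_def)
      ultimately show "negligible (D \<inter> (+) l ` D)" by simp
    qed
    show ?thesis unfolding Dp
    proof (rule gauss_tiling[OF per ec[unfolded 2]])
      show "(LINT x|lebesgue. \<eta> x * d x + g x \<bullet> w x) = 0"
        if "compact C" "has_grad \<eta> g" "\<And>x. x \<notin> C \<Longrightarrow> \<eta> x = 0" for \<eta> g C
        using interior[rule_format, OF that(1) _ that(2,3)] 2 by (simp add: set_lebesgue_integral_def)
    qed
  qed
qed

section \<open>The \<open>L\<^sup>2\<close> product and its time derivative\<close>

lemma L2D:
  assumes "L2 D f"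
  shows "(\<lambda>x. indicat_real D x *\<^sub>R f x) \<in> borel_measurable lebesgue"
    "integrable lebesgue (\<lambda>x. (norm (indicat_real D x *\<^sub>R f x))\<^sup>2)"
proof -
  show "(\<lambda>x. indicat_real D x *\<^sub>R f x) \<in> borel_measurable lebesgue"
    using assms by (simp add: L2_def set_borel_measurable_def)
  have "(norm (indicat_real D x *\<^sub>R f x))\<^sup>2 = indicat_real D x *\<^sub>R (norm (f x))\<^sup>2" for x
    by (simp add: indicator_def)
  then show "integrable lebesgue (\<lambda>x. (norm (indicat_real D x *\<^sub>R f x))\<^sup>2)"
    using assms by (simp add: L2_def set_integrable_def)
qed

lemma L2I:
  assumes "(\<lambda>x. indicat_real D x *\<^sub>R f x) \<in> borel_measurable lebesgue"
    "integrable lebesgue (\<lambda>x. (norm (indicat_real D x *\<^sub>R f x))\<^sup>2)"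
  shows "L2 D f"
proof -
  have "(norm (indicat_real D x *\<^sub>R f x))\<^sup>2 = indicat_real D x *\<^sub>R (norm (f x))\<^sup>2" for x
    by (simp add: indicator_def)
  then show ?thesis using assms by (simp add: L2_def set_borel_measurable_def set_integrable_def)
qed

lemma L2_add:
  assumes "L2 D f" "L2 D g"
  shows "L2 D (\<lambda>x. f x + g x)"
proof (rule L2I)
  note f = L2D[OF assms(1)] and g = L2D[OF assms(2)]
  have eq: "indicat_real D x *\<^sub>R (f x + g x) = indicat_real D x *\<^sub>R f x + indicat_real D x *\<^sub>R g x" for x
    by (simp add: scaleR_add_right)
  show m: "(\<lambda>x. indicat_real D x *\<^sub>R (f x + g x)) \<in> borel_measurable lebesgue"
    unfolding eq using f(1) g(1) by (rule borel_measurable_add)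
  show "integrable lebesgue (\<lambda>x. (norm (indicat_real D x *\<^sub>R (f x + g x)))\<^sup>2)"
  proof (rule Bochner_Integration.integrable_bound)
    show "integrable lebesgue (\<lambda>x. 2 * (norm (indicat_real D x *\<^sub>R f x))\<^sup>2 + 2 * (norm (indicat_real D x *\<^sub>R g x))\<^sup>2)"
      using f(2) g(2) by (intro Bochner_Integration.integrable_add integrable_mult_right)
    show "(\<lambda>x. (norm (indicat_real D x *\<^sub>R (f x + g x)))\<^sup>2) \<in> borel_measurable lebesgue"
      by (rule borel_measurable_power[OF measurable_compose[OF m borel_measurable_norm]])
    have bnd: "(norm (a + b))\<^sup>2 \<le> 2 * (norm a)\<^sup>2 + 2 * (norm b)\<^sup>2" for a b :: 'a
    proof -
      have "(norm (a + b))\<^sup>2 \<le> (norm a + norm b)\<^sup>2" by (intro power_mono norm_triangle_ineq) auto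
      also have "\<dots> \<le> 2 * (norm a)\<^sup>2 + 2 * (norm b)\<^sup>2"
        using sum_squares_bound[of "norm a" "norm b"] by (simp add: power2_sum)
      finally show ?thesis .
    qed
    show "AE x in lebesgue. norm ((norm (indicat_real D x *\<^sub>R (f x + g x)))\<^sup>2)
        \<le> norm (2 * (norm (indicat_real D x *\<^sub>R f x))\<^sup>2 + 2 * (norm (indicat_real D x *\<^sub>R g x))\<^sup>2)"
    proof (intro AE_I2)
      fix x
      have "norm ((norm (indicat_real D x *\<^sub>R (f x + g x)))\<^sup>2) = (norm (indicat_real D x *\<^sub>R (f x + g x)))\<^sup>2"
        by simp
      also have "\<dots> \<le> 2 * (norm (indicat_real D x *\<^sub>R f x))\<^sup>2 + 2 * (norm (indicat_real D x *\<^sub>R g x))\<^sup>2"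
        unfolding eq by (rule bnd)
      also have "\<dots> \<le> norm \<dots>" by (simp only: real_norm_def abs_ge_self)
      finally show "norm ((norm (indicat_real D x *\<^sub>R (f x + g x)))\<^sup>2)
        \<le> norm (2 * (norm (indicat_real D x *\<^sub>R f x))\<^sup>2 + 2 * (norm (indicat_real D x *\<^sub>R g x))\<^sup>2)" .
    qed
  qed
qed

lemma L2_scale: "L2 D f \<Longrightarrow> L2 D (\<lambda>x. c *\<^sub>R f x)"
proof (rule L2I)
  assume f: "L2 D f"
  have eq: "indicat_real D x *\<^sub>R c *\<^sub>R f x = c *\<^sub>R indicat_real D x *\<^sub>R f x" for x by simp
  show "(\<lambda>x. indicat_real D x *\<^sub>R c *\<^sub>R f x) \<in> borel_measurable lebesgue"
    unfolding eq by (rule borel_measurable_scaleR[OF borel_measurable_const L2D(1)[OF f]])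
  show "integrable lebesgue (\<lambda>x. (norm (indicat_real D x *\<^sub>R c *\<^sub>R f x))\<^sup>2)"
    unfolding eq norm_scaleR[of c] power_mult_distrib by (rule integrable_mult_right[OF L2D(2)[OF f]])
qed

lemma L2_minus: "L2 D f \<Longrightarrow> L2 D (\<lambda>x. - f x)"
  using L2_scale[of D f "-1"] by simp

lemma L2_diff: "L2 D f \<Longrightarrow> L2 D g \<Longrightarrow> L2 D (\<lambda>x. f x - g x)"
  using L2_add[OF _ L2_minus] by simp

lemma L2_inner_integrable:
  assumes "L2 D f" "L2 D g"
  shows "set_integrable lebesgue D (\<lambda>x. f x \<bullet> g x)"
proof -
  note f = L2D[OF assms(1)] and g = L2D[OF assms(2)]
  have eq: "indicat_real D x *\<^sub>R (f x \<bullet> g x) = (indicat_real D x *\<^sub>R f x) \<bullet> (indicat_real D x *\<^sub>R g x)" for x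
    by (simp add: indicator_def)
  show ?thesis unfolding set_integrable_def eq
  proof (rule Bochner_Integration.integrable_bound)
    show "integrable lebesgue (\<lambda>x. (norm (indicat_real D x *\<^sub>R f x))\<^sup>2 + (norm (indicat_real D x *\<^sub>R g x))\<^sup>2)"
      using f(2) g(2) by (rule Bochner_Integration.integrable_add)
    show "(\<lambda>x. (indicat_real D x *\<^sub>R f x) \<bullet> (indicat_real D x *\<^sub>R g x)) \<in> borel_measurable lebesgue"
      using f(1) g(1) by (rule borel_measurable_inner)
    have bnd: "\<bar>a \<bullet> b\<bar> \<le> (norm a)\<^sup>2 + (norm b)\<^sup>2" for a b :: 'a
    proof -
      have "0 \<le> norm a * norm b" "2 * (norm a * norm b) \<le> (norm a)\<^sup>2 + (norm b)\<^sup>2"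
        using sum_squares_bound[of "norm a" "norm b"] by (simp_all add: mult.assoc)
      then show ?thesis using Cauchy_Schwarz_ineq2[of a b] by linarith
    qed
    show "AE x in lebesgue. norm ((indicat_real D x *\<^sub>R f x) \<bullet> (indicat_real D x *\<^sub>R g x))
       \<le> norm ((norm (indicat_real D x *\<^sub>R f x))\<^sup>2 + (norm (indicat_real D x *\<^sub>R g x))\<^sup>2)"
      unfolding real_norm_def by (intro AE_I2 order_trans[OF bnd abs_ge_self])
  qed
qed

lemma ip_commute: "ip D f g = ip D g f"
  by (simp add: ip_def inner_commute)

lemma ip_add_left: "L2 D f \<Longrightarrow> L2 D f' \<Longrightarrow> L2 D g \<Longrightarrow> ip D (\<lambda>x. f x + f' x) g = ip D f g + ip D f' g"
  unfolding ip_def inner_add_left by (rule set_integral_add(2)) (rule L2_inner_integrable, assumption+)+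

lemma ip_scale_left: "ip D (\<lambda>x. c *\<^sub>R f x) g = c * ip D f g"
  by (simp add: ip_def)

lemma ip_add_right: "L2 D f \<Longrightarrow> L2 D g \<Longrightarrow> L2 D g' \<Longrightarrow> ip D f (\<lambda>x. g x + g' x) = ip D f g + ip D f g'"
  unfolding ip_def inner_add_right by (rule set_integral_add(2)) (rule L2_inner_integrable, assumption+)+

lemma ip_scale_right: "ip D f (\<lambda>x. c *\<^sub>R g x) = c * ip D f g"
  by (simp add: ip_def)

lemma ip_minus_left: "ip D (\<lambda>x. - f x) g = - ip D f g"
  using ip_scale_left[of D "-1" f g] by simp

lemma ip_minus_right: "ip D f (\<lambda>x. - g x) = - ip D f g"
  using ip_scale_right[of D f "-1" g] by simp

lemma ip_self_nonneg: "0 \<le> ip D f f"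
  unfolding ip_def set_lebesgue_integral_def by (intro integral_nonneg_AE AE_I2) (simp add: indicator_def)

lemma ip_Cauchy_Schwarz:
  assumes f: "L2 D f" and g: "L2 D g"
  shows "\<bar>ip D f g\<bar> \<le> L2_norm D f * L2_norm D g"
proof -
  let ?F = "ip D f f" and ?X = "ip D f g" and ?G = "ip D g g"
  have quad: "0 \<le> ?F + 2 * s * ?X + s\<^sup>2 * ?G" for s
  proof -
    have sg: "L2 D (\<lambda>x. s *\<^sub>R g x)" by (rule L2_scale[OF g])
    have "ip D (\<lambda>x. f x + s *\<^sub>R g x) (\<lambda>x. f x + s *\<^sub>R g x) = ?F + 2 * s * ?X + s\<^sup>2 * ?G"
      using ip_add_left[OF f sg L2_add[OF f sg]] ip_add_right[OF f f sg] ip_add_right[OF sg f sg]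
      by (simp add: ip_scale_left ip_scale_right ip_commute[of D g f] power2_eq_square)
    then show ?thesis using ip_self_nonneg[of D "\<lambda>x. f x + s *\<^sub>R g x"] by simp
  qed
  have "?X\<^sup>2 \<le> ?F * ?G"
  proof (cases "?G = 0")
    case True
    have "?X = 0"
    proof (rule ccontr)
      assume "?X \<noteq> 0"
      then have "2 * (- (?F + 1) / (2 * ?X)) * ?X = - (?F + 1)" by (simp add: field_simps)
      then show False using quad[of "- (?F + 1) / (2 * ?X)"] True by simp
    qed
    then show ?thesis using True by simp
  next
    case False
    then have G: "?G > 0" using ip_self_nonneg[of D g] by simp
    have "0 \<le> ?F - ?X\<^sup>2 / ?G" using quad[of "- ?X / ?G"] False by (simp add: power2_eq_square)
    then show ?thesis using G by (simp add: field_simps)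
  qed
  then have "sqrt (?X\<^sup>2) \<le> sqrt (?F * ?G)" by (rule real_sqrt_le_mono)
  then show ?thesis by (simp add: L2_norm_def real_sqrt_mult)
qed

lemma ip_tendsto_zero:
  assumes "((\<lambda>s. L2_norm D (f s)) \<longlongrightarrow> 0) F" "((\<lambda>s. L2_norm D (g s)) \<longlongrightarrow> b) F"
    and "\<forall>\<^sub>F s in F. L2 D (f s) \<and> L2 D (g s)"
  shows "((\<lambda>s. ip D (f s) (g s)) \<longlongrightarrow> 0) F"
proof (rule Lim_null_comparison)
  show "((\<lambda>s. L2_norm D (f s) * L2_norm D (g s)) \<longlongrightarrow> 0) F"
    using tendsto_mult[OF assms(1,2)] by simp
  show "\<forall>\<^sub>F s in F. norm (ip D (f s) (g s)) \<le> L2_norm D (f s) * L2_norm D (g s)"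
    using assms(3) by eventually_elim (use ip_Cauchy_Schwarz in auto)
qed

text \<open>Besides the derivative, the difference quotient of the product consists of
  terms that the Cauchy-Schwarz inequality bounds by vanishing \<open>L\<^sup>2\<close> norms or by \<open>s - t\<close>.\<close>
lemma ip_has_derivative:
  assumes A: "\<And>s. s \<in> I \<Longrightarrow> L2 D (A s)" "has_time_derivative D I A t A'"
    and B: "\<And>s. s \<in> I \<Longrightarrow> L2 D (B s)" "has_time_derivative D I B t B'" and t: "t \<in> I"
  shows "((\<lambda>s. ip D (A s) (B s)) has_real_derivative (ip D A' (B t) + ip D (A t) B')) (at t within I)"
proof -
  let ?F = "at t within I"
  define a where "a s = (\<lambda>x. (A s x - A t x) /\<^sub>R (s - t) - A' x)" for s
  define b where "b s = (\<lambda>x. (B s x - B t x) /\<^sub>R (s - t) - B' x)" for s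
  have A': "L2 D A'" and B': "L2 D B'" and an: "((\<lambda>s. L2_norm D (a s)) \<longlongrightarrow> 0) ?F" and bn: "((\<lambda>s. L2_norm D (b s)) \<longlongrightarrow> 0) ?F"
    using A(2) B(2) by (auto simp: has_time_derivative_def a_def b_def)
  have La: "L2 D (a s)" and Lb: "L2 D (b s)" if "s \<in> I" for s
    unfolding a_def b_def using A(1) B(1) A' B' t that by (auto intro!: L2_diff L2_scale)
  have ev: "\<forall>\<^sub>F s in ?F. s \<in> I \<and> s \<noteq> t" by (simp add: eventually_at_filter)
  have eq: "(ip D (A s) (B s) - ip D (A t) (B t)) / (s - t) =
      ip D A' (B t) + ip D (A t) B' + ip D (a s) (B t) + ip D (b s) (A t)
      + (s - t) * (ip D A' B' + ip D (a s) B' + ip D (b s) A' + ip D (a s) (b s))" if s: "s \<in> I" "s \<noteq> t" for s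
  proof -
    define r where "r = s - t"
    have r: "r \<noteq> 0" using s by (simp add: r_def)
    define a' where "a' = (\<lambda>x. A' x + a s x)"
    define b' where "b' = (\<lambda>x. B' x + b s x)"
    have La': "L2 D a'" and Lb': "L2 D b'" unfolding a'_def b'_def using La Lb A' B' s(1) by (auto intro: L2_add)
    have As: "A s = (\<lambda>x. A t x + r *\<^sub>R a' x)" and Bs: "B s = (\<lambda>x. B t x + r *\<^sub>R b' x)"
      using r by (simp_all add: fun_eq_iff a'_def b'_def a_def b_def r_def)
    have "ip D (A s) (B s) = ip D (A t) (B s) + r * ip D a' (B s)"
      by (subst As) (simp add: ip_add_left[OF A(1)[OF t] L2_scale[OF La'] B(1)[OF s(1)]] ip_scale_left)
    also have "ip D (A t) (B s) = ip D (A t) (B t) + r * ip D (A t) b'"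
      by (subst Bs) (simp add: ip_add_right[OF A(1)[OF t] B(1)[OF t] L2_scale[OF Lb']] ip_scale_right)
    also have "ip D a' (B s) = ip D a' (B t) + r * ip D a' b'"
      by (subst Bs) (simp add: ip_add_right[OF La' B(1)[OF t] L2_scale[OF Lb']] ip_scale_right)
    finally have "(ip D (A s) (B s) - ip D (A t) (B t)) / r = ip D (A t) b' + ip D a' (B t) + r * ip D a' b'"
      using r by (simp add: field_simps)
    moreover have "ip D (A t) b' = ip D (A t) B' + ip D (A t) (b s)"
      unfolding b'_def by (rule ip_add_right[OF A(1)[OF t] B' Lb[OF s(1)]])
    moreover have "ip D a' (B t) = ip D A' (B t) + ip D (a s) (B t)"
      unfolding a'_def by (rule ip_add_left[OF A' La[OF s(1)] B(1)[OF t]])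
    moreover have "ip D a' b' = ip D A' b' + ip D (a s) b'"
      unfolding a'_def by (rule ip_add_left[OF A' La[OF s(1)] Lb'])
    moreover have "ip D A' b' = ip D A' B' + ip D A' (b s)"
      unfolding b'_def by (rule ip_add_right[OF A' B' Lb[OF s(1)]])
    moreover have "ip D (a s) b' = ip D (a s) B' + ip D (a s) (b s)"
      unfolding b'_def by (rule ip_add_right[OF La[OF s(1)] B' Lb[OF s(1)]])
    ultimately show ?thesis by (simp add: r_def ip_commute[of D "b s"])
  qed
  have l: "((\<lambda>s. ip D (a s) X) \<longlongrightarrow> 0) ?F" "((\<lambda>s. ip D (b s) X) \<longlongrightarrow> 0) ?F" if "L2 D X" for X
    using ev La Lb that by (auto intro!: ip_tendsto_zero[OF an tendsto_const] ip_tendsto_zero[OF bn tendsto_const] elim!: eventually_mono)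
  have lab: "((\<lambda>s. ip D (a s) (b s)) \<longlongrightarrow> 0) ?F"
    using ev La Lb by (auto intro!: ip_tendsto_zero[OF an bn] elim!: eventually_mono)
  have lt: "((\<lambda>s. s - t) \<longlongrightarrow> 0) ?F" by (auto intro!: tendsto_eq_intros)
  have "((\<lambda>s. ip D A' (B t) + ip D (A t) B' + ip D (a s) (B t) + ip D (b s) (A t)
      + (s - t) * (ip D A' B' + ip D (a s) B' + ip D (b s) A' + ip D (a s) (b s)))
      \<longlongrightarrow> ip D A' (B t) + ip D (A t) B' + 0 + 0 + 0 * (ip D A' B' + 0 + 0 + 0)) ?F"
    by (intro tendsto_add tendsto_mult tendsto_const l lab lt A' B' A(1) B(1) t)
  then have "((\<lambda>s. (ip D (A s) (B s) - ip D (A t) (B t)) / (s - t)) \<longlongrightarrow> ip D A' (B t) + ip D (A t) B') ?F"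
    by (simp, elim Lim_transform_eventually) (use ev eq in \<open>auto elim!: eventually_mono\<close>)
  then show ?thesis by (simp add: has_field_derivative_iff)
qed

section \<open>Integration by parts on finite element spaces\<close>

lemma sum_Basis_vec3: "(\<Sum>i\<in>Basis. f i) = f (axis 1 1) + f (axis 2 1) + f (axis 3 (1::real))"
  for f :: "vec3 \<Rightarrow> 'a::comm_monoid_add"
proof -
  have "(Basis :: vec3 set) = (\<lambda>j. axis j 1) ` UNIV" by (auto simp: Basis_vec_def)
  moreover have inj: "inj (\<lambda>j::3. axis j (1::real))" by (auto simp: inj_on_def axis_eq_axis)
  ultimately have "(\<Sum>i\<in>Basis. f i) = (\<Sum>j\<in>UNIV. f (axis j 1))" using sum.reindex[OF inj, of f] by (simp add: o_def)
  then show ?thesis by (simp add: sum_3)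
qed

lemma pd_component:
  assumes "(\<phi> has_derivative D) (at x)"
  shows "pd i (\<lambda>y. \<phi> y $ j) x = D (axis i 1) $ j"
proof -
  have "((\<lambda>y. \<phi> y $ j) has_derivative (\<lambda>h. D h $ j)) (at x)"
    by (rule bounded_linear.has_derivative[OF bounded_linear_vec_nth assms])
  from frechet_derivative_at[OF this] show ?thesis by (simp add: pd_def fun_eq_iff)
qed

lemma bounded_bilinear_cross3: "bounded_bilinear cross3"
  using bilinear_cross bilinear_conv_bounded_bilinear by blast

lemma test_function_derivative:
  fixes \<phi> :: "vec3 \<Rightarrow> 'b::euclidean_space"
  assumes "test_function \<Omega> \<phi>"
  shows "(\<phi> has_derivative frechet_derivative \<phi> (at x)) (at x)"
  using assms smooth_derivative(1) by (auto simp: test_function_def)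

lemma weak_curl_iff:
  "has_weak_curl \<Omega> u c \<longleftrightarrow> locally_integrable \<Omega> u \<and> locally_integrable \<Omega> c \<and> weakly cross3 \<Omega> u c"
proof -
  have "classical_curl \<phi> x = (\<Sum>i\<in>Basis. cross3 i (frechet_derivative \<phi> (at x) i))" if "test_function \<Omega> \<phi>" for \<phi> x
    unfolding classical_curl_def pd_component[OF test_function_derivative[OF that]] sum_Basis_vec3
    by (simp add: cross3_def vec_eq_iff forall_3 axis_def vector_def)
  then show ?thesis by (auto simp: has_weak_curl_def weakly_def)
qed

lemma weak_grad_iff:
  "has_weak_grad \<Omega> f g \<longleftrightarrow> locally_integrable \<Omega> f \<and> locally_integrable \<Omega> g \<and> weakly (\<lambda>i b. - (i \<bullet> b)) \<Omega> f g"
proof -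
  have "(\<Sum>i\<in>Basis. - (i \<bullet> frechet_derivative \<phi> (at x) i)) = - classical_div \<phi> x" if "test_function \<Omega> \<phi>" for \<phi> x
    unfolding classical_div_def pd_component[OF test_function_derivative[OF that]] sum_Basis_vec3
    by (simp add: sum_3 inner_axis inner_commute[of "axis _ _"])
  then show ?thesis by (auto simp: has_weak_grad_def weakly_def set_lebesgue_integral_def)
qed

lemma cell_interior_accumulates:
  assumes mesh: "fe_mesh L M \<Omega>" and K: "K \<in> all_cells L M" and x: "x \<in> cell_set K"
  shows "at x within interior (cell_set K) \<noteq> bot"
proof -
  obtain l K0 where K0: "K0 \<in> M" "K = translate_cell l K0" using K by (force simp: all_cells_def)
  obtain S U where "cell_chart (fst K0) (snd K0) S U" using is_cell_chart[OF fe_meshD(2)[OF mesh K0(1)]] by blast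
  then interpret cell_chart "fst K0" "snd K0" S U .
  have "cell_set K \<subseteq> closure (interior (cell_set K))"
    unfolding K0(2) cell_set_translate interior_translation closure_translation
    using cell_subset_closure by (intro image_mono) (simp add: cell_set_def)
  then have "x \<in> closure (interior (cell_set K))" using x by blast
  then have "x islimpt interior (cell_set K)"
    using open_imp_islimpt[OF open_interior] by (auto simp: closure_def)
  then show ?thesis by (simp add: trivial_limit_within)
qed

locale de_Rham_mesh =
  fixes L \<Omega> :: "vec3 set" and M :: "cell set" and V0 V3 :: "scalar_field set" and V1 V2 :: "vector_field set"
  assumes domain: "spatial_domain L \<Omega>" and mesh: "fe_mesh L M \<Omega>"
    and complex: "discrete_de_Rham L M \<Omega> V0 V1 V2 V3"
begin

abbreviation "D \<equiv> period_cell M \<Omega>"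

lemma fe_field:
  assumes "fe_space L M V" "f \<in> V"
  shows "periodic L f" "cellwise_smooth (all_cells L M) f" "ess_cont \<Omega> f"
proof -
  show 1: "periodic L f" "cellwise_smooth (all_cells L M) f" using assms by (auto simp: fe_space_def)
  show "ess_cont \<Omega> f" by (rule mesh_field_ess_cont[OF domain mesh 1])
qed

lemma spaces: "fe_space L M V0" "fe_space L M V1" "fe_space L M V2"
  "\<And>f. f \<in> V0 \<Longrightarrow> L2 D f" "\<And>u. u \<in> V1 \<Longrightarrow> L2 D u" "\<And>w. w \<in> V2 \<Longrightarrow> L2 D w"
  using complex by (auto simp: discrete_de_Rham_def H1_def Hcurl_def Hdiv_def)

lemma open_\<Omega>: "open \<Omega>" by (rule spatial_domain_periods(4)[OF domain])

text \<open>The defining limit of a trace is a genuine one, since a cell lies in the closure of its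
  interior; it is attained by the smooth extension of the field.\<close>
lemma trace_on_cell:
  fixes f :: "vec3 \<Rightarrow> 'b::euclidean_space"
  assumes f: "cellwise_smooth (all_cells L M) f" and K: "K \<in> all_cells L M"
  obtains U g where "open U" "cell_set K \<subseteq> U" "continuous_on U g"
    "\<And>x. x \<in> interior (cell_set K) \<Longrightarrow> f x = g x" "\<And>x. x \<in> cell_set K \<Longrightarrow> cell_trace K f x = g x"
proof -
  obtain U g where g: "open U" "cell_set K \<subseteq> U" "smooth_on U g" "\<And>x. x \<in> interior (cell_set K) \<Longrightarrow> f x = g x"
    using f K unfolding cellwise_smooth_def by metis
  have cg: "continuous_on U g" using g(3) smooth_on_def Ck_on.simps(1) by metis
  have "cell_trace K f x = g x" if x: "x \<in> cell_set K" for x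
    unfolding cell_trace_def
  proof (rule tendsto_Lim)
    show "at x within interior (cell_set K) \<noteq> bot" by (rule cell_interior_accumulates[OF mesh K x])
    have "isCont g x" using cg g(1,2) x continuous_on_eq_continuous_at by blast
    then have "(g \<longlongrightarrow> g x) (at x within interior (cell_set K))"
      using continuous_at_imp_continuous_at_within continuous_within by blast
    then show "(f \<longlongrightarrow> g x) (at x within interior (cell_set K))"
      by (rule Lim_transform_within[OF _ zero_less_one]) (simp add: g(4))
  qed
  then show ?thesis using that[OF g(1,2) cg g(4)] by blast
qed

lemma product_trace:
  fixes f :: "vec3 \<Rightarrow> 'b::euclidean_space" and h :: "vec3 \<Rightarrow> 'c::euclidean_space" and op :: "'b \<Rightarrow> 'c \<Rightarrow> vec3"
  assumes f: "cellwise_smooth (all_cells L M) f" and h: "cellwise_smooth (all_cells L M) h"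
    and op: "bounded_bilinear op"
    and zero: "\<And>K F x n. \<lbrakk>K \<in> all_cells L M; F facet_of fst K; snd K ` F \<in> boundary_facets L M; x \<in> snd K ` rel_interior F;
        outward_unit_normal \<Omega> x n\<rbrakk> \<Longrightarrow> op (cell_trace K f x) (cell_trace K h x) \<bullet> n = 0"
    and K: "K \<in> all_cells L M"
  shows "zero_flux_on L M \<Omega> (\<lambda>x. op (f x) (h x)) K"
proof -
  obtain U g where g: "open U" "cell_set K \<subseteq> U" "continuous_on U g"
    "\<And>x. x \<in> interior (cell_set K) \<Longrightarrow> f x = g x" "\<And>x. x \<in> cell_set K \<Longrightarrow> cell_trace K f x = g x"
    by (rule trace_on_cell[OF f K]) (rule that)
  obtain U' g' where g': "open U'" "cell_set K \<subseteq> U'" "continuous_on U' g'"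
    "\<And>x. x \<in> interior (cell_set K) \<Longrightarrow> h x = g' x" "\<And>x. x \<in> cell_set K \<Longrightarrow> cell_trace K h x = g' x"
    by (rule trace_on_cell[OF h K]) (rule that)
  have "continuous_on (U \<inter> U') (\<lambda>x. op (g x) (g' x))"
    by (rule bounded_bilinear.continuous_on[OF op])
       (auto intro: continuous_on_subset[OF g(3)] continuous_on_subset[OF g'(3)])
  moreover have "op (g x) (g' x) \<bullet> n = 0"
    if "F facet_of fst K" "snd K ` F \<in> boundary_facets L M" "x \<in> snd K ` rel_interior F" "outward_unit_normal \<Omega> x n" for F x n
  proof -
    have "x \<in> cell_set K"
      using that(1,3) facet_of_imp_subset rel_interior_subset by (fastforce simp: cell_set_def)
    then show ?thesis using zero[OF K that] g(5) g'(5) by simp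
  qed
  ultimately show ?thesis
    using g(1,2,4) g'(1,2,4) by (intro exI[of _ "U \<inter> U'"] exI[of _ "\<lambda>x. op (g x) (g' x)"]) auto
qed

text \<open>The weak derivatives that occur in the evolution equations are arbitrary representatives
  in \<open>L\<^sup>2\<close>; in products with fields they may be replaced by those in the finite element spaces.  To
  apply \<open>weak_unique\<close>, the field \<open>f\<close> is cut off near the boundary of a bounded domain and restricted
  to one period of a periodic one.\<close>
lemma weak_representative:
  fixes c c' f :: "vec3 \<Rightarrow> 'b::euclidean_space"
  assumes w: "weakly T \<Omega> u c" "weakly T \<Omega> u c'" and li: "locally_integrable \<Omega> c" "locally_integrable \<Omega> c'"
    and f: "ess_cont \<Omega> f" and L2: "L2 D f" "L2 D c" "L2 D c'"
  shows "ip D f c = ip D f c'"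
proof -
  have int: "set_integrable lebesgue D (\<lambda>x. c x \<bullet> f x)" "set_integrable lebesgue D (\<lambda>x. c' x \<bullet> f x)"
    using L2 by (auto intro: L2_inner_integrable)
  note m = fe_meshD[OF mesh] and p = spatial_domain_periods[OF domain]
  consider "L = {0}" "bounded \<Omega>" | "\<Omega> = UNIV" using domain by (auto simp: spatial_domain_def)
  then have "(LINT x:D|lebesgue. c x \<bullet> f x) = (LINT x:D|lebesgue. c' x \<bullet> f x)"
  proof cases
    case 1
    have "\<Omega> \<subseteq> (\<Union>K\<in>M. cell_set K)" using m(3) closure_subset[of \<Omega>] 1 by simp
    then have D\<Omega>: "D = \<Omega>" by (auto simp: period_cell_def)
    have ne: "- \<Omega> \<noteq> {}" using 1(2) not_bounded_UNIV by (metis Compl_empty_eq double_complement)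
    define \<eta> where "\<eta> m x = min 1 (max 0 (real m * infdist x (- \<Omega>) - 1))" for m x
    have \<eta>: "0 \<le> \<eta> m x" "\<eta> m x \<le> 1" for m x by (auto simp: \<eta>_def)
    have c\<eta>: "continuous_on UNIV (\<eta> m)" for m unfolding \<eta>_def by (intro continuous_intros)
    have lim: "(\<lambda>m. \<eta> m x) \<longlonglongrightarrow> 1" if "x \<in> \<Omega>" for x
    proof (rule tendsto_eventually)
      have "infdist x (- \<Omega>) > 0" using in_closed_iff_infdist_zero[of "- \<Omega>" x] ne p(4) that infdist_nonneg[of x "- \<Omega>"] by fastforce
      then obtain m0 :: nat where m0: "2 < real m0 * infdist x (- \<Omega>)" using reals_Archimedean3 by blast
      have "\<eta> m x = 1" if "m0 \<le> m" for m
      proof -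
        have "real m0 * infdist x (- \<Omega>) \<le> real m * infdist x (- \<Omega>)"
          using that infdist_nonneg by (intro mult_right_mono) auto
        then show ?thesis using m0 by (simp add: \<eta>_def)
      qed
      then show "\<forall>\<^sub>F m in sequentially. \<eta> m x = 1" using eventually_sequentially by blast
    qed
    have eq: "(LINT x:\<Omega>|lebesgue. c x \<bullet> (\<eta> m x *\<^sub>R f x)) = (LINT x:\<Omega>|lebesgue. c' x \<bullet> (\<eta> m x *\<^sub>R f x))" for m
    proof -
      define C where "C = {x. 1 \<le> real m * infdist x (- \<Omega>)}"
      have C\<Omega>: "C \<subseteq> \<Omega>"
      proof
        fix x assume "x \<in> C"
        then have "infdist x (- \<Omega>) \<noteq> 0" by (auto simp: C_def)
        then show "x \<in> \<Omega>" using infdist_zero[of x "- \<Omega>"] by blast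
      qed
      have "closed C" unfolding C_def by (intro closed_Collect_le continuous_intros)
      moreover have "bounded C" using C\<Omega> 1(2) bounded_subset by blast
      ultimately have C: "compact C" by (simp add: compact_eq_bounded_closed)
      show ?thesis
      proof (rule weak_unique[OF w li open_\<Omega> C C\<Omega>])
        show "ess_cont \<Omega> (\<lambda>x. \<eta> m x *\<^sub>R f x)"
          using \<eta> by (intro ess_cont_bilinear[OF bounded_bilinear_scaleR _ f] ess_cont_continuous[OF c\<eta>, of _ 1]) auto
        show "\<eta> m x *\<^sub>R f x = 0" if "x \<notin> C" for x using that by (simp add: \<eta>_def C_def)
      qed
    qed
    have conv: "(\<lambda>m. LINT x:\<Omega>|lebesgue. k x \<bullet> (\<eta> m x *\<^sub>R f x)) \<longlonglongrightarrow> (LINT x:\<Omega>|lebesgue. k x \<bullet> f x)"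
      if k: "set_integrable lebesgue \<Omega> (\<lambda>x. k x \<bullet> f x)" for k
      unfolding set_lebesgue_integral_def
    proof (rule integral_dominated_convergence)
      have i: "integrable lebesgue (\<lambda>x. indicat_real \<Omega> x *\<^sub>R (k x \<bullet> f x))" using k by (simp add: set_integrable_def)
      show "(\<lambda>x. indicat_real \<Omega> x *\<^sub>R (k x \<bullet> f x)) \<in> borel_measurable lebesgue" using i by auto
      have "\<eta> m \<in> borel_measurable lebesgue" for m
        using borel_measurable_continuous_onI[OF c\<eta>] by (simp add: measurable_completion)
      then have "(\<lambda>x. \<eta> m x *\<^sub>R (indicat_real \<Omega> x *\<^sub>R (k x \<bullet> f x))) \<in> borel_measurable lebesgue" for m
        by (rule borel_measurable_scaleR[OF _ borel_measurable_integrable[OF i]])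
      then show "(\<lambda>x. indicat_real \<Omega> x *\<^sub>R (k x \<bullet> (\<eta> m x *\<^sub>R f x))) \<in> borel_measurable lebesgue" for m
        by (simp add: mult_ac)
      show "integrable lebesgue (\<lambda>x. norm (indicat_real \<Omega> x *\<^sub>R (k x \<bullet> f x)))" by (rule integrable_norm[OF i])
      show "AE x in lebesgue. (\<lambda>m. indicat_real \<Omega> x *\<^sub>R (k x \<bullet> (\<eta> m x *\<^sub>R f x))) \<longlonglongrightarrow> indicat_real \<Omega> x *\<^sub>R (k x \<bullet> f x)"
      proof (rule AE_I2)
        fix x
        show "(\<lambda>m. indicat_real \<Omega> x *\<^sub>R (k x \<bullet> (\<eta> m x *\<^sub>R f x))) \<longlonglongrightarrow> indicat_real \<Omega> x *\<^sub>R (k x \<bullet> f x)"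
        proof (cases "x \<in> \<Omega>")
          case True
          have "(\<lambda>m. k x \<bullet> (\<eta> m x *\<^sub>R f x)) \<longlonglongrightarrow> k x \<bullet> (1 *\<^sub>R f x)"
            by (intro tendsto_intros lim True)
          then show ?thesis using True by simp
        qed simp
      qed
      show "AE x in lebesgue. norm (indicat_real \<Omega> x *\<^sub>R (k x \<bullet> (\<eta> m x *\<^sub>R f x))) \<le> norm (indicat_real \<Omega> x *\<^sub>R (k x \<bullet> f x))" for m
      proof (rule AE_I2)
        fix x
        have "\<eta> m x * \<bar>k x \<bullet> f x\<bar> \<le> 1 * \<bar>k x \<bullet> f x\<bar>" using \<eta> by (intro mult_right_mono) auto
        then show "norm (indicat_real \<Omega> x *\<^sub>R (k x \<bullet> (\<eta> m x *\<^sub>R f x))) \<le> norm (indicat_real \<Omega> x *\<^sub>R (k x \<bullet> f x))"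
          using \<eta>(1)[of m x] by (simp add: abs_mult indicator_def)
      qed
    qed
    show ?thesis unfolding D\<Omega>
      using LIMSEQ_unique[OF conv[OF int(1)[unfolded D\<Omega>], unfolded eq] conv[OF int(2)[unfolded D\<Omega>]]] .
  next
    case 2
    then have Dc: "D = (\<Union>K\<in>M. cell_set K)" by (simp add: period_cell_def)
    have cD: "compact D" and nD: "negligible (D - interior D)" unfolding Dc by (rule mesh_union[OF mesh])+
    have "ess_cont \<Omega> (indicat_real D)" by (rule ess_cont_indicator[OF compact_imp_closed[OF cD] nD])
    then have e: "ess_cont \<Omega> (\<lambda>x. indicat_real D x *\<^sub>R f x)"
      by (rule ess_cont_bilinear[OF bounded_bilinear_scaleR _ f])
    have "(LINT x:\<Omega>|lebesgue. c x \<bullet> (indicat_real D x *\<^sub>R f x)) = (LINT x:\<Omega>|lebesgue. c' x \<bullet> (indicat_real D x *\<^sub>R f x))"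
      by (rule weak_unique[OF w li open_\<Omega> cD _ e]) (use 2 in auto)
    then show ?thesis using 2 by (simp add: set_lebesgue_integral_def)
  qed
  then show ?thesis by (simp add: ip_def inner_commute)
qed

text \<open>Gauss's theorem for \<open>v \<times> u\<close>, whose divergence is \<open>u \<bullet> curl v - curl u \<bullet> v\<close> and whose normal
  trace \<open>- (u \<bullet> (v \<times> n))\<close> vanishes.\<close>
lemma curl_integration_by_parts:
  assumes u: "u \<in> V1" "has_weak_curl \<Omega> u b" and b: "b \<in> V2"
    and v: "v \<in> V1_bc L M \<Omega> V1" "has_weak_curl \<Omega> v c" "L2 D c"
  shows "ip D u c = ip D v b"
proof -
  have vV: "v \<in> V1" and vt: "zero_tangential_trace L M \<Omega> v" using v(1) by (auto simp: V1_bc_def)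
  obtain c' where c': "c' \<in> V2" "has_weak_curl \<Omega> v c'" using complex vV unfolding discrete_de_Rham_def by blast
  note fu = fe_field[OF spaces(2) u(1)] and fv = fe_field[OF spaces(2) vV]
    and fb = fe_field[OF spaces(3) b] and fc = fe_field[OF spaces(3) c'(1)]
  have eq: "ip D u c = ip D u c'"
    using v(2) c'(2) weak_representative[OF _ _ _ _ fu(3) spaces(5)[OF u(1)] v(3) spaces(6)[OF c'(1)], of cross3 v]
    by (simp add: weak_curl_iff)
  define d where "d x = u x \<bullet> c' x - b x \<bullet> v x" for x
  have "(LINT x:D|lebesgue. d x) = 0"
  proof (rule gauss_zero_flux[OF domain mesh])
    show "periodic L (\<lambda>x. cross3 (v x) (u x))" "periodic L d"
      using fu(1) fv(1) fb(1) fc(1) by (simp_all add: periodic_def d_def)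
    show "ess_cont \<Omega> (\<lambda>x. cross3 (v x) (u x))" by (rule ess_cont_bilinear[OF bounded_bilinear_cross3 fv(3) fu(3)])
    have "ess_cont \<Omega> (\<lambda>x. u x \<bullet> c' x + (- 1) * (b x \<bullet> v x))"
      by (intro ess_cont_add ess_cont_bilinear[OF bounded_bilinear_mult ess_cont_const] ess_cont_bilinear[OF bounded_bilinear_inner]
          fu fv fb fc)
    then show "ess_cont \<Omega> d" by (simp add: d_def[abs_def])
    show "interior_balance \<Omega> (\<lambda>x. cross3 (v x) (u x)) d"
    proof (intro allI impI)
      fix \<eta> g C assume \<eta>: "compact C" "C \<subseteq> \<Omega>" "has_grad \<eta> g" "\<forall>x. x \<notin> C \<longrightarrow> \<eta> x = 0"
      have wu: "weakly cross3 \<Omega> u b" and wv: "weakly (\<lambda>i a. - (- cross3 i a)) \<Omega> v c'"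
        using u(2) c'(2) by (simp_all add: weak_curl_iff)
      have adj: "cross3 i p \<bullet> a = p \<bullet> (- cross3 i a)" for i a p :: vec3
        using cross_triple[of i p a] cross_triple[of p a i] cross_skew[of a i] by (simp add: inner_commute)
      have lin: "linear (cross3 i)" "linear (\<lambda>a. - cross3 i a)" for i
        using bounded_linear.linear[OF bounded_bilinear.bounded_linear_right[OF bounded_bilinear_cross3, of i]]
          linear_compose_neg by auto
      have "(LINT x:\<Omega>|lebesgue. \<eta> x * (u x \<bullet> c' x - b x \<bullet> v x) + (\<Sum>i\<in>Basis. (g x \<bullet> i) * (u x \<bullet> cross3 i (v x)))) = 0"
        by (rule weak_product_rule[OF wu wv adj lin fu(3) fb(3) fv(3) fc(3) open_\<Omega> \<eta>(1-3) \<eta>(4)[rule_format]])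
      moreover have "(\<Sum>i\<in>Basis. (g x \<bullet> i) * (u x \<bullet> cross3 i (v x))) = g x \<bullet> cross3 (v x) (u x)" for x
      proof -
        have eq: "u x \<bullet> cross3 i (v x) = cross3 (v x) (u x) \<bullet> i" for i
          using cross_triple[of i "v x" "u x"] by (simp add: inner_commute)
        show ?thesis unfolding eq by (rule euclidean_inner[symmetric])
      qed
      ultimately show "flux_balance \<Omega> (\<lambda>x. cross3 (v x) (u x)) d \<eta> g" by (simp add: d_def)
    qed
    fix K assume K: "K \<in> all_cells L M"
    show "zero_flux_on L M \<Omega> (\<lambda>x. cross3 (v x) (u x)) K"
    proof (rule product_trace[OF fv(2) fu(2) bounded_bilinear_cross3 _ K])
      fix K F x n assume "K \<in> all_cells L M" "F facet_of fst K" "snd K ` F \<in> boundary_facets L M"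
        "x \<in> snd K ` rel_interior F" "outward_unit_normal \<Omega> x n"
      then have "cross3 (cell_trace K v x) n = 0" using vt unfolding zero_tangential_trace_def by blast
      moreover have "cross3 p q \<bullet> n = - (q \<bullet> cross3 p n)" for p q :: vec3
        using cross_triple[of p q n] cross_triple[of q n p] cross_skew[of n p] by (simp add: inner_commute)
      ultimately show "cross3 (cell_trace K v x) (cell_trace K u x) \<bullet> n = 0" by simp
    qed
  qed
  moreover have "(LINT x:D|lebesgue. d x) = ip D u c' - ip D b v" unfolding d_def ip_def
    by (rule set_integral_diff(2)) (intro L2_inner_integrable spaces u vV b c')+
  ultimately show ?thesis by (simp add: eq ip_commute[of D b])
qed

text \<open>Gauss's theorem for \<open>f b\<close>, whose divergence is \<open>grad f \<bullet> b\<close> because the curl \<open>b\<close> is free of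
  divergence.\<close>
lemma grad_orthogonal:
  assumes f: "f \<in> V0" "has_weak_grad \<Omega> f G" "L2 D G" and b: "b \<in> V2_bc L M \<Omega> V2" "has_weak_curl \<Omega> u b"
  shows "ip D G b = 0"
proof -
  have bV: "b \<in> V2" and bt: "zero_normal_trace L M \<Omega> b" using b(1) by (auto simp: V2_bc_def)
  obtain G' where G': "G' \<in> V1" "has_weak_grad \<Omega> f G'" using complex f(1) unfolding discrete_de_Rham_def by blast
  note ff = fe_field[OF spaces(1) f(1)] and fb = fe_field[OF spaces(3) bV] and fG = fe_field[OF spaces(2) G'(1)]
  have eq: "ip D b G = ip D b G'"
    using f(2) G'(2) weak_representative[OF _ _ _ _ fb(3) spaces(6)[OF bV] f(3) spaces(5)[OF G'(1)], of "\<lambda>i b. - (i \<bullet> b)" f]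
    by (simp add: weak_grad_iff)
  have lin_cross: "linear (cross3 i)" for i
    using bounded_linear.linear[OF bounded_bilinear.bounded_linear_right[OF bounded_bilinear_cross3]] .
  have "weakly (\<lambda>i r. r *\<^sub>R i) \<Omega> b (\<lambda>_. 0 :: real)"
  proof (rule weakly_div_curl[OF _ lin_cross _ fb(3) open_\<Omega>])
    show "weakly cross3 \<Omega> u b" using b(2) by (simp add: weak_curl_iff)
    show "cross3 i j = - cross3 j i" for i j by (rule cross_skew)
  qed
  then have wb: "weakly (\<lambda>i r. - (- (r *\<^sub>R i))) \<Omega> b (\<lambda>_. 0 :: real)" by simp
  have "(LINT x:D|lebesgue. G' x \<bullet> b x) = 0"
  proof (rule gauss_zero_flux[OF domain mesh])
    show "periodic L (\<lambda>x. f x *\<^sub>R b x)" "periodic L (\<lambda>x. G' x \<bullet> b x)"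
      using ff(1) fb(1) fG(1) by (simp_all add: periodic_def)
    show "ess_cont \<Omega> (\<lambda>x. f x *\<^sub>R b x)" "ess_cont \<Omega> (\<lambda>x. G' x \<bullet> b x)"
      by (rule ess_cont_bilinear[OF bounded_bilinear_scaleR ff(3) fb(3)], rule ess_cont_bilinear[OF bounded_bilinear_inner fG(3) fb(3)])
    show "interior_balance \<Omega> (\<lambda>x. f x *\<^sub>R b x) (\<lambda>x. G' x \<bullet> b x)"
    proof (intro allI impI)
      fix \<eta> g C assume \<eta>: "compact C" "C \<subseteq> \<Omega>" "has_grad \<eta> g" "\<forall>x. x \<notin> C \<longrightarrow> \<eta> x = 0"
      have wf: "weakly (\<lambda>i b. - (i \<bullet> b)) \<Omega> f G'" using G'(2) by (simp add: weak_grad_iff)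
      have adj: "- (i \<bullet> p) \<bullet> r = p \<bullet> - (r *\<^sub>R i)" for i p :: vec3 and r :: real
        by (simp add: inner_commute mult.commute)
      have lin: "linear (\<lambda>b. - (i \<bullet> b))" "linear (\<lambda>r. - (r *\<^sub>R i))" for i :: vec3
        by (auto intro!: linearI simp: inner_add_right scaleR_add_left)
      have "(LINT x:\<Omega>|lebesgue. \<eta> x * (f x \<bullet> 0 - G' x \<bullet> b x) + (\<Sum>i\<in>Basis. (g x \<bullet> i) * (f x \<bullet> - (i \<bullet> b x)))) = 0"
        by (rule weak_product_rule[OF wf wb adj lin ff(3) fG(3) fb(3) ess_cont_const open_\<Omega> \<eta>(1-3) \<eta>(4)[rule_format]])
      moreover have "\<eta> x * (f x \<bullet> 0 - G' x \<bullet> b x) + (\<Sum>i\<in>Basis. (g x \<bullet> i) * (f x \<bullet> - (i \<bullet> b x)))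
          = - (\<eta> x * (G' x \<bullet> b x) + g x \<bullet> (f x *\<^sub>R b x))" for x
      proof -
        have "(\<Sum>i\<in>Basis. (g x \<bullet> i) * (f x \<bullet> - (i \<bullet> b x))) = - (f x * (g x \<bullet> b x))"
          unfolding euclidean_inner[of "g x" "b x"] sum_distrib_left sum_negf[symmetric]
          by (intro sum.cong refl) (simp add: inner_commute)
        then show ?thesis by simp
      qed
      ultimately show "flux_balance \<Omega> (\<lambda>x. f x *\<^sub>R b x) (\<lambda>x. G' x \<bullet> b x) \<eta> g"
        by (simp only: set_lebesgue_integral_def scaleR_minus_right Bochner_Integration.integral_minus)
    qed
    fix K assume K: "K \<in> all_cells L M"
    show "zero_flux_on L M \<Omega> (\<lambda>x. f x *\<^sub>R b x) K"
    proof (rule product_trace[OF ff(2) fb(2) bounded_bilinear_scaleR _ K])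
      fix K F x n assume "K \<in> all_cells L M" "F facet_of fst K" "snd K ` F \<in> boundary_facets L M"
        "x \<in> snd K ` rel_interior F" "outward_unit_normal \<Omega> x n"
      then have "cell_trace K b x \<bullet> n = 0" using bt unfolding zero_normal_trace_def by blast
      then show "(cell_trace K f x *\<^sub>R cell_trace K b x) \<bullet> n = 0" by simp
    qed
  qed
  then show ?thesis using eq by (simp add: ip_def inner_commute)
qed

text \<open>The traces of the zero field are zero because the limits defining them are taken along
  nontrivial filters.\<close>
lemma stabilization_zero:
  assumes "side_labelling L M \<Gamma> Kp Km"
  shows "facet_stabilization \<Gamma> Kp Km \<kappa> (\<lambda>_. 0) v = 0"
proof -
  have tr: "cell_trace K (\<lambda>_. 0 :: vec3) x = 0" if K: "K \<in> all_cells L M" "e \<in> cell_facets K" "x \<in> e" for K e x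
  proof -
    have "x \<in> cell_set K" using K(2,3) facet_of_imp_subset by (fastforce simp: cell_facets_def cell_set_def)
    then show ?thesis unfolding cell_trace_def
      by (intro tendsto_Lim cell_interior_accumulates[OF mesh K(1)] tendsto_const)
  qed
  have "jump Kp Km e (\<lambda>_. 0) x = 0" if "e \<in> \<Gamma>" "x \<in> e" for e x
    using assms that tr unfolding jump_def side_labelling_def by (metis diff_self)
  then have "(LINT x:e|surface_measure. (facet_area e)\<^sup>2 * \<kappa> * (jump Kp Km e (\<lambda>_. 0) x \<bullet> jump Kp Km e v x)) = 0"
    if "e \<in> \<Gamma>" for e
    unfolding set_lebesgue_integral_def
    using that by (intro integral_eq_zero_AE AE_I2) (auto simp: indicator_def)
  then show ?thesis unfolding facet_stabilization_def by (intro sum.neutral) blast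
qed

end


theorem mainTheorem5:
  fixes L \<Omega> :: "vec3 set" and M :: "cell set"
    and V0 V3 :: "scalar_field set" and V1 V2 :: "vector_field set"
    and \<Gamma> :: "vec3 set set" and Kp Km :: "vec3 set \<Rightarrow> cell"
    and \<kappa>\<^sub>B \<mu>\<^sub>0 :: real and I :: "real set"
    and F B \<B> E j A :: "real \<Rightarrow> vector_field" and n \<Phi> :: "real \<Rightarrow> scalar_field"
  defines "D \<equiv> period_cell M \<Omega>"
  assumes domain: "spatial_domain L \<Omega>"
    and mesh: "fe_mesh L M \<Omega>"
    and complex: "discrete_de_Rham L M \<Omega> V0 V1 V2 V3"
    and facets: "facet_representatives L M \<Gamma>" "side_labelling L M \<Gamma> Kp Km"
    and mu: "\<mu>\<^sub>0 > 0"
    and time: "is_interval I"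
    and flux: "\<And>t. t \<in> I \<Longrightarrow> F t \<in> V2_bc L M \<Omega> V2"
    and density: "\<And>t. t \<in> I \<Longrightarrow> n t \<in> V3" "\<And>t. t \<in> I \<Longrightarrow> AE x in lebesgue. x \<in> D \<longrightarrow> n t x > 0"
    and B_space: "\<And>t. t \<in> I \<Longrightarrow> B t \<in> V2_bc L M \<Omega> V2"
    and E_space: "\<And>t. t \<in> I \<Longrightarrow> E t \<in> V1_bc L M \<Omega> V1"
    and j_space: "\<And>t. t \<in> I \<Longrightarrow> j t \<in> V1_bc L M \<Omega> V1"
    and projection: "\<And>t. t \<in> I \<Longrightarrow> is_L2_projection D (V1_bc L M \<Omega> V1) (B t) (\<B> t)"
    and faraday: "\<And>t. t \<in> I \<Longrightarrow>
      \<exists>C. has_weak_curl \<Omega> (E t) C \<and> has_time_derivative D I B t (\<lambda>x. - C x)"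
    and current: "\<And>t \<Sigma> C. t \<in> I \<Longrightarrow> \<Sigma> \<in> V1_bc L M \<Omega> V1 \<Longrightarrow> has_weak_curl \<Omega> \<Sigma> C \<Longrightarrow>
      ip D \<Sigma> (j t) = ip D C (\<lambda>x. (1 / \<mu>\<^sub>0) *\<^sub>R B t x)"
    and ohm: "\<And>t \<omega>. t \<in> I \<Longrightarrow> \<omega> \<in> V1_bc L M \<Omega> V1 \<Longrightarrow>
      ip D \<omega> (E t) =
        ip D \<omega> (\<lambda>x. cross3 (- ((1 / n t x) *\<^sub>R F t x)) (\<B> t x)) +
        facet_stabilization \<Gamma> Kp Km \<kappa>\<^sub>B
          (\<lambda>x. cross3 (\<B> t x) (\<omega> x)) (\<lambda>x. cross3 (\<B> t x) (j t x))"
    and A_space: "\<And>t. t \<in> I \<Longrightarrow> A t \<in> V1"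
    and Phi_space: "\<And>t. t \<in> I \<Longrightarrow> \<Phi> t \<in> V0"
    and A_curl: "\<And>t. t \<in> I \<Longrightarrow> has_weak_curl \<Omega> (A t) (B t)"
    and A_evolution: "\<And>t. t \<in> I \<Longrightarrow>
      \<exists>G. has_weak_grad \<Omega> (\<Phi> t) G \<and> has_time_derivative D I A t (\<lambda>x. - E t x + G x)"
  shows "\<forall>t\<in>I. ((\<lambda>s. ip D (A s) (B s)) has_real_derivative 0) (at t within I)"
proof
  fix t assume t: "t \<in> I"
  interpret de_Rham_mesh L \<Omega> M V0 V3 V1 V2 by unfold_locales (fact domain mesh complex)+
  have BV: "B s \<in> V2" if "s \<in> I" for s using B_space[OF that] by (simp add: V2_bc_def)
  have EV: "E t \<in> V1" using E_space[OF t] by (simp add: V1_bc_def)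
  obtain C where C: "has_weak_curl \<Omega> (E t) C" "has_time_derivative D I B t (\<lambda>x. - C x)" using faraday[OF t] by blast
  obtain G where G: "has_weak_grad \<Omega> (\<Phi> t) G" "has_time_derivative D I A t (\<lambda>x. - E t x + G x)"
    using A_evolution[OF t] by blast
  have LA: "L2 D (A s)" and LB: "L2 D (B s)" if "s \<in> I" for s
    unfolding D_def using spaces(5)[OF A_space[OF that]] spaces(6)[OF BV[OF that]] by auto
  have LE: "L2 D (E t)" unfolding D_def by (rule spaces(5)[OF EV])
  have LC: "L2 D C" using L2_minus[of D "\<lambda>x. - C x"] C(2) by (simp add: has_time_derivative_def)
  have LG: "L2 D G" using L2_add[OF LE, of "\<lambda>x. - E t x + G x"] G(2) by (simp add: has_time_derivative_def)
  have AC: "ip D (A t) C = ip D (E t) (B t)"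
    unfolding D_def
    by (rule curl_integration_by_parts[OF A_space[OF t] A_curl[OF t] BV[OF t] E_space[OF t] C(1) LC[unfolded D_def]])
  have GB: "ip D G (B t) = 0"
    unfolding D_def by (rule grad_orthogonal[OF Phi_space[OF t] G(1) LG[unfolded D_def] B_space[OF t] A_curl[OF t]])
  have P: "\<B> t \<in> V1_bc L M \<Omega> V1" "ip D (E t) (\<B> t) = ip D (E t) (B t)"
    using projection[OF t] E_space[OF t] by (auto simp: is_L2_projection_def)
  have "ip D (\<B> t) (E t) = ip D (\<B> t) (\<lambda>x. cross3 (- ((1 / n t x) *\<^sub>R F t x)) (\<B> t x)) +
      facet_stabilization \<Gamma> Kp Km \<kappa>\<^sub>B (\<lambda>x. cross3 (\<B> t x) (\<B> t x)) (\<lambda>x. cross3 (\<B> t x) (j t x))"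
    by (rule ohm[OF t P(1)])
  also have "\<dots> = 0"
    using stabilization_zero[OF facets(2)] by (simp add: ip_def dot_cross_self)
  finally have EB: "ip D (E t) (B t) = 0" using P(2) by (simp add: ip_commute[of D "\<B> t"])
  have "((\<lambda>s. ip D (A s) (B s)) has_real_derivative
      (ip D (\<lambda>x. - E t x + G x) (B t) + ip D (A t) (\<lambda>x. - C x))) (at t within I)"
    by (rule ip_has_derivative[OF LA G(2) LB C(2) t])
  moreover have "ip D (\<lambda>x. - E t x + G x) (B t) = 0"
    using ip_add_left[OF L2_minus[OF LE] LG LB[OF t]] by (simp add: ip_minus_left EB GB)
  moreover have "ip D (A t) (\<lambda>x. - C x) = 0" by (simp add: ip_minus_right AC EB)
  ultimately show "((\<lambda>s. ip D (A s) (B s)) has_real_derivative 0) (at t within I)" by simp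
qed

end
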